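(* (Legendre's condition.) Suppose that $\mathbf{n}\in\mathcal{A}\cap W^{1,\infty}(\Omega,M)$ is a weak local minimizer of $I$. Then for a.e. $x\in\Omega$, all $\eta\in\mathbb{R}^d$ and all $\zeta\in\mathbb{R}^k$, $$\sum_{i,r=1}^{k}\sum_{j,l=1}^{d}\frac{\partial^2F}{\partial \mathbf{n}_{i,j}\,\partial\mathbf{n}_{r,l}}\big(x,\mathbf{n}(x),\nabla\mathbf{n}(x)\big)\,\eta_j\,\eta_l\,\big[\nabla P(\mathbf{n}(x))\zeta\big]_i\big[\nabla P(\mathbf{n}(x))\zeta\big]_r\geqslant 0,$$ where $\partial/\partial\mathbf{n}_{i,j}$ denotes the partial derivative of $F$ with respect to the $(i,j)$ entry of its matrix (gradient) argument.
   Context: $\Omega\subset\mathbb{R}^d$ is a bounded Lipschitz domain whose boundary has two disjoint, relatively open, measurable components $\partial\Omega_1,\partial\Omega_2$ with $\partial\Omega=\overline{\partial\Omega_1}\cup\overline{\partial\Omega_2}$. $M\subset\mathbb{R}^k$ is a closed, bounded manifold of class $C^4$. There is an open set $U\supset M$ on which the nearest point projection $P:U\to M$ is uniquely defined and of class $C^3$; $\nabla P$ denotes its $k\times k$ derivative matrix. For $1\leqslant p\leqslant\infty$, $W^{1,p}(\Omega,M)=\{\mathbf{n}\in W^{1,p}(\Omega,\mathbb{R}^k): \mathbf{n}(x)\in M\text{ a.e.}\}$. Given $\mathbf{n}_0\in W^{1,1}(\Omega,M)$, the admissible set is $\mathcal{A}=\{\mathbf{n}\in W^{1,1}(\Omega,M):\mathbf{n}=\mathbf{n}_0\text{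 on }\partial\Omega_1\}$. The functional is $I(\mathbf{n})=\int_\Omega F(x,\mathbf{n}(x),\nabla\mathbf{n}(x))\,dx$, where $F\in C(\overline{\Omega}\times M\times\mathbb{R}^{k\times d})$ and there is an open neighbourhood $O$ of $M$ (with $O\subset U$) such that $F(x,\cdot,\cdot)\in C^2(O\times\mathbb{R}^{k\times d})$ for every $x\in\Omega$. $\mathbf{n}\in\mathcal{A}$ is a weak local minimizer of $I$ if there is $\epsilon>0$ such that $I(\mathbf{m})\geqslant I(\mathbf{n})$ for all $\mathbf{m}\in\mathcal{A}$ with $\|\mathbf{n}-\mathbf{m}\|_{1,\infty}<\epsilon$, where $\|\cdot\|_{1,\infty}$ is the $W^{1,\infty}$ norm. *)

theory Defs
  imports "HOL-Analysis.Analysis" "HOL-Probability.Essential_Supremum"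
begin

section \<open>Functions of class \<open>C\<^sup>r\<close>\<close>

text \<open>To be used for open \<open>S\<close> only. Since the domain is finite-dimensional, the derivative is
  of class \<open>C\<^sup>r\<close> iff all its evaluations at fixed directions are.\<close>

primrec Ck_on :: "nat \<Rightarrow> ('a::euclidean_space \<Rightarrow> 'b::real_normed_vector) \<Rightarrow> 'a set \<Rightarrow> bool" where
  "Ck_on 0 f S \<longleftrightarrow> continuous_on S f"
| "Ck_on (Suc r) f S \<longleftrightarrow>
     (\<forall>x\<in>S. f differentiable (at x)) \<and>
     (\<forall>v. Ck_on r (\<lambda>x. frechet_derivative f (at x) v) S)"

definition test_function :: "'a::euclidean_space set \<Rightarrow> ('a \<Rightarrow> real) \<Rightarrow> bool" where
  "test_function \<Omega> \<phi> \<longleftrightarrow>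
     (\<forall>r. Ck_on r \<phi> UNIV) \<and> (\<exists>K. compact K \<and> K \<subseteq> \<Omega> \<and> (\<forall>x. x \<notin> K \<longrightarrow> \<phi> x = 0))"


section \<open>Domains and target manifolds\<close>

text \<open>Near each boundary point, \<open>\<Omega>\<close> is the strict epigraph, in some direction \<open>e\<close>, of a
  Lipschitz function on the hyperplane orthogonal to \<open>e\<close>.\<close>

definition lipschitz_domain :: "'a::euclidean_space set \<Rightarrow> bool" where
  "lipschitz_domain \<Omega> \<longleftrightarrow>
     open \<Omega> \<and> connected \<Omega> \<and> \<Omega> \<noteq> {} \<and>
     (\<forall>p\<in>frontier \<Omega>. \<exists>r>0. \<exists>e \<gamma> L. norm e = 1 \<and>
        L-lipschitz_on {y. y \<bullet> e = 0} (\<gamma> :: 'a \<Rightarrow> real) \<and>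
        \<Omega> \<inter> ball p r = {x \<in> ball p r. x \<bullet> e > \<gamma> (x - (x \<bullet> e) *\<^sub>R e)})"

text \<open>Embedded submanifolds without boundary, of dimension \<open>m\<close> and class \<open>C\<^sup>r\<close>, given by
  flattening charts \<open>\<Phi>\<close> with inverse \<open>\<Psi>\<close>.\<close>

definition submanifold :: "nat \<Rightarrow> nat \<Rightarrow> 'a::euclidean_space set \<Rightarrow> bool" where
  "submanifold r m M \<longleftrightarrow>
     (\<forall>p\<in>M. \<exists>V \<Phi> \<Psi> T. open V \<and> p \<in> V \<and> open (\<Phi> ` V) \<and>
        Ck_on r \<Phi> V \<and> Ck_on r \<Psi> (\<Phi> ` V) \<and> (\<forall>x\<in>V. \<Psi> (\<Phi> x) = x) \<and>
        subspace T \<and> dim T = m \<and> \<Phi> ` (V \<inter> M) = \<Phi> ` V \<inter> (T :: 'a set))"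

definition nearest_point_projection ::
  "'a::euclidean_space set \<Rightarrow> 'a set \<Rightarrow> ('a \<Rightarrow> 'a) \<Rightarrow> bool" where
  "nearest_point_projection M U P \<longleftrightarrow>
     (\<forall>y\<in>U. P y \<in> M \<and> (\<forall>z\<in>M. z \<noteq> P y \<longrightarrow> dist y (P y) < dist y z))"


section \<open>Lebesgue and Sobolev spaces\<close>

text \<open>An \<open>L\<^sup>p\<close> norm with values in \<open>[0,\<infinity>]\<close>. Note that \<open>esssup\<close> is \<open>\<infinity>\<close> on nonmeasurable
  functions.\<close>

definition Lp_norm :: "'a::euclidean_space set \<Rightarrow> ennreal \<Rightarrow> ('a \<Rightarrow> 'b::real_normed_vector) \<Rightarrow> ennreal"
  where "Lp_norm \<Omega> p u =
     (if p = \<infinity> then esssup (lebesgue_on \<Omega>) (\<lambda>x. ennreal (norm (u x)))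
      else let J = \<integral>\<^sup>+x. ennreal (norm (u x) powr enn2real p) \<partial>lebesgue_on \<Omega>
           in if J = \<infinity> then \<infinity> else ennreal (enn2real J powr (1 / enn2real p)))"

definition Lp_space :: "'a::euclidean_space set \<Rightarrow> ennreal \<Rightarrow> ('a \<Rightarrow> 'b::real_normed_vector) set"
  where "Lp_space \<Omega> p = {u \<in> borel_measurable (lebesgue_on \<Omega>). Lp_norm \<Omega> p u < \<infinity>}"

definition locally_integrable :: "'a::euclidean_space set \<Rightarrow> ('a \<Rightarrow> 'b::euclidean_space) \<Rightarrow> bool"
  where "locally_integrable \<Omega> u \<longleftrightarrow>
     (\<forall>K. compact K \<longrightarrow> K \<subseteq> \<Omega> \<longrightarrow> integrable (lebesgue_on K) u)"

definition has_weak_gradient ::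
  "(real^'d) set \<Rightarrow> (real^'d \<Rightarrow> real^'k) \<Rightarrow> (real^'d \<Rightarrow> real^'d^'k) \<Rightarrow> bool" where
  "has_weak_gradient \<Omega> u G \<longleftrightarrow>
     locally_integrable \<Omega> u \<and> locally_integrable \<Omega> G \<and>
     (\<forall>\<phi> i j. test_function \<Omega> \<phi> \<longrightarrow>
        (LINT x|lebesgue_on \<Omega>. u x $ i * frechet_derivative \<phi> (at x) (axis j 1)) =
        - (LINT x|lebesgue_on \<Omega>. G x $ i $ j * \<phi> x))"

text \<open>Well defined up to null sets, for weakly differentiable \<open>u\<close>.\<close>

definition weak_gradient :: "(real^'d) set \<Rightarrow> (real^'d \<Rightarrow> real^'k) \<Rightarrow> real^'d \<Rightarrow> real^'d^'k" where
  "weak_gradient \<Omega> u = (SOME G. has_weak_gradient \<Omega> u G)"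

definition W1 :: "(real^'d) set \<Rightarrow> ennreal \<Rightarrow> (real^'d \<Rightarrow> real^'k) set" where
  "W1 \<Omega> p = {u \<in> Lp_space \<Omega> p. \<exists>G \<in> Lp_space \<Omega> p. has_weak_gradient \<Omega> u G}"

definition W1_norm :: "(real^'d) set \<Rightarrow> ennreal \<Rightarrow> (real^'d \<Rightarrow> real^'k) \<Rightarrow> ennreal" where
  "W1_norm \<Omega> p u = Lp_norm \<Omega> p u + Lp_norm \<Omega> p (weak_gradient \<Omega> u)"

definition W1_into ::
  "(real^'d) set \<Rightarrow> ennreal \<Rightarrow> (real^'k) set \<Rightarrow> (real^'d \<Rightarrow> real^'k) set" where
  "W1_into \<Omega> p M = {u \<in> W1 \<Omega> p. AE x in lebesgue_on \<Omega>. u x \<in> M}"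


section \<open>Boundary values\<close>

text \<open>The \<open>s\<close>-dimensional Hausdorff measure, normalised to agree with Lebesgue measure for
  \<open>s\<close> the dimension of the space. Nonempty covering sets of diameter \<open>0\<close> count as \<open>1\<close> for \<open>s = 0\<close>.\<close>

definition hausdorff_premeasure :: "nat \<Rightarrow> real \<Rightarrow> 'a::metric_space set \<Rightarrow> ennreal" where
  "hausdorff_premeasure s \<delta> A =
     (INF C \<in> {C :: nat \<Rightarrow> 'a set. A \<subseteq> (\<Union>i. C i) \<and> (\<forall>i. bounded (C i) \<and> diameter (C i) \<le> \<delta>)}.
        \<Sum>i. if C i = {} then 0
            else ennreal (unit_ball_vol (real s) * (diameter (C i) / 2) ^ s))"

text \<open>The outer measure below is countably additive on Borel sets by Caratheodory's criterion.\<close>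

definition hausdorff_measure :: "nat \<Rightarrow> 'a::metric_space measure" where
  "hausdorff_measure s =
     measure_of UNIV (sets borel) (\<lambda>A. SUP \<delta>\<in>{0<..}. hausdorff_premeasure s \<delta> A)"

abbreviation surface_measure :: "(real^'d) measure" where
  "surface_measure \<equiv> hausdorff_measure (CARD('d) - 1)"

text \<open>\<open>g\<close> is the trace of \<open>u \<in> W\<^sup>1\<^sup>,\<^sup>1(\<Omega>)\<close> on the boundary. The trace operator is the continuous
  extension to \<open>W\<^sup>1\<^sup>,\<^sup>1(\<Omega>)\<close>, with values in \<open>L\<^sup>1\<close> of the boundary, of the restriction map on
  functions continuous up to the boundary; this is its graph.\<close>

definition has_trace :: "(real^'d) set \<Rightarrow> (real^'d \<Rightarrow> real^'k) \<Rightarrow> (real^'d \<Rightarrow> real^'k) \<Rightarrow> bool" where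
  "has_trace \<Omega> u g \<longleftrightarrow> u \<in> W1 \<Omega> 1 \<and> g \<in> borel_measurable borel \<and>
     (\<exists>w :: nat \<Rightarrow> real^'d \<Rightarrow> real^'k.
        (\<forall>i. w i \<in> W1 \<Omega> 1 \<and> continuous_on (closure \<Omega>) (w i)) \<and>
        (\<lambda>i. W1_norm \<Omega> 1 (\<lambda>x. w i x - u x)) \<longlonglongrightarrow> 0 \<and>
        (\<lambda>i. \<integral>\<^sup>+x\<in>frontier \<Omega>. ennreal (norm (w i x - g x)) \<partial>surface_measure) \<longlonglongrightarrow> 0)"

definition trace_eq_on ::
  "(real^'d) set \<Rightarrow> (real^'d) set \<Rightarrow> (real^'d \<Rightarrow> real^'k) \<Rightarrow> (real^'d \<Rightarrow> real^'k) \<Rightarrow> bool" where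
  "trace_eq_on \<Omega> \<Gamma> u v \<longleftrightarrow>
     (\<exists>g h. has_trace \<Omega> u g \<and> has_trace \<Omega> v h \<and> (AE x in surface_measure. x \<in> \<Gamma> \<longrightarrow> g x = h x))"


section \<open>The variational problem\<close>

definition admissible ::
  "(real^'d) set \<Rightarrow> (real^'d) set \<Rightarrow> (real^'k) set \<Rightarrow> (real^'d \<Rightarrow> real^'k) \<Rightarrow>
    (real^'d \<Rightarrow> real^'k) set" where
  "admissible \<Omega> \<Gamma> M n\<^sub>0 = {n \<in> W1_into \<Omega> 1 M. trace_eq_on \<Omega> \<Gamma> n n\<^sub>0}"

definition energy ::
  "(real^'d) set \<Rightarrow> (real^'d \<Rightarrow> real^'k \<Rightarrow> real^'d^'k \<Rightarrow> real) \<Rightarrow> (real^'d \<Rightarrow> real^'k) \<Rightarrow> real" where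
  "energy \<Omega> F n = (LINT x|lebesgue_on \<Omega>. F x (n x) (weak_gradient \<Omega> n x))"

text \<open>If \<open>n \<in> W\<^sup>1\<^sup>,\<^sup>\<infinity>\<close>, \<open>M\<close> is compact and \<open>F\<close> is continuous, then every competitor \<open>m\<close> has bounded
  integrand, so the Bochner integrals compared here are genuine.\<close>

definition weak_local_minimizer ::
  "(real^'d) set \<Rightarrow> (real^'d) set \<Rightarrow> (real^'k) set \<Rightarrow> (real^'d \<Rightarrow> real^'k) \<Rightarrow>
    (real^'d \<Rightarrow> real^'k \<Rightarrow> real^'d^'k \<Rightarrow> real) \<Rightarrow> (real^'d \<Rightarrow> real^'k) \<Rightarrow> bool" where
  "weak_local_minimizer \<Omega> \<Gamma> M n\<^sub>0 F n \<longleftrightarrow>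
     n \<in> admissible \<Omega> \<Gamma> M n\<^sub>0 \<and>
     (\<exists>\<epsilon>>0. \<forall>m \<in> admissible \<Omega> \<Gamma> M n\<^sub>0.
        W1_norm \<Omega> \<infinity> (\<lambda>x. n x - m x) < ennreal \<epsilon> \<longrightarrow> energy \<Omega> F m \<ge> energy \<Omega> F n)"

definition entry_deriv :: "'k \<Rightarrow> 'd \<Rightarrow> (real^'d^'k \<Rightarrow> real) \<Rightarrow> real^'d^'k \<Rightarrow> real" where
  "entry_deriv i j f A = deriv (\<lambda>t. f (A + t *\<^sub>R axis i (axis j 1))) 0"

end

theory Submission
  imports Defs
begin

text \<open>
  The classical derivation of Legendre's condition integrates the second variation. Here \<open>F\<close> is merely
  continuous in \<open>x\<close>, nothing bounds its second derivatives uniformly in \<open>x\<close>, and this integral need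
  not exist. The proof works with energies only: it perturbs \<open>n\<close> by oscillations of ever shorter wave
  length, whose gradients keep a fixed small amplitude, and takes derivatives of \<open>F\<close> only at the very end,
  at a single point \<open>x\<close>.

  For a smooth cutoff \<open>\<kappa>\<close>, put \<open>\<psi> x = \<kappa> x * \<delta> / N * cos (N * (x \<bullet> \<eta>) + \<theta>)\<close>. The competitor \<open>P (n + \<psi> \<zeta>)\<close> takes values in
  \<open>M\<close>. As \<open>N\<close> grows, it tends to \<open>n\<close> uniformly, and its gradient is uniformly asymptotic to
  \<open>\<nabla>n - \<delta> \<kappa> sin (N * (x \<bullet> \<eta>) + \<theta>) (w \<otimes> \<eta>)\<close> with \<open>w = \<nabla>P(n) \<zeta>\<close>, because \<open>\<nabla>P(n) \<nabla>n = \<nabla>n\<close>. By continuity of \<open>F\<close>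
  the energy densities are asymptotic as well (\<open>oscillation_energy_density\<close>), and for small \<open>\<delta>\<close> and large \<open>N\<close> the
  competitor is one of those with which \<open>n\<close> is compared (\<open>small_oscillation\<close>). Summing over the phases
  \<open>0\<close>, \<open>\<pi>/2\<close>, \<open>\<pi>\<close>, \<open>3\<pi>/2\<close> produces, where \<open>\<kappa> = 1\<close>, a sum of second differences of \<open>s \<mapsto> F x n (\<nabla>n + s (w \<otimes> \<eta>))\<close>
  with steps \<open>\<delta> sin y\<close> and \<open>\<delta> cos y\<close>, where \<open>y = N * (x \<bullet> \<eta>)\<close>. Not both steps vanish. Where the Legendre form is
  negative, the second differences are therefore negative for all small \<open>\<delta>\<close>, uniformly in \<open>y\<close>. If
  this happened on a set of positive measure, then also, with one bound and one \<open>\<delta>\<close>, on a compact set \<open>K\<close> of positive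
  measure; with a cutoff supported close enough to \<open>K\<close>, the four competitors together would have less than four
  times the energy of \<open>n\<close> (\<open>compact_negative_second_difference_null\<close>).

  It remains to know that the competitor is admissible and to know its gradient. A map with bounded weak gradient
  is locally Lipschitz after a change on a null set (\<open>has_weak_gradient_lipschitz_representative\<close>); for Lipschitz
  maps the chain rule follows from the weak convergence of difference quotients (\<open>weak_derivative_chain\<close>); and
  weak gradients on overlapping open sets can be glued (\<open>has_weak_gradient_Un\<close>). The difference between competitor and \<open>n\<close>
  is continuous with compact support, which preserves the boundary values (\<open>has_trace_perturb\<close>). All this
  rests on a sufficient supply of test functions (\<open>smooth_urysohn\<close>) and on the fundamental lemma of the calculus of
  variations (\<open>locally_integrable_nonnegI\<close>).
\<close>

section \<open>Calculus of \<open>C\<^sup>r\<close> functions\<close>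

lemma Ck_on_cong:
  assumes "open S" "\<And>x. x \<in> S \<Longrightarrow> f x = g x" "Ck_on r f S"
  shows "Ck_on r g S"
  using assms(2,3)
proof (induction r arbitrary: f g)
  case 0
  then show ?case by (auto intro: continuous_on_eq)
next
  case (Suc r)
  have d: "(g has_derivative frechet_derivative f (at x)) (at x)" if "x \<in> S" for x
  proof -
    have "(f has_derivative frechet_derivative f (at x)) (at x)"
      using Suc.prems(2) that frechet_derivative_works by auto
    then show ?thesis
      using has_derivative_transform_within_open[OF _ assms(1) that] Suc.prems(1) by blast
  qed
  have eq: "frechet_derivative f (at x) v = frechet_derivative g (at x) v" if "x \<in> S" for x v
    using frechet_derivative_at[OF d[OF that]] by simp
  have "Ck_on r (\<lambda>x. frechet_derivative g (at x) v) S" for v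
    by (rule Suc.IH[of "\<lambda>x. frechet_derivative f (at x) v"]) (use eq Suc.prems in auto)
  with d show ?case by (auto simp: differentiable_def)
qed

text \<open>Any pointwise choice of derivatives can replace the chosen one of the definition; all
  concrete functions below are shown to be of class \<open>C\<^sup>r\<close> in this way.\<close>

lemma Ck_on_SucI:
  assumes "open S" "\<And>x. x \<in> S \<Longrightarrow> (f has_derivative f' x) (at x)" "\<And>v. Ck_on r (\<lambda>x. f' x v) S"
  shows "Ck_on (Suc r) f S"
proof -
  have "Ck_on r (\<lambda>x. frechet_derivative f (at x) v) S" for v
    by (rule Ck_on_cong[OF assms(1) _ assms(3)[of v]]) (simp add: frechet_derivative_at[OF assms(2), symmetric])
  with assms(2) show ?thesis by (auto simp: differentiable_def)
qed

lemma Ck_on_SucD: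
  assumes "Ck_on (Suc r) f S" "x \<in> S"
  shows "(f has_derivative frechet_derivative f (at x)) (at x)"
  using assms frechet_derivative_works by auto

lemma Ck_on_imp_continuous_on: "Ck_on r f S \<Longrightarrow> continuous_on S f"
  by (cases r) (auto intro!: continuous_at_imp_continuous_on differentiable_imp_continuous_within)

lemma Ck_on_pred: "open S \<Longrightarrow> Ck_on (Suc r) f S \<Longrightarrow> Ck_on r f S"
proof (induction r arbitrary: f)
  case 0 then show ?case using Ck_on_imp_continuous_on[of "Suc 0"] by simp
next
  case (Suc r)
  then show ?case
    by (intro Ck_on_SucI[of S f "\<lambda>x. frechet_derivative f (at x)"]) (auto simp: frechet_derivative_works)
qed

lemma Ck_on_const: "open S \<Longrightarrow> Ck_on r (\<lambda>x. c) S"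
proof (induction r arbitrary: c)
  case (Suc r)
  show ?case
    by (rule Ck_on_SucI[OF Suc.prems, where f' = "\<lambda>x v. 0"]) (auto intro: Suc)
qed auto

lemma Ck_on_bounded_linear: "open S \<Longrightarrow> bounded_linear f \<Longrightarrow> Ck_on r f S"
proof (cases r)
  case (Suc r')
  assume a: "open S" "bounded_linear f"
  show ?thesis unfolding Suc
    by (rule Ck_on_SucI[OF a(1), where f' = "\<lambda>x v. f v"])
       (auto intro: bounded_linear_imp_has_derivative a Ck_on_const)
qed (auto intro: linear_continuous_on)

lemma Ck_on_add: "open S \<Longrightarrow> Ck_on r f S \<Longrightarrow> Ck_on r g S \<Longrightarrow> Ck_on r (\<lambda>x. f x + g x) S"
proof (induction r arbitrary: f g)
  case (Suc r)
  show ?case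
    by (rule Ck_on_SucI[OF Suc.prems(1),
          where f' = "\<lambda>x v. frechet_derivative f (at x) v + frechet_derivative g (at x) v"])
       (use Suc in \<open>auto intro!: has_derivative_add Suc.IH simp: frechet_derivative_works\<close>)
qed (auto intro: continuous_on_add)

lemma Ck_on_mult:
  fixes f g :: "'a::euclidean_space \<Rightarrow> real"
  shows "open S \<Longrightarrow> Ck_on r f S \<Longrightarrow> Ck_on r g S \<Longrightarrow> Ck_on r (\<lambda>x. f x * g x) S"
proof (induction r arbitrary: f g)
  case (Suc r)
  have p: "Ck_on r f S" "Ck_on r g S" 
    using Ck_on_pred[OF Suc.prems(1)] Suc.prems(2,3) by blast+
  have q: "Ck_on r (\<lambda>x. frechet_derivative f (at x) v) S"
          "Ck_on r (\<lambda>x. frechet_derivative g (at x) v) S" for v using Suc.prems by auto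
  show ?case
  proof (rule Ck_on_SucI[OF Suc.prems(1),
          where f' = "\<lambda>x v. f x * frechet_derivative g (at x) v + frechet_derivative f (at x) v * g x"])
    show "((\<lambda>x. f x * g x) has_derivative
         (\<lambda>v. f x * frechet_derivative g (at x) v + frechet_derivative f (at x) v * g x)) (at x)"
      if "x \<in> S" for x
      by (rule has_derivative_mult[OF Ck_on_SucD[OF Suc.prems(2) that] Ck_on_SucD[OF Suc.prems(3) that]])
  qed (intro Ck_on_add Suc.IH Suc.prems(1) p q)
qed (auto intro: continuous_on_mult)

lemma Ck_on_compose_real:
  fixes h :: "real \<Rightarrow> real" and g :: "'a::euclidean_space \<Rightarrow> real"
  assumes "open S" "open T" "g ` S \<subseteq> T"
  shows "Ck_on r h T \<Longrightarrow> Ck_on r g S \<Longrightarrow> Ck_on r (\<lambda>x. h (g x)) S"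
proof (induction r arbitrary: h)
  case 0
  then show ?case using assms by (auto intro: continuous_on_compose2)
next
  case (Suc r)
  show ?case
  proof (rule Ck_on_SucI[OF assms(1),
          where f' = "\<lambda>x v. frechet_derivative h (at (g x)) 1 * frechet_derivative g (at x) v"])
    fix x assume x: "x \<in> S"
    have dh: "(h has_derivative frechet_derivative h (at (g x))) (at (g x))"
      using Ck_on_SucD[OF Suc.prems(1)] x assms by auto
    then have lin: "frechet_derivative h (at (g x)) t = frechet_derivative h (at (g x)) 1 * t" for t
      using linear_scale[OF has_derivative_linear[OF dh], of t 1] by simp
    show "((\<lambda>x. h (g x)) has_derivative
        (\<lambda>v. frechet_derivative h (at (g x)) 1 * frechet_derivative g (at x) v)) (at x)"
      unfolding lin[symmetric] by (rule has_derivative_compose[OF Ck_on_SucD[OF Suc.prems(2) x] dh])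
  next
    fix v
    show "Ck_on r (\<lambda>x. frechet_derivative h (at (g x)) 1 * frechet_derivative g (at x) v) S"
    proof (rule Ck_on_mult[OF assms(1)])
      show "Ck_on r (\<lambda>x. frechet_derivative h (at (g x)) 1) S"
        using Suc.prems Ck_on_pred[OF assms(1) Suc.prems(2)]
        by (intro Suc.IH[of "\<lambda>y. frechet_derivative h (at y) 1"]) auto
      show "Ck_on r (\<lambda>x. frechet_derivative g (at x) v) S" using Suc.prems by auto
    qed
  qed
qed

lemma Ck_on_translate:
  assumes "Ck_on r f UNIV" shows "Ck_on r (\<lambda>x. f (x + a)) UNIV"
  using assms
proof (induction r arbitrary: f)
  case 0 then show ?case by (auto intro!: continuous_intros continuous_on_compose2[of UNIV f])
next
  case (Suc r)
  show ?case
  proof (rule Ck_on_SucI[where f' = "\<lambda>x v. frechet_derivative f (at (x + a)) v"])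
    show "((\<lambda>x. f (x + a)) has_derivative frechet_derivative f (at (x + a))) (at x)" for x
      by (rule has_derivative_compose[OF has_derivative_add_const[OF has_derivative_ident]
            Ck_on_SucD[OF Suc.prems UNIV_I]])
    show "Ck_on r (\<lambda>x. frechet_derivative f (at (x + a)) v) UNIV" for v
      using Suc.prems by (intro Suc.IH[of "\<lambda>x. frechet_derivative f (at x) v"]) auto
  qed auto
qed

lemma Ck_on_real_polynomial_function:
  "real_polynomial_function p \<Longrightarrow> Ck_on r p UNIV"
proof (induction rule: real_polynomial_function.induct)
  case (linear f) then show ?case by (rule Ck_on_bounded_linear[OF open_UNIV])
next
  case (const c) show ?case by (rule Ck_on_const[OF open_UNIV])
next
  case (add f g) then show ?case by (blast intro: Ck_on_add[OF open_UNIV])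
next
  case (mult f g) then show ?case by (blast intro: Ck_on_mult[OF open_UNIV])
qed

lemma Ck_on_prod:
  fixes f :: "'i \<Rightarrow> 'a::euclidean_space \<Rightarrow> real"
  assumes "open S" "finite I" "\<And>i. i \<in> I \<Longrightarrow> Ck_on r (f i) S"
  shows "Ck_on r (\<lambda>x. \<Prod>i\<in>I. f i x) S"
  using assms(2,3)
proof induction
  case empty then show ?case using Ck_on_const[OF assms(1)] by simp
next
  case (insert i I)
  show ?case unfolding prod.insert[OF insert.hyps]
    by (rule Ck_on_mult[OF assms(1) insert.prems insert.IH]) (simp_all add: insert.prems)
qed

text \<open>A sequence of functions closed under differentiation consists of smooth functions.\<close>

lemma Ck_on_real_derivs:
  fixes f :: "nat \<Rightarrow> real \<Rightarrow> real"
  assumes S: "open S" and d: "\<And>n x. x \<in> S \<Longrightarrow> (f n has_real_derivative f (Suc n) x) (at x)"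
  shows "Ck_on r (f n) S"
proof (induction r arbitrary: n)
  case 0
  have "isCont (f n) x" if "x \<in> S" for x using DERIV_isCont[OF d[OF that]] .
  then show ?case by (simp add: continuous_at_imp_continuous_on)
next
  case (Suc r)
  show ?case
    by (rule Ck_on_SucI[OF S, where f' = "\<lambda>x v. f (Suc n) x * v"])
       (rule d[unfolded has_field_derivative_def], assumption, rule Ck_on_mult[OF S Suc Ck_on_const[OF S]])
qed

lemma Ck_on_cos: "Ck_on r (cos :: real \<Rightarrow> real) UNIV"
proof -
  have "Ck_on r ((\<lambda>n x. cos (x + real n * pi / 2)) 0) UNIV"
  proof (rule Ck_on_real_derivs)
    fix n and x :: real
    have *: "cos (x + real (Suc n) * pi / 2) = - sin (x + real n * pi / 2)"
      using cos_add[of "x + real n * pi / 2" "pi/2"] by (simp add: algebra_simps add_divide_distrib)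
    show "((\<lambda>x. cos (x + real n * pi / 2)) has_real_derivative cos (x + real (Suc n) * pi / 2)) (at x)"
      unfolding * by (auto intro!: derivative_eq_intros)
  qed auto
  then show ?thesis by simp
qed

lemma Ck_on_inverse: "Ck_on r (inverse :: real \<Rightarrow> real) {0<..}"
proof -
  define f :: "nat \<Rightarrow> real \<Rightarrow> real" where "f n x = (-1)^n * fact n * inverse x ^ Suc n" for n x
  have "Ck_on r (f 0) {0<..}"
  proof (rule Ck_on_real_derivs)
    fix n and x :: real assume "x \<in> {0<..}"
    then have x: "x > 0" by simp
    have i: "(inverse has_real_derivative - (inverse x * inverse x)) (at x)"
      using DERIV_inverse[of x UNIV] x by (simp add: power2_eq_square)
    show "(f n has_real_derivative f (Suc n) x) (at x)" unfolding f_def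
      by (rule DERIV_cmult[OF DERIV_power[OF i, of "Suc n"], THEN DERIV_cong]) (simp add: algebra_simps)
  qed auto
  then show ?thesis by (simp add: f_def[abs_def])
qed

text \<open>With the polynomial factor this family is closed under differentiation, and \<open>flat_exp 1\<close> is the
  standard smooth function vanishing exactly on the negative half-line.\<close>

definition flat_exp :: "real poly \<Rightarrow> real \<Rightarrow> real" where
  "flat_exp p t = (if t > 0 then poly p (1 / t) * exp (- (1 / t)) else 0)"

lemma flat_exp_right_limit: "((\<lambda>t. poly p (1 / t) * exp (- (1 / t))) \<longlongrightarrow> 0) (at_right (0::real))"
proof -
  have "((\<lambda>s. poly p s * exp (- s)) \<longlongrightarrow> (0::real)) at_top"
  proof -
    have "((\<lambda>s. \<Sum>i\<le>degree p. coeff p i * (s ^ i / exp s)) \<longlongrightarrow> (\<Sum>i\<le>degree p. coeff p i * (0::real))) at_top"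
      by (intro tendsto_sum tendsto_mult_left tendsto_power_div_exp_0)
    then show ?thesis
      by (simp add: poly_altdef sum_distrib_right exp_minus divide_inverse mult.assoc)
  qed
  from filterlim_compose[OF this filterlim_inverse_at_top_right]
  show ?thesis by (simp add: divide_inverse)
qed

lemma Ck_on_flat_exp: "Ck_on r (flat_exp p) UNIV"
proof -
  define D :: "real poly \<Rightarrow> real poly" where "D p = [:0,0,1:] * (p - pderiv p)" for p
  define f where "f n = flat_exp ((D ^^ n) p)" for n
  have d: "(flat_exp q has_real_derivative flat_exp (D q) t) (at t)" for q t
  proof -
    consider "t > 0" | "t < 0" | "t = 0" by linarith
    then show ?thesis
    proof cases
      case 1
      have "((\<lambda>t. poly q (1 / t) * exp (- (1 / t))) has_real_derivative flat_exp (D q) t) (at t)"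
      proof -
        have i: "((\<lambda>t. 1 / t) has_real_derivative - 1 / t^2) (at t)"
          using 1 by (auto intro!: derivative_eq_intros simp: power2_eq_square)
        show ?thesis
          by (rule DERIV_mult[OF DERIV_chain2[OF poly_DERIV i]
                DERIV_chain2[OF DERIV_exp DERIV_minus[OF i]], THEN DERIV_cong])
             (use 1 in \<open>simp add: flat_exp_def D_def field_simps power2_eq_square\<close>)
      qed
      then show ?thesis
        by (rule has_field_derivative_transform_within_open[of _ _ _ "{0<..}"]) (use 1 in \<open>auto simp: flat_exp_def\<close>)
    next
      case 2
      have "((\<lambda>t::real. 0) has_real_derivative flat_exp (D q) t) (at t)"
        using 2 by (simp add: flat_exp_def)
      then show ?thesis
        by (rule has_field_derivative_transform_within_open[of _ _ _ "{..<0}"]) (use 2 in \<open>auto simp: flat_exp_def\<close>)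
    next
      case 3
      have r: "((\<lambda>h. flat_exp q h / h) \<longlongrightarrow> 0) (at_right 0)"
        by (rule Lim_transform_eventually[OF flat_exp_right_limit[of "[:0,1:] * q"]])
           (auto simp: flat_exp_def eventually_at_right_field intro!: exI[of _ 1])
      have l: "((\<lambda>h. flat_exp q h / h) \<longlongrightarrow> 0) (at_left 0)"
        by (rule Lim_transform_eventually[OF tendsto_const])
           (auto simp: flat_exp_def eventually_at_left_field intro!: exI[of _ "-1"])
      have "((\<lambda>h. flat_exp q h / h) \<longlongrightarrow> 0) (at 0)"
        using l r by (rule filterlim_split_at)
      then show ?thesis using 3 by (simp add: DERIV_def flat_exp_def)
    qed
  qed
  have "Ck_on r (f 0) UNIV"
    by (rule Ck_on_real_derivs) (auto simp: f_def d)
  then show ?thesis by (simp add: f_def)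
qed

lemma smooth_step:
  "\<exists>\<beta> :: real \<Rightarrow> real. (\<forall>r. Ck_on r \<beta> UNIV) \<and> (\<forall>t. 0 \<le> \<beta> t \<and> \<beta> t \<le> 1) \<and>
     (\<forall>t\<le>1. \<beta> t = 1) \<and> (\<forall>t\<ge>2. \<beta> t = 0)"
proof -
  define e where "e = flat_exp 1"
  have e: "e t \<ge> 0" "e t > 0 \<longleftrightarrow> t > 0" for t by (auto simp: e_def flat_exp_def)
  have eC: "Ck_on r (\<lambda>t. e (b * t + c)) UNIV" for b c r
  proof -
    have "Ck_on r (\<lambda>t. b * t + c) UNIV"
      by (rule Ck_on_add[OF open_UNIV Ck_on_bounded_linear[OF open_UNIV bounded_linear_mult_right]
            Ck_on_const[OF open_UNIV]])
    then show ?thesis unfolding e_def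
      by (rule Ck_on_compose_real[OF open_UNIV open_UNIV subset_UNIV Ck_on_flat_exp])
  qed
  define s where "s t = e (-1 * t + 2) + e (1 * t + (-1))" for t
  have s: "s t > 0" for t
    using e[of "-1 * t + 2"] e[of "1 * t + (-1)"] unfolding s_def by (cases "t < 2") auto
  define \<beta> where "\<beta> t = e (-1 * t + 2) * inverse (s t)" for t
  have "Ck_on r \<beta> UNIV" for r unfolding \<beta>_def
  proof (rule Ck_on_mult[OF open_UNIV eC])
    have "Ck_on r s UNIV" unfolding s_def by (rule Ck_on_add[OF open_UNIV eC eC])
    from Ck_on_compose_real[OF open_UNIV open_greaterThan _ Ck_on_inverse this] s
    show "Ck_on r (\<lambda>x. inverse (s x)) UNIV" by auto
  qed
  moreover have "0 \<le> \<beta> t" for t using s[of t] e by (simp add: \<beta>_def)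
  moreover have "\<beta> t \<le> 1" for t using s[of t] e(1)[of "1 * t + (-1)"] by (simp add: \<beta>_def field_simps s_def)
  moreover have "\<beta> t = 1" if "t \<le> 1" for t
    using s[of t] that by (simp add: \<beta>_def s_def e_def flat_exp_def)
  moreover have "\<beta> t = 0" if "t \<ge> 2" for t using that by (simp add: \<beta>_def e_def flat_exp_def)
  ultimately show ?thesis by blast
qed

section \<open>Test functions\<close>

text \<open>Finitely many smooth bumps, each equal to \<open>1\<close> on a ball and supported in the concentric ball
  of twice the radius, cover the compact set. The complement of the product of their complements is
  \<open>1\<close> wherever one of the bumps is, hence on a neighbourhood of \<open>K\<close>; this makes products with the
  cutoff differentiate well there.\<close>

lemma smooth_urysohn:
  fixes K V :: "'a::euclidean_space set"
  assumes K: "compact K" and V: "open V" "K \<subseteq> V"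
  shows "\<exists>\<kappa> W. test_function V \<kappa> \<and> (\<forall>x. 0 \<le> \<kappa> x \<and> \<kappa> x \<le> 1) \<and> open W \<and> K \<subseteq> W \<and> (\<forall>x\<in>W. \<kappa> x = 1)"
proof -
  obtain \<beta> :: "real \<Rightarrow> real" where \<beta>: "\<And>r. Ck_on r \<beta> UNIV" "\<And>t. 0 \<le> \<beta> t" "\<And>t. \<beta> t \<le> 1"
    "\<And>t. t \<le> 1 \<Longrightarrow> \<beta> t = 1" "\<And>t. t \<ge> 2 \<Longrightarrow> \<beta> t = 0"
    using smooth_step by blast
  have "\<exists>r>0. cball x (2 * r) \<subseteq> V" if x: "x \<in> K" for x
  proof -
    obtain e where "e > 0" "cball x e \<subseteq> V"
      using open_contains_cball_eq[OF V(1)] x V(2) by blast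
    then show ?thesis by (intro exI[of _ "e/2"]) auto
  qed
  then have "\<forall>x\<in>K. \<exists>r>0. cball x (2 * r) \<subseteq> V" by blast
  from bchoice[OF this] obtain r where
    r: "\<And>x. x \<in> K \<Longrightarrow> r x > 0" "\<And>x. x \<in> K \<Longrightarrow> cball x (2 * r x) \<subseteq> V" by blast
  have cov: "K \<subseteq> (\<Union>x\<in>K. ball x (r x))" 
  proof
    fix x assume "x \<in> K"
    then show "x \<in> (\<Union>x\<in>K. ball x (r x))" using r(1) centre_in_ball by blast
  qed
  obtain C where C: "C \<subseteq> K" "finite C" "K \<subseteq> (\<Union>x\<in>C. ball x (r x))"
    by (rule compactE_image[OF K open_ball cov])
  define b where "b x y = \<beta> ((norm (y - x))\<^sup>2 / (r x)\<^sup>2)" for x y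
  define \<kappa> where "\<kappa> y = 1 + (-1) * (\<Prod>x\<in>C. 1 + (-1) * b x y)" for y
  define W where "W = (\<Union>x\<in>C. ball x (r x))"
  have bC: "Ck_on n (b x) UNIV" for n x
  proof -
    have eq: "(norm (y - x))\<^sup>2 / (r x)\<^sup>2 = (\<Sum>i\<in>Basis. (y \<bullet> i - x \<bullet> i)^2) / (r x)\<^sup>2" for y
      unfolding power2_norm_eq_inner
      by (subst euclidean_inner) (simp add: inner_diff_left power2_eq_square)
    have "real_polynomial_function (\<lambda>y. (\<Sum>i\<in>Basis. (y \<bullet> i - x \<bullet> i)^2) / (r x)\<^sup>2)"
      by (rule real_polynomial_function_divide, rule real_polynomial_function_sum[OF finite_Basis],
          rule real_polynomial_function_power, rule real_polynomial_function_diff,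
          rule real_polynomial_function.intros(1)[OF bounded_linear_inner_left],
          rule real_polynomial_function.intros(2))
    from Ck_on_real_polynomial_function[OF this] show ?thesis
      unfolding b_def[abs_def] eq by (rule Ck_on_compose_real[OF open_UNIV open_UNIV subset_UNIV \<beta>(1)])
  qed
  have comp: "Ck_on n (\<lambda>y. 1 + (-1) * f y) UNIV" if "Ck_on n f UNIV" for n and f :: "'a \<Rightarrow> real"
    by (rule Ck_on_add[OF open_UNIV Ck_on_const[OF open_UNIV] Ck_on_mult[OF open_UNIV Ck_on_const[OF open_UNIV] that]])
  have \<kappa>C: "Ck_on n \<kappa> UNIV" for n
    unfolding \<kappa>_def[abs_def] by (rule comp, rule Ck_on_prod[OF open_UNIV C(2)], rule comp, rule bC)
  have b01: "0 \<le> 1 + (-1) * b x y" "1 + (-1) * b x y \<le> 1" for x y using \<beta> by (auto simp: b_def)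
  have b1: "b x y = 1" if "x \<in> C" "y \<in> ball x (r x)" for x y
  proof -
    have "norm (y - x) < r x" using that by (simp add: dist_norm norm_minus_commute)
    then have "(norm (y - x))\<^sup>2 \<le> (r x)\<^sup>2" by (intro power_mono) auto
    moreover have "r x > 0" using that C(1) r(1) by blast
    ultimately show ?thesis unfolding b_def by (intro \<beta>(4)) (simp add: divide_le_eq)
  qed
  have b0: "b x y = 0" if "x \<in> C" "y \<notin> cball x (2 * r x)" for x y
  proof -
    have rx: "r x > 0" using that C(1) r(1) by blast
    have "norm (y - x) > 2 * r x" using that by (simp add: dist_norm norm_minus_commute)
    then have "(norm (y - x))\<^sup>2 \<ge> (2 * r x)\<^sup>2" using rx by (intro power_mono) auto
    moreover have "(2 * r x)\<^sup>2 \<ge> 2 * (r x)\<^sup>2" by (simp add: power_mult_distrib)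
    ultimately have "(norm (y - x))\<^sup>2 \<ge> 2 * (r x)\<^sup>2" by linarith
    then show ?thesis unfolding b_def using rx by (intro \<beta>(5)) (simp add: le_divide_eq)
  qed
    have "test_function V \<kappa>" unfolding test_function_def
    proof (intro conjI allI exI[of _ "\<Union>x\<in>C. cball x (2 * r x)"])
      show "compact (\<Union>x\<in>C. cball x (2 * r x))" using C(2) by (intro compact_UN) auto
      show "(\<Union>x\<in>C. cball x (2 * r x)) \<subseteq> V" using r C(1) by blast
      show "y \<notin> (\<Union>x\<in>C. cball x (2 * r x)) \<longrightarrow> \<kappa> y = 0" for y
        using b0 by (simp add: \<kappa>_def)
    qed (rule \<kappa>C)
    moreover have "0 \<le> \<kappa> y" for y
      using prod_le_1[of C "\<lambda>x. 1 + (-1) * b x y"] b01 by (simp add: \<kappa>_def)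
    moreover have "\<kappa> y \<le> 1" for y
      using prod_nonneg[of C "\<lambda>x. 1 + (-1) * b x y"] b01 by (simp add: \<kappa>_def)
    moreover have "open W" by (auto simp: W_def)
    moreover have "K \<subseteq> W" using C(3) by (simp add: W_def)
    moreover have "\<kappa> y = 1" if yW: "y \<in> W" for y
    proof -
      obtain x where x: "x \<in> C" "y \<in> ball x (r x)" using yW by (auto simp: W_def)
      then have "(\<Prod>x\<in>C. 1 + (-1) * b x y) = 0"
        using C(2) b1[OF x] by (subst prod_zero_iff) (auto intro!: bexI[of _ x])
      then show ?thesis by (simp add: \<kappa>_def)
    qed
    ultimately show ?thesis by blast
qed

lemma test_function_smooth: "test_function V \<phi> \<Longrightarrow> Ck_on r \<phi> UNIV"
  by (simp add: test_function_def)

lemma test_function_has_derivative: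
  "test_function V \<phi> \<Longrightarrow> (\<phi> has_derivative frechet_derivative \<phi> (at x)) (at x)"
  using Ck_on_SucD[OF test_function_smooth] by blast

lemma test_function_continuous: "test_function V \<phi> \<Longrightarrow> continuous_on S \<phi>"
  using Ck_on_imp_continuous_on[OF test_function_smooth] continuous_on_subset by blast

lemma test_function_continuous_derivative:
  assumes "test_function V \<phi>" shows "continuous_on S (\<lambda>x. frechet_derivative \<phi> (at x) v)"
proof -
  have "Ck_on 0 (\<lambda>x. frechet_derivative \<phi> (at x) v) UNIV"
    using test_function_smooth[OF assms, of "Suc 0"] by simp
  then show ?thesis using continuous_on_subset by auto
qed

lemma test_function_support:
  assumes "test_function V \<phi>"
  shows "\<exists>K. compact K \<and> K \<subseteq> V \<and> (\<forall>x. x \<notin> K \<longrightarrow> \<phi> x = 0 \<and> (\<forall>v. frechet_derivative \<phi> (at x) v = 0))"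
proof -
  obtain K where K: "compact K" "K \<subseteq> V" "\<And>x. x \<notin> K \<Longrightarrow> \<phi> x = 0"
    using assms unfolding test_function_def by blast
  have D: "frechet_derivative \<phi> (at x) v = 0" if "x \<notin> K" for x v
  proof -
    have "(\<phi> has_derivative (\<lambda>v. 0)) (at x)"
      by (rule has_derivative_transform_within_open[of "\<lambda>x. 0" _ x UNIV "- K"])
         (simp_all add: K that compact_imp_closed open_Compl)
    then show ?thesis by (simp add: frechet_derivative_at[symmetric])
  qed
  show ?thesis using K D by blast
qed

lemma test_function_mono: "test_function V \<phi> \<Longrightarrow> V \<subseteq> V' \<Longrightarrow> test_function V' \<phi>"
  unfolding test_function_def by (meson subset_trans)

lemma test_function_mult_smooth:
  assumes "test_function V \<phi>" "\<And>r. Ck_on r \<psi> UNIV" shows "test_function V (\<lambda>x. \<phi> x * \<psi> x)"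
proof -
  obtain K where "compact K" "K \<subseteq> V" "\<And>x. x \<notin> K \<Longrightarrow> \<phi> x = 0" "\<And>x v. x \<notin> K \<Longrightarrow> frechet_derivative \<phi> (at x) v = 0"
    using test_function_support[OF assms(1)] by blast
  then show ?thesis unfolding test_function_def
    using Ck_on_mult[OF open_UNIV test_function_smooth[OF assms(1)] assms(2)]
    by (intro conjI allI exI[of _ K]) auto
qed

lemma test_function_translate:
  assumes \<phi>: "test_function V \<phi>" shows "test_function ((\<lambda>x. x + a) ` V) (\<lambda>x. \<phi> (x - a))"
proof -
  obtain K where K: "compact K" "K \<subseteq> V" "\<And>x. x \<notin> K \<Longrightarrow> \<phi> x = 0" "\<And>x v. x \<notin> K \<Longrightarrow> frechet_derivative \<phi> (at x) v = 0"
    using test_function_support[OF \<phi>] by blast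
  show ?thesis unfolding test_function_def
  proof (intro conjI allI exI[of _ "(\<lambda>x. x + a) ` K"])
    show "Ck_on r (\<lambda>x. \<phi> (x - a)) UNIV" for r
      using Ck_on_translate[OF test_function_smooth[OF \<phi>], of r "-a"] by simp
    show "compact ((\<lambda>x. x + a) ` K)"
      using compact_translation[OF K(1), of a] by (simp add: add.commute)
    show "(\<lambda>x. x + a) ` K \<subseteq> (\<lambda>x. x + a) ` V" using K(2) by blast
    show "x \<notin> (\<lambda>x. x + a) ` K \<longrightarrow> \<phi> (x - a) = 0" for x
      using K(3)[of "x - a"] by (metis diff_add_cancel imageI)
  qed
qed

lemma test_function_bounded_derivative:
  assumes \<phi>: "test_function V \<phi>"
  shows "\<exists>B\<ge>0. \<forall>x. \<bar>frechet_derivative \<phi> (at x) v\<bar> \<le> B"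
proof -
  obtain K where K: "compact K" "K \<subseteq> V" "\<And>x. x \<notin> K \<Longrightarrow> \<phi> x = 0"
    "\<And>x v. x \<notin> K \<Longrightarrow> frechet_derivative \<phi> (at x) v = 0"
    using test_function_support[OF \<phi>] by blast
  have "bounded ((\<lambda>x. frechet_derivative \<phi> (at x) v) ` K)"
    using compact_continuous_image[OF test_function_continuous_derivative[OF \<phi>] K(1)]
    by (rule compact_imp_bounded)
  then obtain B where B: "\<And>x. x \<in> K \<Longrightarrow> \<bar>frechet_derivative \<phi> (at x) v\<bar> \<le> B"
    by (auto simp: bounded_iff)
  have "\<bar>frechet_derivative \<phi> (at x) v\<bar> \<le> max B 0" for x
    using B[of x] K(4)[of x] by (cases "x \<in> K") auto
  then show ?thesis by (intro exI[of _ "max B 0"]) auto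
qed

text \<open>Stone-Weierstrass, multiplied by a cutoff. The supports stay in one compact set,
  so that uniform closeness can be integrated.\<close>

lemma test_function_uniform_approximation:
  fixes v :: "'a::euclidean_space \<Rightarrow> real"
  assumes V: "open V" and K: "compact K" "K \<subseteq> V"
    and v: "continuous_on UNIV v" "\<And>x. x \<notin> K \<Longrightarrow> v x = 0"
  shows "\<exists>K'. compact K' \<and> K' \<subseteq> V \<and> (\<forall>e>0. \<exists>\<phi>. test_function V \<phi> \<and>
    (\<forall>x. x \<notin> K' \<longrightarrow> \<phi> x = 0 \<and> v x = 0) \<and> (\<forall>x. \<bar>\<phi> x - v x\<bar> \<le> e))"
proof -
  obtain \<kappa> W where \<kappa>: "test_function V \<kappa>" "\<And>x. 0 \<le> \<kappa> x" "\<And>x. \<kappa> x \<le> 1"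
    "open W" "K \<subseteq> W" "\<And>x. x \<in> W \<Longrightarrow> \<kappa> x = 1"
    using smooth_urysohn[OF K(1) V K(2)] by blast
  obtain K' where K': "compact K'" "K' \<subseteq> V" "\<And>x. x \<notin> K' \<Longrightarrow> \<kappa> x = 0"
    "\<And>x v. x \<notin> K' \<Longrightarrow> frechet_derivative \<kappa> (at x) v = 0"
    using test_function_support[OF \<kappa>(1)] by blast
  have KK': "K \<subseteq> K'" using K'(3) \<kappa>(5,6) by fastforce
  show ?thesis
  proof (intro exI[of _ K'] conjI K'(1,2) allI impI)
    fix e :: real assume e: "e > 0"
    have cK': "continuous_on K' v" by (rule continuous_on_subset[OF v(1) subset_UNIV])
    have "\<exists>p. real_polynomial_function p \<and> (\<forall>x\<in>K'. \<bar>v x - p x\<bar> < e)"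
      by (rule Stone_Weierstrass_real_polynomial_function[OF K'(1) cK' e]) blast
    then obtain p where p: "real_polynomial_function p" "\<And>x. x \<in> K' \<Longrightarrow> \<bar>v x - p x\<bar> < e" by blast
    have "\<bar>\<kappa> x * p x - v x\<bar> \<le> e" for x
    proof (cases "x \<in> K")
      case True
      then show ?thesis using p(2)[of x] \<kappa>(5,6) KK' by (force simp: abs_minus_commute)
    next
      case False
      have "\<bar>\<kappa> x * p x\<bar> \<le> e"
      proof (cases "x \<in> K'")
        case True
        have "\<bar>\<kappa> x * p x\<bar> \<le> 1 * \<bar>p x\<bar>"
          unfolding abs_mult using \<kappa>(2,3) by (intro mult_right_mono) auto
        then show ?thesis using p(2)[OF True] v(2)[OF False] by simp
      qed (use K'(3) e in auto)
      then show ?thesis using v(2)[OF False] by simp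
    qed
    then show "\<exists>\<phi>. test_function V \<phi> \<and> (\<forall>x. x \<notin> K' \<longrightarrow> \<phi> x = 0 \<and> v x = 0) \<and> (\<forall>x. \<bar>\<phi> x - v x\<bar> \<le> e)"
      using test_function_mult_smooth[OF \<kappa>(1) Ck_on_real_polynomial_function[OF p(1)]] K'(3) v(2) KK'
      by (intro exI[of _ "\<lambda>x. \<kappa> x * p x"]) auto
  qed
qed

section \<open>Locally integrable functions\<close>

lemma lebesgue_translation: "lebesgue = distr lebesgue lebesgue (\<lambda>x::'a::euclidean_space. x + a)"
proof -
  have T: "(\<lambda>x. a + (\<Sum>j\<in>Basis. (1 * (x \<bullet> j)) *\<^sub>R j)) = (\<lambda>x::'a. x + a)"
    by (simp add: euclidean_representation add.commute)
  have "lebesgue = density (distr lebesgue lebesgue (\<lambda>x::'a. x + a)) (\<lambda>_. ennreal 1)"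
    using lebesgue_affine_euclidean[where c="\<lambda>_. 1" and t=a] unfolding T by (simp only: prod.neutral_const abs_1)
  then show ?thesis by (simp add: density_1)
qed

lemma measurable_lebesgue_translation: "(\<lambda>x::'a::euclidean_space. x + a) \<in> lebesgue \<rightarrow>\<^sub>M lebesgue"
proof -
  have T: "(\<lambda>x. a + (\<Sum>j\<in>Basis. (1 * (x \<bullet> j)) *\<^sub>R j)) = (\<lambda>x::'a. x + a)"
    by (simp add: euclidean_representation add.commute)
  show ?thesis using lebesgue_affine_measurable[where c="\<lambda>_. 1" and t=a] unfolding T by simp
qed

lemma integral_lebesgue_translation:
  fixes f :: "'a::euclidean_space \<Rightarrow> real"
  shows "integrable lebesgue f \<Longrightarrow> integrable lebesgue (\<lambda>x. f (x + a))"
    and "integrable lebesgue f \<Longrightarrow> (LINT x|lebesgue. f (x + a)) = (LINT x|lebesgue. f x)"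
proof -
  assume f: "integrable lebesgue f"
  have m: "f \<in> borel_measurable lebesgue" using f by auto
  show "integrable lebesgue (\<lambda>x. f (x + a))"
    using f integrable_distr_eq[OF measurable_lebesgue_translation m, of a] lebesgue_translation[of a] by simp
  show "(LINT x|lebesgue. f (x + a)) = (LINT x|lebesgue. f x)"
    using integral_distr[OF measurable_lebesgue_translation m, of a] lebesgue_translation[of a] by simp
qed

lemma locally_integrable_mult:
  fixes g v :: "'a::euclidean_space \<Rightarrow> real"
  assumes g: "locally_integrable V g" and K: "compact K" "K \<subseteq> V"
    and v: "v \<in> borel_measurable lebesgue" "\<And>x. \<bar>v x\<bar> \<le> c" "\<And>x. x \<notin> K \<Longrightarrow> v x = 0"
  shows "integrable lebesgue (\<lambda>x. g x * v x)"
proof -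
  have Ks: "K \<inter> space lebesgue \<in> sets lebesgue" using K(1) by (simp add: lmeasurable_compact fmeasurableD)
  have i: "integrable lebesgue (\<lambda>x. indicator K x * g x)"
    using g K integrable_restrict_space[OF Ks, of g] by (simp add: locally_integrable_def)
  have "integrable lebesgue (\<lambda>x. (indicator K x * g x) * v x)"
  proof (rule Bochner_Integration.integrable_bound)
    show "integrable lebesgue (\<lambda>x. c * (indicator K x * g x))" using i by simp
    show "(\<lambda>x. indicator K x * g x * v x) \<in> borel_measurable lebesgue"
      by (rule borel_measurable_times[OF borel_measurable_integrable[OF i] v(1)])
    have "c \<ge> 0" using v(2)[of undefined] by linarith
    then show "AE x in lebesgue. norm (indicator K x * g x * v x) \<le> norm (c * (indicator K x * g x))"
      using v(2) by (auto simp: abs_mult mult.commute[of c] intro!: mult_left_mono)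
  qed
  moreover have "indicator K x * g x * v x = g x * v x" for x
    using v(3)[of x] by (auto simp: indicator_def)
  ultimately show ?thesis by simp
qed

lemma locally_integrable_mult_continuous:
  fixes g v :: "'a::euclidean_space \<Rightarrow> real"
  assumes g: "locally_integrable V g" and K: "compact K" "K \<subseteq> V"
    and v: "continuous_on UNIV v" "\<And>x. x \<notin> K \<Longrightarrow> v x = 0"
  shows "integrable lebesgue (\<lambda>x. g x * v x)"
proof -
  have "bounded (v ` K)"
    using compact_continuous_image[OF continuous_on_subset[OF v(1)] K(1)] by (auto intro: compact_imp_bounded)
  then obtain B where B: "\<And>x. x \<in> K \<Longrightarrow> \<bar>v x\<bar> \<le> B" by (auto simp: bounded_iff)
  have "\<bar>v x\<bar> \<le> max B 0" for x
    using B[of x] v(2)[of x] by (cases "x \<in> K") auto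
  then show ?thesis
    using v(2) by (intro locally_integrable_mult[OF g K] measurable_completion)
      (auto intro: borel_measurable_continuous_onI[OF v(1)])
qed

lemma locally_integrable_mono: "locally_integrable V g \<Longrightarrow> V' \<subseteq> V \<Longrightarrow> locally_integrable V' g"
  by (auto simp: locally_integrable_def)

lemma locally_integrable_component:
  fixes u :: "'a::euclidean_space \<Rightarrow> 'b::euclidean_space ^ 'k"
  shows "locally_integrable V u \<Longrightarrow> locally_integrable V (\<lambda>x. u x $ i)"
  unfolding locally_integrable_def
  by (auto intro: integrable_bounded_linear[OF bounded_linear_vec_nth])

text \<open>Integrals against test functions can be taken over the whole space, where Lebesgue measure is
  invariant under translations.\<close>

lemma integral_lebesgue_on_eq:
  fixes f :: "'a::euclidean_space \<Rightarrow> real"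
  assumes "open V" "\<And>x. x \<notin> V \<Longrightarrow> f x = 0"
  shows "(LINT x|lebesgue_on V. f x) = (LINT x|lebesgue. f x)"
proof -
  have "indicat_real V x *\<^sub>R f x = f x" for x using assms(2)[of x] by (auto simp: indicator_def)
  then show ?thesis
    using integral_restrict_space[of V lebesgue f] assms(1) by (simp del: real_scaleR_def)
qed

text \<open>Test functions equal to \<open>1\<close> on a compact set and supported in shrinking neighbourhoods of it
  converge boundedly to its indicator.\<close>

lemma locally_integrable_nonneg_compact:
  fixes w :: "'a::euclidean_space \<Rightarrow> real"
  assumes V: "open V" and w: "locally_integrable V w"
    and t: "\<And>\<phi>. test_function V \<phi> \<Longrightarrow> (\<And>x. 0 \<le> \<phi> x) \<Longrightarrow> 0 \<le> (LINT x|lebesgue. w x * \<phi> x)"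
    and K: "compact K" "K \<subseteq> V"
  shows "0 \<le> (LINT x|lebesgue. w x * indicator K x)"
proof (cases "K = {}")
  case False
  obtain \<kappa>0 W0 where \<kappa>0: "test_function V \<kappa>0" "\<And>x. 0 \<le> \<kappa>0 x" "\<And>x. \<kappa>0 x \<le> 1"
    "open W0" "K \<subseteq> W0" "\<And>x. x \<in> W0 \<Longrightarrow> \<kappa>0 x = 1"
    using smooth_urysohn[OF K(1) V K(2)] by blast
  obtain K0 where K0: "compact K0" "K0 \<subseteq> V" "\<And>x. x \<notin> K0 \<Longrightarrow> \<kappa>0 x = 0"
    "\<And>x v. x \<notin> K0 \<Longrightarrow> frechet_derivative \<kappa>0 (at x) v = 0"
    using test_function_support[OF \<kappa>0(1)] by blast
  have W0K0: "W0 \<subseteq> K0" using \<kappa>0(6) K0(3) by fastforce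
  define N where "N n = W0 \<inter> {y. infdist y K < 1 / real (Suc n)}" for n
  have No: "open (N n)" for n unfolding N_def
    by (intro open_Int \<kappa>0(4) open_Collect_less continuous_intros)
  have KN: "K \<subseteq> N n" for n using \<kappa>0(5) by (auto simp: N_def)
  have "\<exists>\<kappa> W. test_function (N n) \<kappa> \<and> (\<forall>x. 0 \<le> \<kappa> x \<and> \<kappa> x \<le> 1) \<and> (\<forall>x\<in>K. \<kappa> x = 1)" for n
  proof -
    obtain \<kappa> W where *: "test_function (N n) \<kappa>" "\<And>x. 0 \<le> \<kappa> x" "\<And>x. \<kappa> x \<le> 1"
      "open W" "K \<subseteq> W" "\<And>x. x \<in> W \<Longrightarrow> \<kappa> x = 1"
      using smooth_urysohn[OF K(1) No KN] by blast
    then show ?thesis by (intro exI[of _ \<kappa>] exI[of _ W]) auto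
  qed
  then obtain \<kappa> where \<kappa>: "\<And>n. test_function (N n) (\<kappa> n)" "\<And>n x. 0 \<le> \<kappa> n x" "\<And>n x. \<kappa> n x \<le> 1"
    "\<And>n x. x \<in> K \<Longrightarrow> \<kappa> n x = 1" by metis
  have out: "\<kappa> n x = 0" if "x \<notin> N n" for n x
  proof -
    obtain K' where "compact K'" "K' \<subseteq> N n" "\<And>x. x \<notin> K' \<Longrightarrow> \<kappa> n x = 0"
      "\<And>x v. x \<notin> K' \<Longrightarrow> frechet_derivative (\<kappa> n) (at x) v = 0"
      using test_function_support[OF \<kappa>(1)[of n]] by blast
    then show ?thesis using that by blast
  qed
  have N_V: "N n \<subseteq> V" "N n \<subseteq> K0" for n using W0K0 K0(2) by (auto simp: N_def)
  have lim: "(\<lambda>n. \<kappa> n x) \<longlonglongrightarrow> indicator K x" for x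
  proof (cases "x \<in> K")
    case True then show ?thesis using \<kappa>(4) by simp
  next
    case False
    have "infdist x K > 0"
      using False K(1) \<open>K \<noteq> {}\<close> by (simp add: infdist_pos_not_in_closed compact_imp_closed)
    then obtain n0 where n0: "1 / real (Suc n0) < infdist x K" by (rule nat_approx_posE)
    have "\<kappa> n x = 0" if "n \<ge> n0" for n
    proof (rule out)
      have "1 / real (Suc n) \<le> 1 / real (Suc n0)" using that by (simp add: frac_le)
      then show "x \<notin> N n" using n0 by (auto simp: N_def)
    qed
    then show ?thesis using False
      by (intro tendsto_eventually eventually_sequentiallyI[of n0]) auto
  qed
  have K0m: "indicator K0 \<in> borel_measurable lebesgue" "indicator K \<in> borel_measurable lebesgue"
    by (intro borel_measurable_indicator fmeasurableD lmeasurable_compact K0(1) K(1))+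
  have iK0: "integrable lebesgue (\<lambda>x. w x * indicator K0 x)"
    by (rule locally_integrable_mult[OF w K0(1,2) K0m(1), of 1]) (auto simp: indicator_def)
  have "(\<lambda>n. LINT x|lebesgue. w x * \<kappa> n x) \<longlonglongrightarrow> (LINT x|lebesgue. w x * indicator K x)"
  proof (rule integral_dominated_convergence[where w="\<lambda>x. \<bar>w x * indicator K0 x\<bar>"])
    show "(\<lambda>x. w x * indicator K x) \<in> borel_measurable lebesgue"
      using locally_integrable_mult[OF w K K0m(2), of 1] by (auto simp: indicator_def)
    show "(\<lambda>x. w x * \<kappa> n x) \<in> borel_measurable lebesgue" for n
    proof -
      have "integrable lebesgue (\<lambda>x. w x * \<kappa> n x)"
        by (rule locally_integrable_mult_continuous[OF w K0(1,2) test_function_continuous[OF \<kappa>(1)]])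
           (use out N_V in blast)
      then show ?thesis by simp
    qed
    show "integrable lebesgue (\<lambda>x. \<bar>w x * indicator K0 x\<bar>)" using iK0 by simp
    show "AE x in lebesgue. (\<lambda>n. w x * \<kappa> n x) \<longlonglongrightarrow> w x * indicator K x"
      using lim by (auto intro!: tendsto_mult_left)
    have "norm (w x * \<kappa> n x) \<le> \<bar>w x * indicator K0 x\<bar>" for n x
    proof (cases "x \<in> K0")
      case True
      then show ?thesis using \<kappa>(2,3)[of n x] mult_left_mono[of "\<kappa> n x" 1 "\<bar>w x\<bar>"] by (simp add: abs_mult)
    next
      case False
      then show ?thesis using out[of x n] N_V(2) by (metis abs_ge_zero mult_zero_right norm_zero subsetD)
    qed
    then show "AE x in lebesgue. norm (w x * \<kappa> n x) \<le> \<bar>w x * indicator K0 x\<bar>" for n by simp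
  qed
  moreover have "0 \<le> (LINT x|lebesgue. w x * \<kappa> n x)" for n
    using t[OF test_function_mono[OF \<kappa>(1) N_V(1)] \<kappa>(2)] .
  ultimately show ?thesis by (intro LIMSEQ_le_const) auto
qed simp

lemma not_null_imp_compact_subset:
  fixes S :: "'a::euclidean_space set"
  assumes S: "S \<in> sets lebesgue" "bounded S" "\<not> negligible S"
  shows "\<exists>K. compact K \<and> K \<subseteq> S \<and> 0 < measure lebesgue K"
proof -
  have lm: "S \<in> lmeasurable" using S bounded_set_imp_lmeasurable by blast
  define e where "e = measure lebesgue S / 2"
  have e: "e > 0" using S(3) lm negligible_iff_measure zero_less_measure_iff unfolding e_def
    by (metis half_gt_zero_iff)
  obtain T where T: "closed T" "T \<subseteq> S" "S - T \<in> lmeasurable" "emeasure lebesgue (S - T) < ennreal e"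
    using sets_lebesgue_inner_closed[OF S(1) e] by blast
  have c: "compact T" using T S(2) bounded_subset compact_eq_bounded_closed by blast
  have "measure lebesgue (S - T) < e" using T(3,4) e
    by (simp add: emeasure_eq_measure2 ennreal_less_iff)
  moreover have "measure lebesgue (S - T) = measure lebesgue S - measure lebesgue T"
    using lm c T(2) by (intro measurable_measure_Diff) (auto simp: lmeasurable_compact fmeasurableD)
  ultimately have "measure lebesgue T > 0" using e by (simp add: e_def)
  then show ?thesis using c T(2) by blast
qed

text \<open>The fundamental lemma of the calculus of variations in one-sided form. It yields uniqueness of
  weak derivatives, and also turns bounds on integrals against test functions into pointwise ones.\<close>

lemma locally_integrable_nonnegI:
  fixes w :: "'a::euclidean_space \<Rightarrow> real"
  assumes V: "open V" and w: "locally_integrable V w"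
    and t: "\<And>\<phi>. test_function V \<phi> \<Longrightarrow> (\<And>x. 0 \<le> \<phi> x) \<Longrightarrow> 0 \<le> (LINT x|lebesgue. w x * \<phi> x)"
  shows "AE x in lebesgue. x \<in> V \<longrightarrow> 0 \<le> w x"
proof -
  have "negligible {x\<in>V. w x < 0}" (is "negligible ?N")
  proof (subst locally_negligible_alt, intro ballI)
    fix x assume x: "x \<in> ?N"
    then obtain r where r: "r > 0" "cball x r \<subseteq> V"
      using open_contains_cball_eq[OF V] by blast
    have m: "(\<lambda>y. w y * indicator (cball x r) y) \<in> borel_measurable lebesgue"
    proof (rule borel_measurable_integrable, rule locally_integrable_mult[OF w compact_cball r(2), of _ 1])
      show "indicat_real (cball x r) \<in> borel_measurable lebesgue"
        by (rule borel_measurable_indicator) simp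
    qed auto
    define A where "A n = {y\<in>cball x r. w y \<le> - 1 / real (Suc n)}" for n
    have "negligible (A n)" for n
    proof (rule ccontr)
      assume nn: "\<not> negligible (A n)"
      have "A n = {y\<in>space lebesgue. w y * indicator (cball x r) y \<le> - 1 / real (Suc n)}"
        by (auto simp: A_def indicator_def)
      moreover have "\<dots> \<in> sets lebesgue" using m by (rule borel_measurable_le) simp
      ultimately have "A n \<in> sets lebesgue" by simp
      moreover have "bounded (A n)" by (rule bounded_subset[of "cball x r"]) (auto simp: A_def)
      ultimately obtain K where K: "compact K" "K \<subseteq> A n" "0 < measure lebesgue K"
        using not_null_imp_compact_subset nn by blast
      have "A n \<subseteq> cball x r" by (auto simp: A_def)
      then have KV: "K \<subseteq> V" using K(2) r(2) by blast
      have Kl: "K \<in> lmeasurable" using K(1) by (rule lmeasurable_compact)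
      have "0 \<le> (LINT x|lebesgue. w x * indicator K x)"
        using locally_integrable_nonneg_compact[OF V w t K(1) KV] by blast
      also have "\<dots> \<le> (LINT x|lebesgue. (- 1 / real (Suc n)) * indicator K x)"
      proof (rule integral_mono)
        show "integrable lebesgue (\<lambda>x. w x * indicator K x)"
          by (rule locally_integrable_mult[OF w K(1) KV, of _ 1])
             (use Kl in \<open>auto simp: indicator_def fmeasurableD\<close>)
        show "integrable lebesgue (\<lambda>x. (- 1 / real (Suc n)) * indicator K x)"
          using Kl by (intro integrable_mult_right) (auto simp: fmeasurable_def)
        show "w x * indicator K x \<le> (- 1 / real (Suc n)) * indicator K x" for x
          using K(2) by (auto simp: indicator_def A_def)
      qed
      also have "\<dots> = (- 1 / real (Suc n)) * measure lebesgue K" by simp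
      also have "\<dots> < 0" using K(3) by (simp add: field_simps)
      finally show False by simp
    qed
    then have "negligible (\<Union>n. A n)" by (intro negligible_countable_Union) auto
    moreover have "?N \<inter> ball x r \<subseteq> (\<Union>n. A n)"
    proof
      fix y assume y: "y \<in> ?N \<inter> ball x r"
      then have "- w y > 0" by simp
      then obtain n where "1 / real (Suc n) < - w y" by (rule nat_approx_posE)
      then show "y \<in> (\<Union>n. A n)" using y by (auto simp: A_def intro!: exI[of _ n])
    qed
    ultimately have "negligible (?N \<inter> ball x r)" by (rule negligible_subset)
    then show "\<exists>U. openin (top_of_set ?N) U \<and> x \<in> U \<and> negligible U"
      using x r(1) by (intro exI[of _ "?N \<inter> ball x r"]) (auto intro: openin_open_Int)
  qed
  then have "?N \<in> null_sets lebesgue" by (simp add: negligible_iff_null_sets)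
  then show ?thesis by (rule AE_I') auto
qed

section \<open>Weak derivatives\<close>

text \<open>The directional version for scalar functions. The integrals extend over the whole space,
  since test functions vanish outside \<open>V\<close>.\<close>

definition weak_derivative :: "'a::euclidean_space set \<Rightarrow> 'a \<Rightarrow> ('a \<Rightarrow> real) \<Rightarrow> ('a \<Rightarrow> real) \<Rightarrow> bool" where
  "weak_derivative V z f g \<longleftrightarrow> locally_integrable V f \<and> locally_integrable V g \<and>
     (\<forall>\<phi>. test_function V \<phi> \<longrightarrow>
        (LINT x|lebesgue. f x * frechet_derivative \<phi> (at x) z) = - (LINT x|lebesgue. g x * \<phi> x))"

lemma compact_in_open_neighbourhood:
  fixes K V :: "'a::euclidean_space set"
  assumes K: "compact K" and V: "open V" "K \<subseteq> V"
  shows "\<exists>d>0. \<exists>K'. compact K' \<and> K' \<subseteq> V \<and> K \<subseteq> K' \<and> (\<forall>x\<in>K. \<forall>y. dist x y \<le> d \<longrightarrow> y \<in> K')"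
proof (cases "K = {}")
  case True
  then show ?thesis by (intro exI[of _ 1] conjI exI[of _ "{}"]) auto
next
  case False
  obtain e where e: "e > 0" "{x. infdist x K \<le> e} \<subseteq> V"
    using compact_in_open_separated[OF False K V] by blast
  have "\<forall>x\<in>K. \<forall>y. dist x y \<le> e \<longrightarrow> y \<in> {x. infdist x K \<le> e}"
    by (auto intro: infdist_le2 simp: dist_commute)
  moreover have "K \<subseteq> {x. infdist x K \<le> e}" using e(1) by auto
  ultimately show ?thesis
    using e compact_infdist_le[OF False K e(1)] by blast
qed

lemma test_function_increment:
  assumes \<phi>: "test_function V \<phi>" and B: "\<And>x. \<bar>frechet_derivative \<phi> (at x) z\<bar> \<le> B"
  shows "\<bar>\<phi> (x - h *\<^sub>R z) - \<phi> x\<bar> \<le> B * \<bar>h\<bar>"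
proof -
  have d: "((\<lambda>t. \<phi> (x - t *\<^sub>R z)) has_real_derivative - frechet_derivative \<phi> (at (x - t *\<^sub>R z)) z) (at t)" for t
  proof -
    have i: "((\<lambda>t. x - t *\<^sub>R z) has_derivative (\<lambda>s. - (s *\<^sub>R z))) (at t)"
      by (auto intro!: derivative_eq_intros)
    have l: "linear (frechet_derivative \<phi> (at (x - t *\<^sub>R z)))"
      using has_derivative_linear[OF test_function_has_derivative[OF \<phi>]] .
    have e: "frechet_derivative \<phi> (at (x - t *\<^sub>R z)) (- (s *\<^sub>R z)) =
        - frechet_derivative \<phi> (at (x - t *\<^sub>R z)) z * s" for s
      using linear_neg[OF l, of "s *\<^sub>R z"] linear_scale[OF l, of s z] by simp
    show ?thesis
      using has_derivative_compose[OF i test_function_has_derivative[OF \<phi>]]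
      unfolding has_field_derivative_def e .
  qed
  have "norm (\<phi> (x - h *\<^sub>R z) - \<phi> (x - 0 *\<^sub>R z)) \<le> B * norm (h - 0)"
    by (rule field_differentiable_bound[of UNIV _ "\<lambda>t. - frechet_derivative \<phi> (at (x - t *\<^sub>R z)) z"])
       (use d B in auto)
  then show ?thesis by simp
qed

lemma test_function_difference_quotient:
  assumes \<phi>: "test_function V \<phi>"
  shows "((\<lambda>h. (\<phi> (x - h *\<^sub>R z) - \<phi> x) / h) \<longlongrightarrow> - frechet_derivative \<phi> (at x) z) (at 0)"
proof -
  have i: "((\<lambda>t. x - t *\<^sub>R z) has_derivative (\<lambda>s. - (s *\<^sub>R z))) (at 0)"
    by (auto intro!: derivative_eq_intros)
  have "(\<phi> has_derivative frechet_derivative \<phi> (at x)) (at (x - 0 *\<^sub>R z))"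
    using test_function_has_derivative[OF \<phi>, of x] by simp
  note c = has_derivative_compose[OF i this]
  have l: "linear (frechet_derivative \<phi> (at x))"
    using has_derivative_linear[OF test_function_has_derivative[OF \<phi>]] .
  have e: "frechet_derivative \<phi> (at x) (- (s *\<^sub>R z)) = - frechet_derivative \<phi> (at x) z * s" for s
    using linear_neg[OF l, of "s *\<^sub>R z"] linear_scale[OF l, of s z] by simp
  have "((\<lambda>t. \<phi> (x - t *\<^sub>R z)) has_real_derivative - frechet_derivative \<phi> (at x) z) (at 0)"
    using c unfolding has_field_derivative_def e .
  then show ?thesis unfolding DERIV_def by simp
qed

text \<open>Differentiation under the integral sign: moving the test function is the way in which weak
  derivatives see difference quotients.\<close>

lemma derivative_integral_translated_test_function:
  fixes f :: "'a::euclidean_space \<Rightarrow> real"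
  assumes V: "open V" and f: "locally_integrable V f" and \<phi>: "test_function V \<phi>"
  shows "((\<lambda>h. LINT x|lebesgue. f x * \<phi> (x - h *\<^sub>R z)) has_real_derivative
           - (LINT x|lebesgue. f x * frechet_derivative \<phi> (at x) z)) (at 0)"
proof -
  obtain K where K: "compact K" "K \<subseteq> V" "\<And>x. x \<notin> K \<Longrightarrow> \<phi> x = 0"
    "\<And>x. x \<notin> K \<Longrightarrow> frechet_derivative \<phi> (at x) z = 0"
    using test_function_support[OF \<phi>] by blast
  obtain d K' where d: "d > 0" and K': "compact K'" "K' \<subseteq> V" "K \<subseteq> K'"
      "\<And>x y. x \<in> K \<Longrightarrow> dist x y \<le> d \<Longrightarrow> y \<in> K'"
    using compact_in_open_neighbourhood[OF K(1) V K(2)] by blast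
  obtain B where B: "B \<ge> 0" "\<And>x. \<bar>frechet_derivative \<phi> (at x) z\<bar> \<le> B"
    using test_function_bounded_derivative[OF \<phi>] by blast
  have out: "\<phi> (x - h *\<^sub>R z) = 0" if "norm (h *\<^sub>R z) \<le> d" "x \<notin> K'" for x h
  proof (rule K(3), rule notI)
    assume "x - h *\<^sub>R z \<in> K"
    from K'(4)[OF this, of x] that show False by (simp add: dist_norm)
  qed
  have cont: "continuous_on UNIV (\<lambda>x. \<phi> (x - h *\<^sub>R z))" for h
    by (intro continuous_on_compose2[OF test_function_continuous[OF \<phi>, of UNIV]] continuous_intros) auto
  have int: "integrable lebesgue (\<lambda>x. f x * \<phi> (x - h *\<^sub>R z))" if "norm (h *\<^sub>R z) \<le> d" for h
    by (rule locally_integrable_mult_continuous[OF f K'(1,2) cont]) (use out that in auto)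
  have int0: "integrable lebesgue (\<lambda>x. f x * \<phi> x)" using int[of 0] d by simp
  \<comment> \<open>the difference quotient, cut off for large \<open>h\<close> so that one integrable bound serves for all \<open>h\<close>\<close>
  define q where "q h x = (if norm (h *\<^sub>R z) \<le> d then f x * ((\<phi> (x - h *\<^sub>R z) - \<phi> x) / h) else 0)" for h x
  have qi: "integrable lebesgue (q h)" for h
  proof (cases "norm (h *\<^sub>R z) \<le> d")
    case True
    have "integrable lebesgue (\<lambda>x. (f x * \<phi> (x - h *\<^sub>R z) - f x * \<phi> x) / h)"
      using int[OF True] int0 by simp
    then show ?thesis using True by (simp add: q_def[abs_def] algebra_simps)
  qed (simp add: q_def[abs_def])
  have ev: "\<forall>\<^sub>F h in at 0. norm (h *\<^sub>R z) \<le> d"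
  proof -
    have "((\<lambda>h. norm (h *\<^sub>R z)) \<longlongrightarrow> norm (0 *\<^sub>R z)) (at (0::real))" by (intro tendsto_intros)
    then have "\<forall>\<^sub>F h in at 0. norm (h *\<^sub>R z) < d" using d by (intro order_tendstoD) auto
    then show ?thesis by (auto elim: eventually_mono)
  qed
  have iK': "integrable lebesgue (\<lambda>x. B * \<bar>f x * indicator K' x\<bar>)"
  proof -
    have "integrable lebesgue (\<lambda>x. f x * indicator K' x)"
    proof (rule locally_integrable_mult[OF f K'(1,2), of _ 1])
      show "indicat_real K' \<in> borel_measurable lebesgue"
        by (intro borel_measurable_indicator fmeasurableD lmeasurable_compact K'(1))
    qed (auto simp: indicator_def)
    then show ?thesis by simp
  qed
  have "(\<lambda>h. LINT x|lebesgue. q h x) \<midarrow>0\<rightarrow> (LINT x|lebesgue. f x * - frechet_derivative \<phi> (at x) z)"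
  proof (subst LIMSEQ_SEQ_conv[symmetric], intro allI impI)
    fix S :: "nat \<Rightarrow> real" assume S: "(\<forall>n. S n \<noteq> 0) \<and> S \<longlonglongrightarrow> 0"
    then have S0: "filterlim S (at 0) sequentially" by (simp add: filterlim_at)
    show "(\<lambda>n. LINT x|lebesgue. q (S n) x) \<longlonglongrightarrow> (LINT x|lebesgue. f x * - frechet_derivative \<phi> (at x) z)"
    proof (rule integral_dominated_convergence[where w = "\<lambda>x. B * \<bar>f x * indicator K' x\<bar>"])
      have "continuous_on UNIV (\<lambda>x. - frechet_derivative \<phi> (at x) z)"
        by (intro continuous_intros test_function_continuous_derivative[OF \<phi>])
      then have "integrable lebesgue (\<lambda>x. f x * - frechet_derivative \<phi> (at x) z)"
        by (rule locally_integrable_mult_continuous[OF f K(1,2)]) (simp add: K(4))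
      then show "(\<lambda>x. f x * - frechet_derivative \<phi> (at x) z) \<in> borel_measurable lebesgue"
        by (rule borel_measurable_integrable)
      show "q (S n) \<in> borel_measurable lebesgue" for n using qi by (rule borel_measurable_integrable)
      have "(\<lambda>n. q (S n) x) \<longlonglongrightarrow> f x * - frechet_derivative \<phi> (at x) z" for x
      proof -
        have "((\<lambda>h. q h x) \<longlongrightarrow> f x * - frechet_derivative \<phi> (at x) z) (at 0)"
          by (rule Lim_transform_eventually[OF tendsto_mult_left[OF test_function_difference_quotient[OF \<phi>]]])
             (use ev in \<open>auto simp: q_def elim: eventually_mono\<close>)
        from filterlim_compose[OF this S0] show ?thesis .
      qed
      then show "AE x in lebesgue. (\<lambda>n. q (S n) x) \<longlonglongrightarrow> f x * - frechet_derivative \<phi> (at x) z" by simp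
      have "norm (q (S n) x) \<le> B * \<bar>f x * indicator K' x\<bar>" for n x
      proof (cases "norm (S n *\<^sub>R z) \<le> d \<and> x \<in> K'")
        case True
        have "\<bar>(\<phi> (x - S n *\<^sub>R z) - \<phi> x) / S n\<bar> \<le> B"
          using test_function_increment[OF \<phi> B(2), of x "S n"] S by (simp add: abs_divide divide_le_eq)
        from mult_left_mono[OF this, of "\<bar>f x\<bar>"] True
        show ?thesis by (simp add: q_def abs_mult mult.commute abs_divide)
      next
        case False
        then have "q (S n) x = 0" using out[of "S n" x] K(3)[of x] K'(3) by (auto simp: q_def)
        then show ?thesis using B(1) by simp
      qed
      then show "AE x in lebesgue. norm (q (S n) x) \<le> B * \<bar>f x * indicator K' x\<bar>" for n by simp
    qed (rule iK')
  qed
  moreover have "\<forall>\<^sub>F h in at 0. (LINT x|lebesgue. q h x) =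
      ((LINT x|lebesgue. f x * \<phi> (x - (0 + h) *\<^sub>R z)) - (LINT x|lebesgue. f x * \<phi> (x - 0 *\<^sub>R z))) / h"
    using ev
  proof (rule eventually_mono)
    fix h assume h: "norm (h *\<^sub>R z) \<le> d"
    have "(LINT x|lebesgue. q h x) = (LINT x|lebesgue. (f x * \<phi> (x - h *\<^sub>R z) - f x * \<phi> x) / h)"
      using h by (simp add: q_def algebra_simps)
    also have "\<dots> = (LINT x|lebesgue. f x * \<phi> (x - h *\<^sub>R z) - f x * \<phi> x) / h"
      by (rule Bochner_Integration.integral_divide_zero)
    also have "(LINT x|lebesgue. f x * \<phi> (x - h *\<^sub>R z) - f x * \<phi> x) =
        (LINT x|lebesgue. f x * \<phi> (x - h *\<^sub>R z)) - (LINT x|lebesgue. f x * \<phi> x)"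
      by (rule Bochner_Integration.integral_diff[OF int[OF h] int0])
    finally show "(LINT x|lebesgue. q h x) =
      ((LINT x|lebesgue. f x * \<phi> (x - (0 + h) *\<^sub>R z)) - (LINT x|lebesgue. f x * \<phi> (x - 0 *\<^sub>R z))) / h"
      by simp
  qed
  ultimately have "((\<lambda>h. ((LINT x|lebesgue. f x * \<phi> (x - (0 + h) *\<^sub>R z)) - (LINT x|lebesgue. f x * \<phi> (x - 0 *\<^sub>R z))) / h)
      \<longlongrightarrow> (LINT x|lebesgue. f x * - frechet_derivative \<phi> (at x) z)) (at 0)"
    by (rule Lim_transform_eventually)
  then show ?thesis unfolding DERIV_def by simp
qed

lemma locally_integrable_continuous:
  fixes f :: "'a::euclidean_space \<Rightarrow> 'b::euclidean_space"
  assumes "continuous_on V f" shows "locally_integrable V f"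
  unfolding locally_integrable_def
proof (intro allI impI)
  fix K assume K: "compact K" "K \<subseteq> V"
  have "integrable lborel (\<lambda>x. indicator K x *\<^sub>R f x)"
    using borel_integrable_compact[OF K(1) continuous_on_subset[OF assms K(2)]]
    by (simp add: indicator_scaleR_eq_if)
  then have "integrable lebesgue (\<lambda>x. indicator K x *\<^sub>R f x)"
    using integrable_completion[of "\<lambda>x. indicator K x *\<^sub>R f x" lborel] by (simp add: borel_measurable_integrable)
  then show "integrable (lebesgue_on K) f"
    using K(1) by (subst integrable_restrict_space) (simp_all add: fmeasurableD lmeasurable_compact)
qed

text \<open>Translating a test function does not change its integral.\<close>

lemma integral_derivative_test_function:
  assumes \<phi>: "test_function UNIV \<phi>"
  shows "(LINT x|lebesgue. frechet_derivative \<phi> (at x) z) = 0"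
proof -
  have "locally_integrable UNIV (\<lambda>x::'a. 1::real)"
    by (rule locally_integrable_continuous) (rule continuous_on_const)
  note d = derivative_integral_translated_test_function[OF open_UNIV this \<phi>, of z]
  have i: "integrable lebesgue \<phi>"
  proof -
    obtain K where K: "compact K" "\<And>x. x \<notin> K \<Longrightarrow> \<phi> x = 0" using test_function_support[OF \<phi>] by blast
    have "integrable lebesgue (\<lambda>x. 1 * \<phi> x)"
      by (rule locally_integrable_mult_continuous[OF \<open>locally_integrable UNIV (\<lambda>x::'a. 1::real)\<close> K(1)])
         (use K(2) test_function_continuous[OF \<phi>] in auto)
    then show ?thesis by simp
  qed
  have "(LINT x|lebesgue. \<phi> (x - h *\<^sub>R z)) = (LINT x|lebesgue. \<phi> x)" for h
    using integral_lebesgue_translation(2)[OF i, of "- (h *\<^sub>R z)"] by simp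
  then have "((\<lambda>h. LINT x|lebesgue. \<phi> x) has_real_derivative - (LINT x|lebesgue. frechet_derivative \<phi> (at x) z)) (at 0)"
    using d by simp
  from DERIV_unique[OF this DERIV_const] show ?thesis by simp
qed

lemma weak_derivative_test_function:
  assumes V: "open V" and \<psi>: "test_function V \<psi>"
  shows "weak_derivative V z \<psi> (\<lambda>x. frechet_derivative \<psi> (at x) z)"
  unfolding weak_derivative_def
proof (intro conjI allI impI)
  show "locally_integrable V \<psi>" "locally_integrable V (\<lambda>x. frechet_derivative \<psi> (at x) z)"
    by (intro locally_integrable_continuous test_function_continuous[OF \<psi>] test_function_continuous_derivative[OF \<psi>])+
  fix \<phi> assume \<phi>: "test_function V \<phi>"
  have t: "test_function UNIV (\<lambda>x. \<psi> x * \<phi> x)"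
    by (rule test_function_mono[OF test_function_mult_smooth[OF \<psi> test_function_smooth[OF \<phi>]]]) simp
  have e: "frechet_derivative (\<lambda>x. \<psi> x * \<phi> x) (at x) z =
      \<psi> x * frechet_derivative \<phi> (at x) z + frechet_derivative \<psi> (at x) z * \<phi> x" for x
    using frechet_derivative_at[OF has_derivative_mult[OF test_function_has_derivative[OF \<psi>]
          test_function_has_derivative[OF \<phi>], of x]] by metis
  obtain K where K: "compact K" "\<And>x. x \<notin> K \<Longrightarrow> \<phi> x = 0"
    "\<And>x. x \<notin> K \<Longrightarrow> frechet_derivative \<phi> (at x) z = 0"
    using test_function_support[OF \<phi>] by blast
  have c1: "locally_integrable UNIV \<psi>"
    by (intro locally_integrable_continuous test_function_continuous[OF \<psi>])
  have c2: "locally_integrable UNIV (\<lambda>x. frechet_derivative \<psi> (at x) z)"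
    by (intro locally_integrable_continuous test_function_continuous_derivative[OF \<psi>])
  have i: "integrable lebesgue (\<lambda>x. \<psi> x * frechet_derivative \<phi> (at x) z)"
      "integrable lebesgue (\<lambda>x. frechet_derivative \<psi> (at x) z * \<phi> x)"
    using locally_integrable_mult_continuous[OF c1 K(1) subset_UNIV test_function_continuous_derivative[OF \<phi>] K(3)]
      locally_integrable_mult_continuous[OF c2 K(1) subset_UNIV test_function_continuous[OF \<phi>] K(2)] by simp_all
  show "(LINT x|lebesgue. \<psi> x * frechet_derivative \<phi> (at x) z) =
      - (LINT x|lebesgue. frechet_derivative \<psi> (at x) z * \<phi> x)"
    using integral_derivative_test_function[OF t, of z] unfolding e Bochner_Integration.integral_add[OF i] by linarith
qed

text \<open>Nonnegativity of \<open>h - h'\<close> for any two weak derivatives, used in both orders.\<close>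

lemma weak_derivative_unique:
  assumes V: "open V" and d: "weak_derivative V z f g" "weak_derivative V z f g'"
  shows "AE x in lebesgue. x \<in> V \<longrightarrow> g x = g' x"
proof -
  have l: "locally_integrable V g" "locally_integrable V g'" using d by (auto simp: weak_derivative_def)
  have le: "AE x in lebesgue. x \<in> V \<longrightarrow> 0 \<le> h x - h' x"
    if h: "weak_derivative V z f h" "weak_derivative V z f h'" for h h'
  proof (rule locally_integrable_nonnegI[OF V])
    have l: "locally_integrable V h" "locally_integrable V h'" using h by (auto simp: weak_derivative_def)
    then show "locally_integrable V (\<lambda>x. h x - h' x)" by (auto simp: locally_integrable_def)
    fix \<phi> assume \<phi>: "test_function V \<phi>" 
    obtain K where K: "compact K" "K \<subseteq> V" "\<And>x. x \<notin> K \<Longrightarrow> \<phi> x = 0"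
      using test_function_support[OF \<phi>] by blast
    have i: "integrable lebesgue (\<lambda>x. h x * \<phi> x)" "integrable lebesgue (\<lambda>x. h' x * \<phi> x)"
      by (rule locally_integrable_mult_continuous[OF _ K(1,2) test_function_continuous[OF \<phi>] K(3)], rule l, assumption)+
    have "(LINT x|lebesgue. h x * \<phi> x) = (LINT x|lebesgue. h' x * \<phi> x)"
      using h \<phi> unfolding weak_derivative_def by (metis neg_equal_iff_equal)
    then show "0 \<le> (LINT x|lebesgue. (h x - h' x) * \<phi> x)"
      unfolding left_diff_distrib Bochner_Integration.integral_diff[OF i] by simp
  qed
  show ?thesis using le[OF d] le[OF d(2,1)] by eventually_elim auto
qed

lemma weak_derivative_mono:
  assumes "weak_derivative V z f g" "V' \<subseteq> V" shows "weak_derivative V' z f g"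
  using assms locally_integrable_mono[OF _ assms(2)] test_function_mono[OF _ assms(2)]
  unfolding weak_derivative_def by blast

lemma has_weak_gradient_iff:
  fixes u :: "real^'d \<Rightarrow> real^'k"
  assumes V: "open V"
  shows "has_weak_gradient V u G \<longleftrightarrow> locally_integrable V u \<and> locally_integrable V G \<and>
     (\<forall>i j. weak_derivative V (axis j 1) (\<lambda>x. u x $ i) (\<lambda>x. G x $ i $ j))"
proof -
  have 1: "(LINT x|lebesgue_on V. f x * frechet_derivative \<phi> (at x) z) = (LINT x|lebesgue. f x * frechet_derivative \<phi> (at x) z)"
      "(LINT x|lebesgue_on V. f x * \<phi> x) = (LINT x|lebesgue. f x * \<phi> x)" if \<phi>: "test_function V \<phi>" for f \<phi> z
  proof -
    obtain K where K: "K \<subseteq> V" "\<And>x. x \<notin> K \<Longrightarrow> \<phi> x = 0 \<and> frechet_derivative \<phi> (at x) z = 0"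
      using test_function_support[OF \<phi>] by blast
    have z: "\<phi> x = 0 \<and> frechet_derivative \<phi> (at x) z = 0" if "x \<notin> V" for x using K that by blast
    show "(LINT x|lebesgue_on V. f x * frechet_derivative \<phi> (at x) z) = (LINT x|lebesgue. f x * frechet_derivative \<phi> (at x) z)"
      by (rule integral_lebesgue_on_eq[OF V]) (simp add: z)
    show "(LINT x|lebesgue_on V. f x * \<phi> x) = (LINT x|lebesgue. f x * \<phi> x)"
      by (rule integral_lebesgue_on_eq[OF V]) (simp add: z)
  qed
  have 2: "locally_integrable V (\<lambda>x. u x $ i)" if "locally_integrable V u" for i
    using that by (rule locally_integrable_component)
  have 3: "locally_integrable V (\<lambda>x. G x $ i $ j)" if "locally_integrable V G" for i j
    using locally_integrable_component[OF locally_integrable_component[OF that]] .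
  show ?thesis
    unfolding has_weak_gradient_def weak_derivative_def using 1 2 3 by (auto simp: 1)
qed

lemma weak_derivative_scaleR_sum:
  assumes V: "open V" and I: "finite I" and d: "\<And>j. j \<in> I \<Longrightarrow> weak_derivative V (b j) f (g j)"
    and f: "locally_integrable V f"
  shows "weak_derivative V (\<Sum>j\<in>I. c j *\<^sub>R b j) f (\<lambda>x. \<Sum>j\<in>I. c j * g j x)"
  unfolding weak_derivative_def
proof (intro conjI allI impI f)
  show "locally_integrable V (\<lambda>x. \<Sum>j\<in>I. c j * g j x)"
    using d unfolding locally_integrable_def weak_derivative_def by (auto intro!: Bochner_Integration.integrable_sum)
  fix \<phi> assume \<phi>: "test_function V \<phi>"
  obtain K where K: "compact K" "K \<subseteq> V" "\<And>x. x \<notin> K \<Longrightarrow> \<phi> x = 0"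
    "\<And>x v. x \<notin> K \<Longrightarrow> frechet_derivative \<phi> (at x) v = 0"
    using test_function_support[OF \<phi>] by blast
  have l: "frechet_derivative \<phi> (at x) (\<Sum>j\<in>I. c j *\<^sub>R b j) = (\<Sum>j\<in>I. c j * frechet_derivative \<phi> (at x) (b j))" for x
  proof -
    have "linear (frechet_derivative \<phi> (at x))"
      using has_derivative_linear[OF test_function_has_derivative[OF \<phi>]] .
    then show ?thesis by (simp add: linear_sum linear_scale)
  qed
  have i1: "integrable lebesgue (\<lambda>x. f x * frechet_derivative \<phi> (at x) (b j))" for j
    by (rule locally_integrable_mult_continuous[OF f K(1,2) test_function_continuous_derivative[OF \<phi>] K(4)])
  have i2: "integrable lebesgue (\<lambda>x. g j x * \<phi> x)" if "j \<in> I" for j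
  proof (rule locally_integrable_mult_continuous[OF _ K(1,2) test_function_continuous[OF \<phi>] K(3)])
    show "locally_integrable V (g j)" using d[OF that] by (simp add: weak_derivative_def)
  qed
  have "(LINT x|lebesgue. f x * frechet_derivative \<phi> (at x) (\<Sum>j\<in>I. c j *\<^sub>R b j)) =
      (LINT x|lebesgue. (\<Sum>j\<in>I. c j * (f x * frechet_derivative \<phi> (at x) (b j))))"
    unfolding l sum_distrib_left by (simp add: algebra_simps)
  also have "\<dots> = (\<Sum>j\<in>I. c j * (LINT x|lebesgue. f x * frechet_derivative \<phi> (at x) (b j)))"
    using i1 by (subst Bochner_Integration.integral_sum) auto
  also have "\<dots> = (\<Sum>j\<in>I. c j * (- (LINT x|lebesgue. g j x * \<phi> x)))"
    using d \<phi> by (intro sum.cong refl) (simp add: weak_derivative_def)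
  also have "\<dots> = - (\<Sum>j\<in>I. (LINT x|lebesgue. c j * (g j x * \<phi> x)))" by (simp add: sum_negf)
  also have "\<dots> = - (LINT x|lebesgue. (\<Sum>j\<in>I. c j * (g j x * \<phi> x)))"
    using i2 by (subst Bochner_Integration.integral_sum) auto
  also have "\<dots> = - (LINT x|lebesgue. (\<Sum>j\<in>I. c j * g j x) * \<phi> x)"
    by (simp add: sum_distrib_right mult.assoc)
  finally show "(LINT x|lebesgue. f x * frechet_derivative \<phi> (at x) (\<Sum>j\<in>I. c j *\<^sub>R b j)) =
    - (LINT x|lebesgue. (\<Sum>j\<in>I. c j * g j x) * \<phi> x)" .
qed

lemma has_weak_gradient_direction:
  fixes u :: "real^'d \<Rightarrow> real^'k"
  assumes V: "open V" and u: "has_weak_gradient V u G"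
  shows "weak_derivative V z (\<lambda>x. u x $ i) (\<lambda>x. (G x *v z) $ i)"
proof -
  have "weak_derivative V (\<Sum>j\<in>UNIV. z $ j *\<^sub>R axis j 1) (\<lambda>x. u x $ i) (\<lambda>x. \<Sum>j\<in>UNIV. z $ j * G x $ i $ j)"
    using u unfolding has_weak_gradient_iff[OF V]
    by (intro weak_derivative_scaleR_sum[OF V]) (auto simp: locally_integrable_component)
  moreover have "(\<Sum>j\<in>UNIV. z $ j *\<^sub>R axis j 1) = z"
    using basis_expansion[of z] by (simp add: scalar_mult_eq_scaleR)
  ultimately show ?thesis by (simp add: matrix_vector_mult_def mult.commute)
qed

lemma AE_lebesgue_on_iff:
  "open V \<Longrightarrow> (AE x in lebesgue_on V. P x) \<longleftrightarrow> (AE x in lebesgue. x \<in> V \<longrightarrow> P x)"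
  by (subst AE_restrict_space_iff) auto

lemma has_weak_gradient_unique:
  fixes u :: "real^'d \<Rightarrow> real^'k"
  assumes V: "open V" and u: "has_weak_gradient V u G" "has_weak_gradient V u H"
  shows "AE x in lebesgue_on V. G x = H x"
proof -
  have "AE x in lebesgue. x \<in> V \<longrightarrow> G x $ i $ j = H x $ i $ j" for i j
  proof (rule weak_derivative_unique[OF V])
    show "weak_derivative V (axis j 1) (\<lambda>x. u x $ i) (\<lambda>x. G x $ i $ j)"
      "weak_derivative V (axis j 1) (\<lambda>x. u x $ i) (\<lambda>x. H x $ i $ j)"
      using u unfolding has_weak_gradient_iff[OF V] by blast+
  qed
  then have "AE x in lebesgue. \<forall>i j. x \<in> V \<longrightarrow> G x $ i $ j = H x $ i $ j"
    unfolding AE_all_countable by blast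
  then show ?thesis unfolding AE_lebesgue_on_iff[OF V] by eventually_elim (auto simp: vec_eq_iff)
qed

lemma has_weak_gradient_mono:
  fixes u :: "real^'d \<Rightarrow> real^'k"
  assumes "open V" "open V'" "V' \<subseteq> V" "has_weak_gradient V u G"
  shows "has_weak_gradient V' u G"
  using assms(4) unfolding has_weak_gradient_iff[OF assms(1)] has_weak_gradient_iff[OF assms(2)]
  by (intro conjI allI; elim conjE) (rule locally_integrable_mono[OF _ assms(3)], assumption,
      rule locally_integrable_mono[OF _ assms(3)], assumption,
      rule weak_derivative_mono[OF _ assms(3)], elim allE, assumption)

lemma weak_derivative_add:
  assumes "weak_derivative V z f g" "weak_derivative V z f' g'"
  shows "weak_derivative V z (\<lambda>x. f x + f' x) (\<lambda>x. g x + g' x)"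
proof -
  have l: "locally_integrable V f" "locally_integrable V f'" "locally_integrable V g" "locally_integrable V g'"
    using assms by (auto simp: weak_derivative_def)
  show ?thesis unfolding weak_derivative_def
  proof (intro conjI allI impI)
    show "locally_integrable V (\<lambda>x. f x + f' x)" "locally_integrable V (\<lambda>x. g x + g' x)"
      using l by (auto simp: locally_integrable_def)
    fix \<phi> assume \<phi>: "test_function V \<phi>"
    obtain K where K: "compact K" "K \<subseteq> V" "\<And>x. x \<notin> K \<Longrightarrow> \<phi> x = 0"
      "\<And>x v. x \<notin> K \<Longrightarrow> frechet_derivative \<phi> (at x) v = 0"
      using test_function_support[OF \<phi>] by blast
    have i1: "integrable lebesgue (\<lambda>x. h x * frechet_derivative \<phi> (at x) z)" if "locally_integrable V h" for h
      by (rule locally_integrable_mult_continuous[OF that K(1,2) test_function_continuous_derivative[OF \<phi>] K(4)])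
    have i2: "integrable lebesgue (\<lambda>x. h x * \<phi> x)" if "locally_integrable V h" for h
      by (rule locally_integrable_mult_continuous[OF that K(1,2) test_function_continuous[OF \<phi>] K(3)])
    show "(LINT x|lebesgue. (f x + f' x) * frechet_derivative \<phi> (at x) z) = - (LINT x|lebesgue. (g x + g' x) * \<phi> x)"
      using assms \<phi> by (simp add: distrib_right i1 i2 l weak_derivative_def)
  qed
qed

lemma weak_derivative_mult_const:
  assumes "weak_derivative V z f g"
  shows "weak_derivative V z (\<lambda>x. c * f x) (\<lambda>x. c * g x)"
  using assms unfolding weak_derivative_def by (auto simp: locally_integrable_def mult.assoc)

lemma has_weak_gradient_add:
  fixes u :: "real^'d \<Rightarrow> real^'k"
  assumes V: "open V" and "has_weak_gradient V u G" "has_weak_gradient V v H"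
  shows "has_weak_gradient V (\<lambda>x. u x + v x) (\<lambda>x. G x + H x)"
  using assms(2,3) unfolding has_weak_gradient_iff[OF V]
proof (intro conjI allI)
  fix i j
  assume u: "locally_integrable V u \<and> locally_integrable V G \<and>
      (\<forall>i j. weak_derivative V (axis j 1) (\<lambda>x. u x $ i) (\<lambda>x. G x $ i $ j))"
    and v: "locally_integrable V v \<and> locally_integrable V H \<and>
      (\<forall>i j. weak_derivative V (axis j 1) (\<lambda>x. v x $ i) (\<lambda>x. H x $ i $ j))"
  from u v show "locally_integrable V (\<lambda>x. u x + v x)" "locally_integrable V (\<lambda>x. G x + H x)"
    by (auto simp: locally_integrable_def)
  from u v have "weak_derivative V (axis j 1) (\<lambda>x. u x $ i) (\<lambda>x. G x $ i $ j)"
    "weak_derivative V (axis j 1) (\<lambda>x. v x $ i) (\<lambda>x. H x $ i $ j)" by blast+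
  from weak_derivative_add[OF this]
  show "weak_derivative V (axis j 1) (\<lambda>x. (u x + v x) $ i) (\<lambda>x. (G x + H x) $ i $ j)" by simp
qed

definition outer_product :: "real^'k \<Rightarrow> real^'d \<Rightarrow> real^'d^'k" where
  "outer_product \<zeta> v = (\<chi> i j. \<zeta> $ i * v $ j)"

definition gradient_vec :: "(real^'d \<Rightarrow> real) \<Rightarrow> real^'d \<Rightarrow> real^'d" where
  "gradient_vec \<psi> x = (\<chi> j. frechet_derivative \<psi> (at x) (axis j 1))"

lemma continuous_on_outer_product [continuous_intros]:
  assumes "continuous_on S f" "continuous_on S g"
  shows "continuous_on S (\<lambda>x. outer_product (f x) (g x))"
  unfolding outer_product_def by (intro continuous_intros assms)

lemma continuous_on_gradient_vec: "test_function V \<psi> \<Longrightarrow> continuous_on S (gradient_vec \<psi>)"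
  unfolding gradient_vec_def[abs_def]
  by (intro continuous_on_vec_lambda test_function_continuous_derivative)

lemma has_weak_gradient_test_function:
  fixes \<zeta> :: "real^'k" and V :: "(real^'d) set"
  assumes V: "open V" and \<psi>: "test_function V \<psi>"
  shows "has_weak_gradient V (\<lambda>x. \<psi> x *\<^sub>R \<zeta>) (\<lambda>x. outer_product \<zeta> (gradient_vec \<psi> x))"
  unfolding has_weak_gradient_iff[OF V]
proof (intro conjI allI)
  show "locally_integrable V (\<lambda>x. \<psi> x *\<^sub>R \<zeta>)"
    by (intro locally_integrable_continuous continuous_intros test_function_continuous[OF \<psi>])
  show "locally_integrable V (\<lambda>x. outer_product \<zeta> (gradient_vec \<psi> x))"
    by (intro locally_integrable_continuous continuous_intros continuous_on_gradient_vec[OF \<psi>])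
  show "weak_derivative V (axis j 1) (\<lambda>x. (\<psi> x *\<^sub>R \<zeta>) $ i) (\<lambda>x. outer_product \<zeta> (gradient_vec \<psi> x) $ i $ j)" for i j
    using weak_derivative_mult_const[OF weak_derivative_test_function[OF V \<psi>], of "axis j 1" "\<zeta> $ i"]
    by (simp add: outer_product_def gradient_vec_def mult.commute)
qed

lemma locally_integrable_cong_AE:
  fixes f g :: "'a::euclidean_space \<Rightarrow> 'b::euclidean_space"
  assumes V: "open V" and ae: "AE x in lebesgue_on V. f x = g x" and f: "locally_integrable V f"
  shows "locally_integrable V g"
  unfolding locally_integrable_def
proof (intro allI impI)
  fix K assume K: "compact K" "K \<subseteq> V"
  have Ks: "K \<inter> space lebesgue \<in> sets lebesgue" using K(1) by (simp add: fmeasurableD lmeasurable_compact)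
  have 1: "integrable lebesgue (\<lambda>x. indicator K x *\<^sub>R f x)"
    using f K integrable_restrict_space[OF Ks, of f] by (simp add: locally_integrable_def)
  have 2: "AE x in lebesgue. indicator K x *\<^sub>R f x = indicator K x *\<^sub>R g x"
    using ae unfolding AE_lebesgue_on_iff[OF V] by eventually_elim (use K in \<open>auto simp: indicator_def\<close>)
  have "(\<lambda>x. indicator K x *\<^sub>R g x) \<in> borel_measurable lebesgue"
    by (rule borel_measurable_AE[OF borel_measurable_integrable[OF 1] 2])
  then have "integrable lebesgue (\<lambda>x. indicator K x *\<^sub>R g x)"
    by (rule integrable_cong_AE_imp[OF 1]) (use 2 in \<open>auto elim: AE_mp\<close>)
  then show "integrable (lebesgue_on K) g" using integrable_restrict_space[OF Ks, of g] by simp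
qed

lemma has_weak_gradient_cong_AE:
  fixes u v :: "real^'d \<Rightarrow> real^'k"
  assumes V: "open V" and ae: "AE x in lebesgue_on V. u x = v x" "AE x in lebesgue_on V. G x = H x"
    and u: "has_weak_gradient V u G"
  shows "has_weak_gradient V v H"
proof -
  have l: "locally_integrable V v" "locally_integrable V H" "locally_integrable V u" "locally_integrable V G"
    using u locally_integrable_cong_AE[OF V] ae by (auto simp: has_weak_gradient_def)
  have "weak_derivative V (axis j 1) (\<lambda>x. v x $ i) (\<lambda>x. H x $ i $ j)" for i j
    unfolding weak_derivative_def
  proof (intro conjI allI impI)
    show "locally_integrable V (\<lambda>x. v x $ i)" by (rule locally_integrable_component[OF l(1)])
    show "locally_integrable V (\<lambda>x. H x $ i $ j)"
      by (rule locally_integrable_component[OF locally_integrable_component[OF l(2)]])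
    fix \<phi> assume \<phi>: "test_function V \<phi>"
    obtain K where K: "compact K" "K \<subseteq> V" "\<And>x. x \<notin> K \<Longrightarrow> \<phi> x = 0"
      "\<And>x v. x \<notin> K \<Longrightarrow> frechet_derivative \<phi> (at x) v = 0"
      using test_function_support[OF \<phi>] by blast
    have m: "(\<lambda>x. f x * frechet_derivative \<phi> (at x) z) \<in> borel_measurable lebesgue"
      "(\<lambda>x. f x * \<phi> x) \<in> borel_measurable lebesgue" if "locally_integrable V f" for f z
      using locally_integrable_mult_continuous[OF that K(1,2) test_function_continuous_derivative[OF \<phi>] K(4)]
        locally_integrable_mult_continuous[OF that K(1,2) test_function_continuous[OF \<phi>] K(3)]
      by (auto intro: borel_measurable_integrable)
    have "(LINT x|lebesgue. v x $ i * frechet_derivative \<phi> (at x) (axis j 1)) =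
        (LINT x|lebesgue. u x $ i * frechet_derivative \<phi> (at x) (axis j 1))"
    proof (rule integral_cong_AE)
      show "AE x in lebesgue. v x $ i * frechet_derivative \<phi> (at x) (axis j 1) =
          u x $ i * frechet_derivative \<phi> (at x) (axis j 1)"
        using ae(1) unfolding AE_lebesgue_on_iff[OF V]
        by eventually_elim (use K in \<open>metis mult_zero_right subsetD\<close>)
    qed (intro m locally_integrable_component l)+
    moreover have "(LINT x|lebesgue. H x $ i $ j * \<phi> x) = (LINT x|lebesgue. G x $ i $ j * \<phi> x)"
    proof (rule integral_cong_AE)
      show "AE x in lebesgue. H x $ i $ j * \<phi> x = G x $ i $ j * \<phi> x"
        using ae(2) unfolding AE_lebesgue_on_iff[OF V]
        by eventually_elim (use K in \<open>metis mult_zero_right subsetD\<close>)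
    qed (intro m(2) locally_integrable_component l)+
    ultimately show "(LINT x|lebesgue. v x $ i * frechet_derivative \<phi> (at x) (axis j 1)) =
        - (LINT x|lebesgue. H x $ i $ j * \<phi> x)"
      using u \<phi> unfolding has_weak_gradient_iff[OF V] weak_derivative_def by simp
  qed
  with l show ?thesis unfolding has_weak_gradient_iff[OF V] by blast
qed

text \<open>The two functions have the same weak gradients, so that the choice operator picks the
  same one: equality holds everywhere.\<close>

lemma weak_gradient_cong_AE:
  fixes u v :: "real^'d \<Rightarrow> real^'k"
  assumes V: "open V" and ae: "AE x in lebesgue_on V. u x = v x"
  shows "weak_gradient V u = weak_gradient V v"
proof -
  have "AE x in lebesgue_on V. v x = u x" using ae by eventually_elim simp
  then have "has_weak_gradient V u G \<longleftrightarrow> has_weak_gradient V v G" for G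
    using has_weak_gradient_cong_AE[OF V] ae by blast
  then show ?thesis by (simp add: weak_gradient_def)
qed

lemma weak_gradient_AE_eq:
  fixes u :: "real^'d \<Rightarrow> real^'k"
  assumes V: "open V" and u: "has_weak_gradient V u G"
  shows "AE x in lebesgue_on V. weak_gradient V u x = G x"
proof -
  have "has_weak_gradient V u (weak_gradient V u)" 
    unfolding weak_gradient_def by (rule someI[of "has_weak_gradient V u", OF u])
  then show ?thesis using has_weak_gradient_unique[OF V _ u] by blast
qed

text \<open>A smooth cutoff splits a test function on a union into test functions on the two parts.\<close>

lemma weak_derivative_Un:
  assumes V: "open V" "open V'" and d: "weak_derivative V z f g" "weak_derivative V' z f g"
    and l: "locally_integrable (V \<union> V') f" "locally_integrable (V \<union> V') g"
  shows "weak_derivative (V \<union> V') z f g"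
  unfolding weak_derivative_def
proof (intro conjI allI impI l)
  fix \<phi> assume \<phi>: "test_function (V \<union> V') \<phi>"
  obtain K where K: "compact K" "K \<subseteq> V \<union> V'" "\<And>x. x \<notin> K \<Longrightarrow> \<phi> x = 0"
    "\<And>x v. x \<notin> K \<Longrightarrow> frechet_derivative \<phi> (at x) v = 0"
    using test_function_support[OF \<phi>] by blast
  have "compact (K - V')" using compact_diff[OF K(1) V(2)] .
  moreover have "K - V' \<subseteq> V" using K(2) by blast
  ultimately obtain \<kappa> W where \<kappa>: "test_function V \<kappa>" "open W" "K - V' \<subseteq> W" "\<forall>x\<in>W. \<kappa> x = 1"
    using smooth_urysohn[OF _ V(1)] by metis
  \<comment> \<open>\<open>\<phi>2\<close> vanishes near \<open>K - V'\<close>, so that its support lies in \<open>V'\<close>\<close>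
  define \<phi>1 where "\<phi>1 x = \<kappa> x * \<phi> x" for x
  define \<phi>2 where "\<phi>2 x = \<phi> x + (-1) * (\<kappa> x * \<phi> x)" for x
  have t1: "test_function V \<phi>1"
    unfolding \<phi>1_def[abs_def] by (rule test_function_mult_smooth[OF \<kappa>(1) test_function_smooth[OF \<phi>]])
  have t2: "test_function V' \<phi>2" unfolding test_function_def
  proof (intro conjI allI exI[of _ "K - W"])
    show "Ck_on r \<phi>2 UNIV" for r unfolding \<phi>2_def[abs_def]
      by (rule Ck_on_add[OF open_UNIV test_function_smooth[OF \<phi>] Ck_on_mult[OF open_UNIV Ck_on_const[OF open_UNIV]
            Ck_on_mult[OF open_UNIV test_function_smooth[OF \<kappa>(1)] test_function_smooth[OF \<phi>]]]])
    show "compact (K - W)" using compact_diff[OF K(1) \<kappa>(2)] .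
    show "K - W \<subseteq> V'" using \<kappa>(3) by blast
    show "x \<notin> K - W \<longrightarrow> \<phi>2 x = 0" for x using K(3) \<kappa>(4) by (auto simp: \<phi>2_def)
  qed
  have sum: "\<phi> x = \<phi>1 x + \<phi>2 x" for x by (simp add: \<phi>1_def \<phi>2_def)
  have Dsum: "frechet_derivative \<phi> (at x) z = frechet_derivative \<phi>1 (at x) z + frechet_derivative \<phi>2 (at x) z" for x
  proof -
    have "(\<phi> has_derivative (\<lambda>v. frechet_derivative \<phi>1 (at x) v + frechet_derivative \<phi>2 (at x) v)) (at x)"
      using has_derivative_add[OF test_function_has_derivative[OF t1] test_function_has_derivative[OF t2]]
      by (simp add: sum[abs_def])
    from frechet_derivative_at[OF this] show ?thesis by metis
  qed
  have i: "integrable lebesgue (\<lambda>x. f x * frechet_derivative \<psi> (at x) z)"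
      "integrable lebesgue (\<lambda>x. g x * \<psi> x)" if \<psi>: "test_function V \<psi> \<or> test_function V' \<psi>" for \<psi>
  proof -
    have t: "test_function (V \<union> V') \<psi>" using \<psi> test_function_mono[of _ \<psi> "V \<union> V'"] by blast
    obtain K where K: "compact K" "K \<subseteq> V \<union> V'" "\<And>x. x \<notin> K \<Longrightarrow> \<psi> x = 0"
      "\<And>x v. x \<notin> K \<Longrightarrow> frechet_derivative \<psi> (at x) v = 0"
      using test_function_support[OF t] by blast
    show "integrable lebesgue (\<lambda>x. f x * frechet_derivative \<psi> (at x) z)"
      by (rule locally_integrable_mult_continuous[OF l(1) K(1,2) test_function_continuous_derivative[OF t] K(4)])
    show "integrable lebesgue (\<lambda>x. g x * \<psi> x)"
      by (rule locally_integrable_mult_continuous[OF l(2) K(1,2) test_function_continuous[OF t] K(3)])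
  qed
  have T1: "test_function V \<phi>1 \<or> test_function V' \<phi>1" and T2: "test_function V \<phi>2 \<or> test_function V' \<phi>2"
    using t1 t2 by blast+
  show "(LINT x|lebesgue. f x * frechet_derivative \<phi> (at x) z) = - (LINT x|lebesgue. g x * \<phi> x)"
    unfolding Dsum sum distrib_left Bochner_Integration.integral_add[OF i(1)[OF T1] i(1)[OF T2]]
      Bochner_Integration.integral_add[OF i(2)[OF T1] i(2)[OF T2]]
    using d t1 t2 by (simp add: weak_derivative_def)
qed

lemma has_weak_gradient_Un:
  fixes u :: "real^'d \<Rightarrow> real^'k"
  assumes V: "open V" "open V'" and "has_weak_gradient V u G" "has_weak_gradient V' u G"
    and l: "locally_integrable (V \<union> V') u" "locally_integrable (V \<union> V') G"
  shows "has_weak_gradient (V \<union> V') u G"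
  unfolding has_weak_gradient_iff[OF open_Un[OF V]]
  using assms(3,4) locally_integrable_component[OF l(1)] locally_integrable_component[OF locally_integrable_component[OF l(2)]]
  unfolding has_weak_gradient_iff[OF V(1)] has_weak_gradient_iff[OF V(2)]
  by (intro conjI allI l weak_derivative_Un V) auto

section \<open>Lipschitz representatives\<close>

lemma locally_integrable_translate:
  fixes f :: "'a::euclidean_space \<Rightarrow> real"
  assumes f: "locally_integrable V f" and a: "\<And>x. x \<in> V' \<Longrightarrow> x + a \<in> V"
  shows "locally_integrable V' (\<lambda>x. f (x + a))"
  unfolding locally_integrable_def
proof (intro allI impI)
  fix K assume K: "compact K" "K \<subseteq> V'"
  define K2 where "K2 = (\<lambda>x. x + a) ` K"
  have K2: "compact K2" "K2 \<subseteq> V"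
    using compact_translation[OF K(1), of a] a K(2) by (auto simp: K2_def add.commute)
  have "integrable lebesgue (\<lambda>x. indicator K2 x * f x)"
    using f K2 integrable_restrict_space[of K2 lebesgue f]
    by (simp add: locally_integrable_def fmeasurableD lmeasurable_compact)
  from integral_lebesgue_translation(1)[OF this, of a]
  have "integrable lebesgue (\<lambda>x. indicator K2 (x + a) * f (x + a))" .
  moreover have "indicator K2 (x + a) = (indicator K x :: real)" for x
    by (auto simp: K2_def indicator_def)
  ultimately show "integrable (lebesgue_on K) (\<lambda>x. f (x + a))"
    using integrable_restrict_space[of K lebesgue "\<lambda>x. f (x + a)"] K(1)
    by (simp add: fmeasurableD lmeasurable_compact)
qed

text \<open>Integrating \<open>f\<close> against a test function that moves in direction \<open>z\<close>, the derivative is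
  controlled by the bound on the weak derivative; the mean value theorem then compares \<open>f\<close> with its
  translate, in the weak sense.\<close>

lemma weak_derivative_increment_bound:
  fixes f g :: "'a::euclidean_space \<Rightarrow> real"
  assumes V: "open V" "open V'" and d: "weak_derivative V z f g"
    and c: "AE x in lebesgue. x \<in> V \<longrightarrow> \<bar>g x\<bar> \<le> c"
    and VV': "\<And>s x. 0 \<le> s \<Longrightarrow> s \<le> 1 \<Longrightarrow> x \<in> V' \<Longrightarrow> x + s *\<^sub>R z \<in> V"
  shows "AE x in lebesgue. x \<in> V' \<longrightarrow> \<bar>f (x + z) - f x\<bar> \<le> c"
proof -
  have f: "locally_integrable V f" and g: "locally_integrable V g" using d by (auto simp: weak_derivative_def)
  have f1: "locally_integrable V' (\<lambda>x. f (x + z))"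
    by (rule locally_integrable_translate[OF f]) (use VV'[of 1] in auto)
  have f0: "locally_integrable V' f"
    by (rule locally_integrable_mono[OF f]) (use VV'[of 0] in auto)
  have cc: "locally_integrable V' (\<lambda>x. c)" by (rule locally_integrable_continuous[OF continuous_on_const])
  have key: "\<bar>(LINT x|lebesgue. f (x + z) * \<phi> x) - (LINT x|lebesgue. f x * \<phi> x)\<bar> \<le> (LINT x|lebesgue. c * \<phi> x)"
    if \<phi>: "test_function V' \<phi>" and pos: "\<And>x. 0 \<le> \<phi> x" for \<phi>
  proof -
    define p where "p s x = \<phi> (x - s *\<^sub>R z)" for s x
    have tp: "test_function V (p s)" if s: "0 \<le> s" "s \<le> 1" for s
    proof (rule test_function_mono)
      show "test_function ((\<lambda>x. x + s *\<^sub>R z) ` V') (p s)"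
        unfolding p_def[abs_def] by (rule test_function_translate[OF \<phi>])
      show "(\<lambda>x. x + s *\<^sub>R z) ` V' \<subseteq> V" using VV' s by auto
    qed
    have int: "integrable lebesgue (\<lambda>x. h x * p s x)" if h: "locally_integrable V h" and s: "0 \<le> s" "s \<le> 1" for h s
    proof -
      obtain K where K: "compact K" "K \<subseteq> V" "\<And>x. x \<notin> K \<Longrightarrow> p s x = 0"
        using test_function_support[OF tp[OF s]] by blast
      show ?thesis
        by (rule locally_integrable_mult_continuous[OF h K(1,2) test_function_continuous[OF tp[OF s]] K(3)])
    qed
    define F where "F s = (LINT x|lebesgue. f x * p s x)" for s
    have dF: "(F has_real_derivative (LINT x|lebesgue. g x * p s x)) (at s)" if s: "0 \<le> s" "s \<le> 1" for s
    proof -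
      have e: "F (h + s) = (LINT x|lebesgue. f x * p s (x - h *\<^sub>R z))" for h
        by (simp add: F_def p_def algebra_simps)
      have "((\<lambda>h. F (h + s)) has_real_derivative - (LINT x|lebesgue. f x * frechet_derivative (p s) (at x) z)) (at 0)"
        unfolding e by (rule derivative_integral_translated_test_function[OF V(1) f tp[OF s]])
      moreover have "- (LINT x|lebesgue. f x * frechet_derivative (p s) (at x) z) = (LINT x|lebesgue. g x * p s x)"
        using d tp[OF s] by (simp add: weak_derivative_def)
      ultimately show ?thesis using DERIV_shift[of F _ 0 s] by simp
    qed
    have bound: "\<bar>LINT x|lebesgue. g x * p s x\<bar> \<le> (LINT x|lebesgue. c * \<phi> x)" if s: "0 \<le> s" "s \<le> 1" for s
    proof -
      have ci: "integrable lebesgue (\<lambda>x. c * p s x)"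
        by (rule int[OF locally_integrable_continuous[OF continuous_on_const] s])
      have ci0: "integrable lebesgue (\<lambda>x. c * \<phi> x)"
        using int[OF locally_integrable_continuous[OF continuous_on_const], of 0 c] by (simp add: p_def)
      have out: "p s x = 0" if "x \<notin> V" for x
        using test_function_support[OF tp[OF s]] that by blast
      have "\<bar>LINT x|lebesgue. g x * p s x\<bar> \<le> (LINT x|lebesgue. \<bar>g x * p s x\<bar>)"
        by (rule integral_abs_bound)
      also have "\<dots> \<le> (LINT x|lebesgue. c * p s x)"
      proof (rule integral_mono_AE)
        show "AE x in lebesgue. \<bar>g x * p s x\<bar> \<le> c * p s x"
          using c
        proof eventually_elim
          case (elim x)
          show ?case
          proof (cases "x \<in> V")
            case True
            then show ?thesis using elim pos by (auto simp: abs_mult p_def intro!: mult_right_mono)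
          qed (simp add: out)
        qed
      qed (use int[OF g s] ci in auto)
      also have "\<dots> = (LINT x|lebesgue. c * \<phi> x)"
        using integral_lebesgue_translation(2)[OF ci0, of "- (s *\<^sub>R z)"] by (simp add: p_def)
      finally show ?thesis .
    qed
    have "norm (F 1 - F 0) \<le> (LINT x|lebesgue. c * \<phi> x) * norm (1 - 0 :: real)"
      by (rule field_differentiable_bound[of "{0..1}" F "\<lambda>s. LINT x|lebesgue. g x * p s x"])
         (use dF bound in \<open>auto intro: has_field_derivative_at_within\<close>)
    moreover have "F 0 = (LINT x|lebesgue. f x * \<phi> x)" by (simp add: F_def p_def)
    moreover have "F 1 = (LINT x|lebesgue. f (x + z) * \<phi> x)"
      using integral_lebesgue_translation(2)[OF int[OF f, of 1], of z] by (simp add: F_def p_def)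
    ultimately show ?thesis by simp
  qed
  have pm: "AE x in lebesgue. x \<in> V' \<longrightarrow> 0 \<le> c + s * (f (x + z) - f x)" if s: "s = 1 \<or> s = -1" for s
  proof (rule locally_integrable_nonnegI[OF V(2)])
    show "locally_integrable V' (\<lambda>x. c + s * (f (x + z) - f x))"
      using f1 f0 cc unfolding locally_integrable_def by auto
    fix \<phi> assume \<phi>: "test_function V' \<phi>" "\<And>x. 0 \<le> \<phi> x"
    obtain K where K: "compact K" "K \<subseteq> V'" "\<And>x. x \<notin> K \<Longrightarrow> \<phi> x = 0"
      using test_function_support[OF \<phi>(1)] by blast
    have int: "integrable lebesgue (\<lambda>x. h x * \<phi> x)" if h: "locally_integrable V' h" for h
      by (rule locally_integrable_mult_continuous[OF h K(1,2) test_function_continuous[OF \<phi>(1)] K(3)])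
    have "(LINT x|lebesgue. (c + s * (f (x + z) - f x)) * \<phi> x) =
        (LINT x|lebesgue. c * \<phi> x + s * (f (x + z) * \<phi> x - f x * \<phi> x))"
      by (simp add: algebra_simps)
    also have "\<dots> = (LINT x|lebesgue. c * \<phi> x) + s * ((LINT x|lebesgue. f (x + z) * \<phi> x) - (LINT x|lebesgue. f x * \<phi> x))"
      using int[OF cc] int[OF f1] int[OF f0] by simp
    finally show "0 \<le> (LINT x|lebesgue. (c + s * (f (x + z) - f x)) * \<phi> x)"
      using key[OF \<phi>] s by auto
  qed
  have "AE x in lebesgue. x \<in> V' \<longrightarrow> 0 \<le> c + 1 * (f (x + z) - f x)" by (rule pm) simp
  moreover have "AE x in lebesgue. x \<in> V' \<longrightarrow> 0 \<le> c + (-1) * (f (x + z) - f x)" by (rule pm) simp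
  ultimately show ?thesis by eventually_elim auto
qed

lemma AE_lebesgue_translate:
  fixes a :: "'a::euclidean_space"
  assumes "AE x in lebesgue. P x" shows "AE x in lebesgue. P (x + a)"
proof -
  have m: "distr lebesgue lebesgue (\<lambda>x. x + a) = lebesgue" by (rule lebesgue_translation[symmetric])
  show ?thesis
    by (rule AE_distrD[OF measurable_lebesgue_translation]) (subst m, rule assms)
qed

text \<open>Nonempty open sets have positive measure.\<close>

lemma AE_lebesgue_open_ex:
  assumes "AE x in lebesgue. P x" "open U" "U \<noteq> {}"
  shows "\<exists>x\<in>U. P (x::'a::euclidean_space)"
proof (rule ccontr)
  assume n: "\<not> (\<exists>x\<in>U. P x)"
  have "AE x in lebesgue. x \<notin> U" using assms(1) by eventually_elim (use n in auto)
  then have "U \<in> null_sets lebesgue" using assms(2) by (subst AE_iff_null_sets) auto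
  then show False using open_not_negligible[OF assms(2,3)] by (simp add: negligible_iff_null_sets)
qed

text \<open>For each fixed translation the increment bound holds almost everywhere; by Fubini, for
  almost every \<open>x\<close> it holds for almost all translations. Two such points can be compared through a common
  third point close to one of them, which makes \<open>f\<close> Lipschitz on a set of full measure. That set
  is dense, and the Lipschitz extension to its closure is the representative. Fubini is applied to
  a Borel representative, to have measurability on the product.\<close>

lemma weak_derivative_lipschitz_representative:
  fixes f :: "'a::euclidean_space \<Rightarrow> real"
  assumes r: "r > 0" and C: "C \<ge> 0"
    and d: "\<And>z. \<exists>g. weak_derivative (ball x0 (4 * r)) z f g \<and>
              (AE x in lebesgue. x \<in> ball x0 (4 * r) \<longrightarrow> \<bar>g x\<bar> \<le> C * norm z)"
  shows "\<exists>h. C-lipschitz_on (ball x0 r) h \<and> (AE x in lebesgue. x \<in> ball x0 r \<longrightarrow> f x = h x)"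
proof -
  have inc: "AE x in lebesgue. x \<in> ball x0 r \<longrightarrow> \<bar>f (x + z) - f x\<bar> \<le> C * norm z" if z: "norm z < 2 * r" for z
  proof -
    obtain g where g: "weak_derivative (ball x0 (4 * r)) z f g"
      "AE x in lebesgue. x \<in> ball x0 (4 * r) \<longrightarrow> \<bar>g x\<bar> \<le> C * norm z" using d by blast
    show ?thesis
    proof (rule weak_derivative_increment_bound[OF open_ball open_ball g])
      fix s :: real and x assume s: "0 \<le> s" "s \<le> 1" and x: "x \<in> ball x0 r"
      have "norm (s *\<^sub>R z) \<le> norm z" using s by (simp add: mult_left_le_one_le)
      moreover have "dist x0 (x + s *\<^sub>R z) \<le> dist x0 x + norm (s *\<^sub>R z)"
        using dist_triangle[of x0 "x + s *\<^sub>R z" x] by (simp add: dist_norm)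
      ultimately show "x + s *\<^sub>R z \<in> ball x0 (4 * r)" using x z r by simp
    qed
  qed
  have lf: "locally_integrable (ball x0 (4 * r)) f" using d[of 0] by (auto simp: weak_derivative_def)
  have "integrable lebesgue (\<lambda>x. f x * indicator (cball x0 (3 * r)) x)"
  proof (rule locally_integrable_mult[OF lf compact_cball[of x0 "3 * r"], of _ 1])
    show "indicat_real (cball x0 (3 * r)) \<in> borel_measurable lebesgue" by (rule borel_measurable_indicator) simp
  qed (use r in auto)
  then have "(\<lambda>x. f x * indicator (cball x0 (3 * r)) x) \<in> borel_measurable (completion lborel)" by simp
  from completion_ex_borel_measurable_real[OF this] obtain f' where
    f'[measurable]: "f' \<in> borel_measurable borel" and "AE x in lborel. f x * indicator (cball x0 (3 * r)) x = f' x"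
    by auto
  then have eq: "AE x in lebesgue. f x * indicator (cball x0 (3 * r)) x = f' x" by (simp add: AE_completion)
  define P where "P x z \<longleftrightarrow> (dist x0 x < r \<and> norm z < 2 * r \<longrightarrow> \<bar>f' (x + z) - f' x\<bar> \<le> C * norm z)" for x z
  have Pz: "AE x in lebesgue. P x z" for z
  proof (cases "norm z < 2 * r")
    case True
    show ?thesis using inc[OF True] eq AE_lebesgue_translate[OF eq, of z]
    proof eventually_elim
      case (elim x)
      show ?case unfolding P_def
      proof (intro impI)
        assume x: "dist x0 x < r \<and> norm z < 2 * r"
        have "dist x0 (x + z) \<le> dist x0 x + norm z"
          using dist_triangle[of x0 "x + z" x] by (simp add: dist_norm)
        then have "x \<in> cball x0 (3 * r)" "x + z \<in> cball x0 (3 * r)" using x r by auto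
        then show "\<bar>f' (x + z) - f' x\<bar> \<le> C * norm z" using elim x by simp
      qed
    qed
  qed (simp add: P_def)
  have meas: "{p \<in> space (lborel \<Otimes>\<^sub>M lborel). P (fst p) (snd p)} \<in> sets (lborel \<Otimes>\<^sub>M lborel)"
    unfolding P_def by measurable
  have "AE z in lborel. AE x in lborel. P x z" using Pz by (simp add: AE_completion_iff)
  then have Px: "AE x in lborel. AE z in lborel. P x z" using lborel_pair.AE_commute[OF meas] by simp
  define S where "S = {x \<in> ball x0 r. (AE z in lborel. P x z) \<and> f x = f' x}"
  have Sae: "AE x in lebesgue. x \<in> ball x0 r \<longrightarrow> x \<in> S"
    using AE_completion[OF Px] eq
  proof eventually_elim
    case (elim x)
    then show ?case using r by (auto simp: S_def indicator_def)
  qed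
  have "C-lipschitz_on S f'"
    unfolding lipschitz_on_def
  proof (intro conjI ballI C)
    fix x y assume x: "x \<in> S" and y: "y \<in> S"
    show "dist (f' x) (f' y) \<le> C * dist x y"
    proof (rule field_le_epsilon)
      fix e :: real assume e: "e > 0"
      have xy: "dist x y < 2 * r"
        using x y dist_triangle2[of x y x0] by (auto simp: S_def dist_commute)
      define \<rho> where "\<rho> = min (e / (2 * (C + 1))) (2 * r - dist x y)"
      have \<rho>: "\<rho> > 0" using e C xy by (auto simp: \<rho>_def)
      have "AE z in lebesgue. P x z" "AE z in lebesgue. P y z"
        using x y by (auto simp: S_def intro: AE_completion)
      from this[THEN AE_lebesgue_translate]
      have ax: "AE w in lebesgue. P x (w + (- x))" "AE w in lebesgue. P y (w + (- y))" by blast+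
      then have "AE w in lebesgue. P x (w + (- x)) \<and> P y (w + (- y))" by eventually_elim simp
      from AE_lebesgue_open_ex[OF this open_ball, of x \<rho>] \<rho> obtain w where
        w: "dist x w < \<rho>" "P x (w + (- x))" "P y (w + (- y))" by auto
      have n: "norm (w + (- x)) = dist x w" "norm (w + (- y)) = dist y w"
        by (simp_all add: dist_norm norm_minus_commute)
      have yw: "dist y w \<le> dist x y + dist x w" using dist_triangle[of y w x] by (simp add: dist_commute)
      have 1: "\<bar>f' w - f' x\<bar> \<le> C * dist x w"
      proof -
        have "dist x w < 2 * r" using w(1) zero_le_dist[of x y] unfolding \<rho>_def by linarith
        then show ?thesis using w(2) x unfolding P_def n(1) S_def by simp
      qed
      have 2: "\<bar>f' w - f' y\<bar> \<le> C * dist y w"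
      proof -
        have "dist y w < 2 * r" using w(1) yw unfolding \<rho>_def by linarith
        then show ?thesis using w(3) y unfolding P_def n(2) S_def by simp
      qed
      have "dist (f' x) (f' y) \<le> \<bar>f' w - f' x\<bar> + \<bar>f' w - f' y\<bar>" by (simp add: dist_real_def)
      also have "\<dots> \<le> C * dist x w + C * (dist x y + dist x w)"
        using 1 2 mult_left_mono[OF yw C] by linarith
      also have "\<dots> = C * dist x y + 2 * C * dist x w" by (simp add: algebra_simps)
      also have "2 * C * dist x w \<le> 2 * (C + 1) * (e / (2 * (C + 1)))"
        using w(1) C by (intro mult_mono) (auto simp: \<rho>_def)
      also have "\<dots> = e" using C by simp
      finally show "dist (f' x) (f' y) \<le> C * dist x y + e" by simp
    qed
  qed
  from lipschitz_extend_closure[OF this] obtain h where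
    h: "C-lipschitz_on (closure S) h" "\<And>x. x \<in> S \<Longrightarrow> h x = f' x" by blast
  have "ball x0 r \<subseteq> closure S"
  proof
    fix x assume x: "x \<in> ball x0 r"
    show "x \<in> closure S" unfolding closure_iff_nhds_not_empty
    proof (intro allI impI)
      fix A V assume A: "V \<subseteq> A" "open V" "x \<in> V"
      have "\<exists>y\<in>V \<inter> ball x0 r. y \<in> ball x0 r \<longrightarrow> y \<in> S"
        by (rule AE_lebesgue_open_ex[OF Sae]) (use A x in auto)
      then show "S \<inter> A \<noteq> {}" using A by blast
    qed
  qed
  then have "C-lipschitz_on (ball x0 r) h" using lipschitz_on_subset[OF h(1)] by blast
  moreover have "AE x in lebesgue. x \<in> ball x0 r \<longrightarrow> f x = h x"
    using Sae by eventually_elim (use h(2) in \<open>auto simp: S_def\<close>)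
  ultimately show ?thesis by blast
qed

text \<open>Componentwise application of the scalar case; the Cauchy-Schwarz inequality bounds
  the directional derivatives by the norm of the gradient.\<close>

lemma has_weak_gradient_lipschitz_representative:
  fixes u :: "real^'d \<Rightarrow> real^'k"
  assumes r: "r > 0" and u: "has_weak_gradient (ball x0 (4 * r)) u G"
    and C: "AE x in lebesgue. x \<in> ball x0 (4 * r) \<longrightarrow> norm (G x) \<le> C"
  shows "\<exists>h L. L-lipschitz_on (ball x0 r) h \<and> (AE x in lebesgue. x \<in> ball x0 r \<longrightarrow> u x = h x)"
proof -
  have C0: "C \<ge> 0"
  proof -
    obtain x where "x \<in> ball x0 (4 * r)" "norm (G x) \<le> C"
      using AE_lebesgue_open_ex[OF C open_ball, of x0 "4 * r"] r by auto
    then show ?thesis using norm_ge_zero order_trans by blast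
  qed
  have "\<exists>h. C-lipschitz_on (ball x0 r) h \<and> (AE x in lebesgue. x \<in> ball x0 r \<longrightarrow> u x $ i = h x)" for i
  proof (rule weak_derivative_lipschitz_representative[OF r C0])
    fix z
    have "AE x in lebesgue. x \<in> ball x0 (4 * r) \<longrightarrow> \<bar>(G x *v z) $ i\<bar> \<le> C * norm z"
      using C
    proof eventually_elim
      case (elim x)
      have "\<bar>(G x *v z) $ i\<bar> \<le> norm (G x $ i) * norm z"
        unfolding matrix_vector_mul_component by (rule Cauchy_Schwarz_ineq2)
      also have "\<dots> \<le> norm (G x) * norm z" by (intro mult_right_mono Finite_Cartesian_Product.norm_nth_le norm_ge_zero)
      finally show ?case using elim mult_right_mono[of "norm (G x)" C "norm z"] by force
    qed
    then show "\<exists>g. weak_derivative (ball x0 (4 * r)) z (\<lambda>x. u x $ i) g \<and>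
        (AE x in lebesgue. x \<in> ball x0 (4 * r) \<longrightarrow> \<bar>g x\<bar> \<le> C * norm z)"
      using has_weak_gradient_direction[OF open_ball u, of z i] by blast
  qed
  then have "\<forall>i. \<exists>h. C-lipschitz_on (ball x0 r) h \<and> (AE x in lebesgue. x \<in> ball x0 r \<longrightarrow> u x $ i = h x)" by blast
  from choice[OF this] obtain h where h: "\<And>i. C-lipschitz_on (ball x0 r) (h i)"
    "\<And>i. AE x in lebesgue. x \<in> ball x0 r \<longrightarrow> u x $ i = h i x" by blast
  define H :: "real^'d \<Rightarrow> real^'k" where "H x = (\<chi> i. h i x)" for x
  have "(real CARD('k) * C)-lipschitz_on (ball x0 r) H"
    unfolding lipschitz_on_def
  proof (intro conjI ballI)
    fix x y assume xy: "x \<in> ball x0 r" "y \<in> ball x0 r"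
    have "dist (H x) (H y) \<le> (\<Sum>i\<in>UNIV. \<bar>h i x - h i y\<bar>)"
      unfolding dist_norm using norm_le_l1_cart[of "H x - H y"] by (simp add: H_def)
    also have "\<dots> \<le> (\<Sum>i\<in>(UNIV::'k set). C * dist x y)"
      using lipschitz_onD[OF h(1) xy] by (intro sum_mono) (simp add: dist_real_def)
    finally show "dist (H x) (H y) \<le> real CARD('k) * C * dist x y" by simp
  qed (use C0 in simp)
  moreover have "AE x in lebesgue. x \<in> ball x0 r \<longrightarrow> u x = H x"
  proof -
    have "AE x in lebesgue. \<forall>i. x \<in> ball x0 r \<longrightarrow> u x $ i = h i x"
      unfolding AE_all_countable using h(2) by blast
    then show ?thesis by eventually_elim (auto simp: H_def vec_eq_iff)
  qed
  ultimately show ?thesis by blast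
qed

section \<open>The chain rule\<close>

lemma continuous_on_test_function_mult:
  fixes w :: "'a::euclidean_space \<Rightarrow> real"
  assumes V: "open V" and w: "continuous_on V w" and \<phi>: "test_function V \<phi>"
  shows "continuous_on UNIV (\<lambda>x. w x * \<phi> x)"
proof -
  obtain K where K: "compact K" "K \<subseteq> V" "\<And>x. x \<notin> K \<Longrightarrow> \<phi> x = 0"
    using test_function_support[OF \<phi>] by blast
  have "continuous_on (V \<union> - K) (\<lambda>x. w x * \<phi> x)"
  proof (rule continuous_on_open_Un[OF V])
    show "open (- K)" using K(1) by (simp add: compact_imp_closed open_Compl)
    show "continuous_on V (\<lambda>x. w x * \<phi> x)"
      by (intro continuous_on_mult w test_function_continuous[OF \<phi>])
    show "continuous_on (- K) (\<lambda>x. w x * \<phi> x)"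
      by (rule continuous_on_eq[OF continuous_on_const[of _ 0]]) (simp add: K(3))
  qed
  moreover have "V \<union> - K = UNIV" using K(2) by blast
  ultimately show ?thesis by simp
qed

lemma locally_integrable_mult_continuous_on:
  fixes g v :: "'a::euclidean_space \<Rightarrow> real"
  assumes g: "locally_integrable V g" and v: "continuous_on V v"
  shows "locally_integrable V (\<lambda>x. g x * v x)"
  unfolding locally_integrable_def
proof (intro allI impI)
  fix K assume K: "compact K" "K \<subseteq> V"
  have m: "(\<lambda>x. indicator K x * v x) \<in> borel_measurable lebesgue"
  proof -
    have "integrable lborel (\<lambda>x. indicator K x *\<^sub>R v x)"
      using borel_integrable_compact[OF K(1) continuous_on_subset[OF v K(2)]]
      by (simp add: indicator_scaleR_eq_if)
    then show ?thesis by (intro measurable_completion) simp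
  qed
  have "bounded (v ` K)"
    using compact_continuous_image[OF continuous_on_subset[OF v K(2)] K(1)] by (rule compact_imp_bounded)
  then obtain B where B: "\<And>x. x \<in> K \<Longrightarrow> \<bar>v x\<bar> \<le> B" by (auto simp: bounded_iff)
  have "integrable lebesgue (\<lambda>x. g x * (indicator K x * v x))"
  proof (rule locally_integrable_mult[OF g K m, of "max B 0"])
    show "\<bar>indicator K x * v x\<bar> \<le> max B 0" for x using B[of x] by (auto simp: indicator_def)
  qed simp
  then have "integrable lebesgue (\<lambda>x. indicator K x * (g x * v x))" by (simp add: ac_simps)
  then show "integrable (lebesgue_on K) (\<lambda>x. g x * v x)"
    using integrable_restrict_space[of K lebesgue "\<lambda>x. g x * v x"] K(1)
    by (simp add: fmeasurableD lmeasurable_compact)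
qed

lemma locally_integrable_componentwise:
  fixes u :: "'a::euclidean_space \<Rightarrow> 'b::euclidean_space ^ 'k"
  assumes "\<And>i. locally_integrable V (\<lambda>x. u x $ i)"
  shows "locally_integrable V u"
  unfolding locally_integrable_def
proof (intro allI impI)
  fix K assume K: "compact K" "K \<subseteq> V"
  have b: "bounded_linear (axis i :: 'b \<Rightarrow> 'b ^ 'k)" for i
    by (intro linear_linear[THEN iffD2] linearI) (auto simp: axis_def vec_eq_iff)
  have "integrable (lebesgue_on K) (\<lambda>x. \<Sum>i\<in>UNIV. axis i (u x $ i))"
    using assms K by (intro Bochner_Integration.integrable_sum integrable_bounded_linear[OF b])
      (auto simp: locally_integrable_def)
  moreover have "(\<Sum>i\<in>UNIV. axis i (u x $ i)) = u x" for x
    by (simp add: vec_eq_iff axis_def if_distrib cong: if_cong)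
  ultimately show "integrable (lebesgue_on K) u" by simp
qed

text \<open>The discrete integration by parts that moves difference quotients from \<open>f\<close> to \<open>v\<close>.\<close>

lemma integrable_difference_quotient:
  fixes f v :: "'a::euclidean_space \<Rightarrow> real"
  assumes V: "open V" and f: "locally_integrable V f"
    and K: "compact K" "K \<subseteq> V" "\<And>x. x \<in> K \<Longrightarrow> x + h *\<^sub>R z \<in> V"
    and v: "continuous_on UNIV v" "\<And>x. x \<notin> K \<Longrightarrow> v x = 0"
  shows "integrable lebesgue (\<lambda>x. (f (x + h *\<^sub>R z) - f x) / h * v x)" (is ?int)
    and "(LINT x|lebesgue. (f (x + h *\<^sub>R z) - f x) / h * v x) =
      ((LINT x|lebesgue. f x * v (x - h *\<^sub>R z)) - (LINT x|lebesgue. f x * v x)) / h" (is ?eq)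
proof -
  define K2 where "K2 = (\<lambda>x. x + h *\<^sub>R z) ` K"
  have K2: "compact K2" "K2 \<subseteq> V"
    using compact_translation[OF K(1), of "h *\<^sub>R z"] K(3) by (auto simp: K2_def add.commute)
  have v2: "v (x - h *\<^sub>R z) = 0" if "x \<notin> K2" for x
  proof (rule v(2), rule notI)
    assume "x - h *\<^sub>R z \<in> K"
    then have "x - h *\<^sub>R z + h *\<^sub>R z \<in> K2" unfolding K2_def by (rule imageI)
    with that show False by simp
  qed
  have c2: "continuous_on UNIV (\<lambda>x. v (x - h *\<^sub>R z))"
    by (intro continuous_on_compose2[OF v(1)] continuous_intros) auto
  have i2: "integrable lebesgue (\<lambda>x. f x * v (x - h *\<^sub>R z))"
    by (rule locally_integrable_mult_continuous[OF f K2 c2 v2])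
  have i1: "integrable lebesgue (\<lambda>x. f (x + h *\<^sub>R z) * v x)"
    using integral_lebesgue_translation(1)[OF i2, of "h *\<^sub>R z"] by simp
  have e1: "(LINT x|lebesgue. f (x + h *\<^sub>R z) * v x) = (LINT x|lebesgue. f x * v (x - h *\<^sub>R z))"
    using integral_lebesgue_translation(2)[OF i2, of "h *\<^sub>R z"] by simp
  have i0: "integrable lebesgue (\<lambda>x. f x * v x)"
    by (rule locally_integrable_mult_continuous[OF f K(1,2) v])
  have eq: "(f (x + h *\<^sub>R z) - f x) / h * v x = (f (x + h *\<^sub>R z) * v x - f x * v x) / h" for x
    by (simp add: left_diff_distrib diff_divide_distrib)
  show ?int unfolding eq using i1 i0 by simp
  show ?eq unfolding eq using i1 i0 by (simp add: e1)
qed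

text \<open>Difference quotients of Lipschitz functions are bounded, so that their weak convergence to the
  weak derivative extends from test functions to continuous functions of compact support.\<close>

lemma difference_quotient_weak_convergence:
  fixes f g v :: "'a::euclidean_space \<Rightarrow> real"
  assumes V: "open V" and d: "weak_derivative V z f g" and L: "L-lipschitz_on V f"
    and K: "compact K" "K \<subseteq> V" and v: "continuous_on UNIV v" "\<And>x. x \<notin> K \<Longrightarrow> v x = 0"
    and h: "\<And>n. h n \<noteq> 0" "h \<longlonglongrightarrow> 0"
  shows "(\<lambda>n. LINT x|lebesgue. (f (x + h n *\<^sub>R z) - f x) / h n * v x) \<longlonglongrightarrow> (LINT x|lebesgue. g x * v x)"
proof -
  have f: "locally_integrable V f" and g: "locally_integrable V g" using d by (auto simp: weak_derivative_def)
  have L0: "L \<ge> 0" using lipschitz_on_nonneg[OF L] .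
  obtain K1 where K1: "compact K1" "K1 \<subseteq> V" and
    approx: "\<And>e. e > 0 \<Longrightarrow> \<exists>\<phi>. test_function V \<phi> \<and> (\<forall>x. x \<notin> K1 \<longrightarrow> \<phi> x = 0 \<and> v x = 0) \<and> (\<forall>x. \<bar>\<phi> x - v x\<bar> \<le> e)"
    using test_function_uniform_approximation[OF V K v] by blast
  obtain \<delta> K2 where \<delta>: "\<delta> > 0" and K2: "K2 \<subseteq> V" "\<And>x y. x \<in> K1 \<Longrightarrow> dist x y \<le> \<delta> \<Longrightarrow> y \<in> K2"
    using compact_in_open_neighbourhood[OF K1(1) V K1(2)] by blast
  have ev: "\<forall>\<^sub>F n in sequentially. \<forall>x\<in>K1. x + h n *\<^sub>R z \<in> V"
  proof -
    have "(\<lambda>n. norm (h n *\<^sub>R z)) \<longlonglongrightarrow> norm (0 *\<^sub>R z)" by (intro tendsto_intros h(2))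
    then have "\<forall>\<^sub>F n in sequentially. norm (h n *\<^sub>R z) < \<delta>" using \<delta> by (intro order_tendstoD) auto
    then show ?thesis
    proof eventually_elim
      case (elim n)
      show ?case
      proof
        fix x assume x: "x \<in> K1"
        have "x + h n *\<^sub>R z \<in> K2" by (rule K2(2)[OF x]) (use elim in \<open>simp add: dist_norm\<close>)
        then show "x + h n *\<^sub>R z \<in> V" using K2(1) by blast
      qed
    qed
  qed
  define Q where "Q n x = (f (x + h n *\<^sub>R z) - f x) / h n" for n x
  have mK1: "indicat_real K1 \<in> borel_measurable lebesgue"
    by (intro borel_measurable_indicator fmeasurableD lmeasurable_compact K1(1))
  have iK1: "integrable lebesgue (\<lambda>x. c * indicat_real K1 x)" for c
    using lmeasurable_compact[OF K1(1)] by (intro integrable_mult_right) (auto simp: fmeasurable_def)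
  have gK1: "integrable lebesgue (\<lambda>x. \<bar>g x * indicator K1 x\<bar>)"
  proof -
    have "integrable lebesgue (\<lambda>x. g x * indicator K1 x)"
      by (rule locally_integrable_mult[OF g K1 mK1, of 1]) (auto simp: indicator_def)
    then show ?thesis by simp
  qed
  define A where "A = L * norm z * measure lebesgue K1 + (LINT x|lebesgue. \<bar>g x * indicator K1 x\<bar>) + 1"
  have A: "A > 0" "L * norm z * measure lebesgue K1 \<le> A" "(LINT x|lebesgue. \<bar>g x * indicator K1 x\<bar>) \<le> A"
  proof -
    have 1: "L * norm z * measure lebesgue K1 \<ge> 0" using L0 by simp
    have 2: "(LINT x|lebesgue. \<bar>g x * indicator K1 x\<bar>) \<ge> 0" by (rule integral_nonneg_AE) simp
    show "A > 0" "L * norm z * measure lebesgue K1 \<le> A" "(LINT x|lebesgue. \<bar>g x * indicator K1 x\<bar>) \<le> A"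
      using 1 2 unfolding A_def by linarith+
  qed
  have "(\<lambda>n. LINT x|lebesgue. Q n x * v x) \<longlonglongrightarrow> (LINT x|lebesgue. g x * v x)"
  proof (rule tendstoI)
    fix e :: real assume e: "e > 0"
    define \<epsilon> where "\<epsilon> = e / (4 * A)"
    have \<epsilon>: "\<epsilon> > 0" using e A by (simp add: \<epsilon>_def)
    obtain \<phi> where \<phi>: "test_function V \<phi>" "\<And>x. x \<notin> K1 \<Longrightarrow> \<phi> x = 0" "\<And>x. x \<notin> K1 \<Longrightarrow> v x = 0"
      "\<And>x. \<bar>\<phi> x - v x\<bar> \<le> \<epsilon>" using approx[OF \<epsilon>] by blast
    have h0: "filterlim h (at 0) sequentially" using h by (auto simp: filterlim_at)
    have "((\<lambda>t. ((LINT x|lebesgue. f x * \<phi> (x - (0 + t) *\<^sub>R z)) - (LINT x|lebesgue. f x * \<phi> (x - 0 *\<^sub>R z))) / t)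
        \<longlongrightarrow> - (LINT x|lebesgue. f x * frechet_derivative \<phi> (at x) z)) (at 0)"
      using derivative_integral_translated_test_function[OF V f \<phi>(1)] unfolding DERIV_def .
    from filterlim_compose[OF this h0]
    have "(\<lambda>n. ((LINT x|lebesgue. f x * \<phi> (x - h n *\<^sub>R z)) - (LINT x|lebesgue. f x * \<phi> x)) / h n)
        \<longlonglongrightarrow> (LINT x|lebesgue. g x * \<phi> x)"
      using d \<phi>(1) by (simp add: weak_derivative_def)
    moreover have "\<forall>\<^sub>F n in sequentially. ((LINT x|lebesgue. f x * \<phi> (x - h n *\<^sub>R z)) - (LINT x|lebesgue. f x * \<phi> x)) / h n =
        (LINT x|lebesgue. Q n x * \<phi> x)"
      using ev
    proof eventually_elim
      case (elim n)
      show ?case unfolding Q_def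
        by (rule integrable_difference_quotient(2)[OF V f K1 _ test_function_continuous[OF \<phi>(1)] \<phi>(2), symmetric])
           (use elim in auto)
    qed
    ultimately have "(\<lambda>n. LINT x|lebesgue. Q n x * \<phi> x) \<longlonglongrightarrow> (LINT x|lebesgue. g x * \<phi> x)"
      by (rule Lim_transform_eventually)
    then have "\<forall>\<^sub>F n in sequentially. dist (LINT x|lebesgue. Q n x * \<phi> x) (LINT x|lebesgue. g x * \<phi> x) < e / 4"
      using e by (intro tendstoD) auto
    then show "\<forall>\<^sub>F n in sequentially. dist (LINT x|lebesgue. Q n x * v x) (LINT x|lebesgue. g x * v x) < e"
      using ev
    proof eventually_elim
      case (elim n)
      have Qb: "\<bar>Q n x\<bar> \<le> L * norm z" if x: "x \<in> K1" for x
      proof -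
        have "dist (f (x + h n *\<^sub>R z)) (f x) \<le> L * dist (x + h n *\<^sub>R z) x"
          using lipschitz_onD[OF L] elim(2) x K1(2) by blast
        then have "\<bar>f (x + h n *\<^sub>R z) - f x\<bar> \<le> L * norm z * \<bar>h n\<bar>" by (simp add: dist_norm mult_ac)
        then show ?thesis using h(1)[of n] by (simp add: Q_def abs_divide divide_le_eq)
      qed
      have xV: "x + h n *\<^sub>R z \<in> V" if "x \<in> K1" for x using elim(2) that by blast
      have iQv: "integrable lebesgue (\<lambda>x. Q n x * v x)" unfolding Q_def
        by (rule integrable_difference_quotient(1)[OF V f K1 xV v(1) \<phi>(3)])
      have iQ\<phi>: "integrable lebesgue (\<lambda>x. Q n x * \<phi> x)" unfolding Q_def
        by (rule integrable_difference_quotient(1)[OF V f K1 xV test_function_continuous[OF \<phi>(1)] \<phi>(2)])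
      have igv: "integrable lebesgue (\<lambda>x. g x * v x)"
        by (rule locally_integrable_mult_continuous[OF g K1 v(1) \<phi>(3)])
      have ig\<phi>: "integrable lebesgue (\<lambda>x. g x * \<phi> x)"
        by (rule locally_integrable_mult_continuous[OF g K1 test_function_continuous[OF \<phi>(1)] \<phi>(2)])
      have d1: "\<bar>(LINT x|lebesgue. Q n x * v x) - (LINT x|lebesgue. Q n x * \<phi> x)\<bar> \<le> e / 4"
      proof -
        have "\<bar>(LINT x|lebesgue. Q n x * v x) - (LINT x|lebesgue. Q n x * \<phi> x)\<bar> =
            \<bar>LINT x|lebesgue. Q n x * v x - Q n x * \<phi> x\<bar>"
          using iQv iQ\<phi> by simp
        also have "\<dots> \<le> (LINT x|lebesgue. \<bar>Q n x * v x - Q n x * \<phi> x\<bar>)" by (rule integral_abs_bound)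
        also have "\<dots> \<le> (LINT x|lebesgue. (\<epsilon> * (L * norm z)) * indicat_real K1 x)"
        proof (rule integral_mono)
          show "\<bar>Q n x * v x - Q n x * \<phi> x\<bar> \<le> (\<epsilon> * (L * norm z)) * indicat_real K1 x" for x
          proof (cases "x \<in> K1")
            case True
            have "\<bar>Q n x * v x - Q n x * \<phi> x\<bar> = \<bar>Q n x\<bar> * \<bar>\<phi> x - v x\<bar>"
              by (simp add: abs_mult[symmetric] right_diff_distrib abs_minus_commute)
            also have "\<dots> \<le> (L * norm z) * \<epsilon>"
              using Qb[OF True] \<phi>(4)[of x] L0 by (intro mult_mono) auto
            finally show ?thesis using True by (simp add: mult.commute)
          qed (simp add: \<phi>(2,3))
        qed (use iQv iQ\<phi> iK1 in auto)
        also have "\<dots> = \<epsilon> * (L * norm z * measure lebesgue K1)" by simp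
        also have "\<dots> \<le> \<epsilon> * A" using \<epsilon> A(2) by (intro mult_left_mono) auto
        also have "\<dots> = e / 4" using A(1) by (simp add: \<epsilon>_def)
        finally show ?thesis .
      qed
      have d2: "\<bar>(LINT x|lebesgue. g x * \<phi> x) - (LINT x|lebesgue. g x * v x)\<bar> \<le> e / 4"
      proof -
        have "\<bar>(LINT x|lebesgue. g x * \<phi> x) - (LINT x|lebesgue. g x * v x)\<bar> =
            \<bar>LINT x|lebesgue. g x * \<phi> x - g x * v x\<bar>"
          using igv ig\<phi> by simp
        also have "\<dots> \<le> (LINT x|lebesgue. \<bar>g x * \<phi> x - g x * v x\<bar>)" by (rule integral_abs_bound)
        also have "\<dots> \<le> (LINT x|lebesgue. \<epsilon> * \<bar>g x * indicator K1 x\<bar>)"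
        proof (rule integral_mono)
          show "\<bar>g x * \<phi> x - g x * v x\<bar> \<le> \<epsilon> * \<bar>g x * indicator K1 x\<bar>" for x
          proof (cases "x \<in> K1")
            case True
            have "\<bar>g x * \<phi> x - g x * v x\<bar> = \<bar>g x\<bar> * \<bar>\<phi> x - v x\<bar>"
              by (simp add: abs_mult[symmetric] right_diff_distrib)
            also have "\<dots> \<le> \<bar>g x\<bar> * \<epsilon>" using \<phi>(4)[of x] by (intro mult_left_mono) auto
            finally show ?thesis using True by (simp add: mult.commute)
          qed (simp add: \<phi>(2,3))
        qed (use igv ig\<phi> gK1 in auto)
        also have "\<dots> = \<epsilon> * (LINT x|lebesgue. \<bar>g x * indicator K1 x\<bar>)" by simp
        also have "\<dots> \<le> \<epsilon> * A" using \<epsilon> A(3) by (intro mult_left_mono) auto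
        also have "\<dots> = e / 4" using A(1) by (simp add: \<epsilon>_def)
        finally show ?thesis .
      qed
      show ?case using d1 d2 elim(1) e unfolding dist_real_def by linarith
    qed
  qed
  then show ?thesis by (simp add: Q_def)
qed

text \<open>The difference quotient of \<open>p \<circ> u\<close> is the derivative of \<open>p\<close> applied to the difference quotient of \<open>u\<close>, up to
  an error tending to \<open>0\<close> boundedly. The former depends linearly on the difference quotient of \<open>u\<close>, with the
  continuous coefficients \<open>p' (u x)\<close>, so that its weak convergence suffices to pass to the limit.\<close>

lemma weak_derivative_chain:
  fixes u g :: "'a::euclidean_space \<Rightarrow> real^'k" and p :: "real^'k \<Rightarrow> real"
  assumes V: "open V" and d: "\<And>l. weak_derivative V z (\<lambda>x. u x $ l) (\<lambda>x. g x $ l)"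
    and L: "L-lipschitz_on V u" and p: "Lp-lipschitz_on W p" and uW: "u ` V \<subseteq> W"
    and p': "\<And>y. y \<in> W \<Longrightarrow> (p has_derivative p' y) (at y)"
    and cp': "\<And>w. continuous_on W (\<lambda>y. p' y w)"
  shows "weak_derivative V z (\<lambda>x. p (u x)) (\<lambda>x. p' (u x) (g x))"
proof -
  have L0: "L \<ge> 0" "Lp \<ge> 0" using lipschitz_on_nonneg L p by auto
  have cu: "continuous_on V u" using lipschitz_on_continuous_on[OF L] .
  have cpu: "continuous_on V (\<lambda>x. p (u x))"
    using continuous_on_compose2[OF lipschitz_on_continuous_on[OF p] cu uW] .
  have cp'u: "continuous_on V (\<lambda>x. p' (u x) w)" for w
    using continuous_on_compose2[OF cp' cu uW] .
  have p'_sum: "p' (u x) w = (\<Sum>l\<in>UNIV. w $ l * p' (u x) (axis l 1))" if x: "x \<in> V" for x w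
  proof -
    have lin: "linear (p' (u x))" using has_derivative_linear[OF p'] uW x by blast
    have "p' (u x) w = p' (u x) (\<Sum>l\<in>UNIV. w $ l *\<^sub>R axis l 1)"
      using basis_expansion[of w] by (simp add: scalar_mult_eq_scaleR)
    also have "\<dots> = (\<Sum>l\<in>UNIV. w $ l * p' (u x) (axis l 1))"
      using lin by (simp add: linear_sum linear_scale)
    finally show ?thesis .
  qed
  have lg: "locally_integrable V (\<lambda>x. g x $ l)" for l using d by (simp add: weak_derivative_def)
  have lp': "locally_integrable V (\<lambda>x. p' (u x) (g x))"
  proof -
    have "locally_integrable V (\<lambda>x. \<Sum>l\<in>UNIV. g x $ l * p' (u x) (axis l 1))"
      using locally_integrable_mult_continuous_on[OF lg cp'u] unfolding locally_integrable_def by auto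
    moreover have "integrable (lebesgue_on K) (\<lambda>x. \<Sum>l\<in>UNIV. g x $ l * p' (u x) (axis l 1)) =
        integrable (lebesgue_on K) (\<lambda>x. p' (u x) (g x))" if "K \<subseteq> V" for K
    proof (rule Bochner_Integration.integrable_cong[OF refl])
      fix x assume "x \<in> space (lebesgue_on K)"
      then have "x \<in> V" using that by auto
      then show "(\<Sum>l\<in>UNIV. g x $ l * p' (u x) (axis l 1)) = p' (u x) (g x)"
        by (rule p'_sum[symmetric])
    qed
    ultimately show ?thesis unfolding locally_integrable_def by blast
  qed
  have lpu: "locally_integrable V (\<lambda>x. p (u x))" by (rule locally_integrable_continuous[OF cpu])
  show ?thesis unfolding weak_derivative_def
  proof (intro conjI allI impI lpu lp')
    fix \<phi> assume \<phi>: "test_function V \<phi>"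
    obtain K where K: "compact K" "K \<subseteq> V" "\<And>x. x \<notin> K \<Longrightarrow> \<phi> x = 0"
      using test_function_support[OF \<phi>] by blast
    obtain \<delta> K2 where \<delta>: "\<delta> > 0" and K2: "K2 \<subseteq> V" "\<And>x y. x \<in> K \<Longrightarrow> dist x y \<le> \<delta> \<Longrightarrow> y \<in> K2"
      using compact_in_open_neighbourhood[OF K(1) V K(2)] by blast
    \<comment> \<open>steps so small that the translates of \<open>K\<close> stay in \<open>V\<close>\<close>
    define h where "h n = \<delta> / (norm z + 1) / real (Suc n)" for n
    have nz: "norm z + 1 > 0" using norm_ge_zero[of z] by linarith
    have h0: "h n > 0" for n using \<delta> nz by (simp add: h_def)
    have hlim: "h \<longlonglongrightarrow> 0"
      unfolding h_def[abs_def] by (rule LIMSEQ_Suc[OF lim_const_over_n])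
    have hz: "norm (h n *\<^sub>R z) \<le> \<delta>" for n
    proof -
      have "h n \<le> \<delta> / (norm z + 1)" unfolding h_def using \<delta> nz by (simp add: divide_le_eq mult_left_le)
      then have "h n * norm z \<le> \<delta> / (norm z + 1) * (norm z + 1)"
        using \<delta> nz by (intro mult_mono) auto
      then show ?thesis using h0[of n] nz by simp
    qed
    have xV: "x + h n *\<^sub>R z \<in> V" if x: "x \<in> K" for x n
      using K2(2)[OF x, of "x + h n *\<^sub>R z"] K2(1) hz[of n] by (auto simp: dist_norm)
    define v where "v l x = p' (u x) (axis l 1) * \<phi> x" for l x
    have cv: "continuous_on UNIV (v l)" for l
      unfolding v_def[abs_def] by (rule continuous_on_test_function_mult[OF V cp'u \<phi>])
    have v0: "v l x = 0" if "x \<notin> K" for l x using K(3)[OF that] by (simp add: v_def)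
    define Q where "Q n l x = (u (x + h n *\<^sub>R z) $ l - u x $ l) / h n" for n l x
    define T where "T n x = (p (u (x + h n *\<^sub>R z)) - p (u x)) / h n" for n x
    define R where "R n x = T n x * \<phi> x - (\<Sum>l\<in>UNIV. Q n l x * v l x)" for n x
    have Ll: "L-lipschitz_on V (\<lambda>x. u x $ l)" for l
      unfolding lipschitz_on_def
    proof (intro conjI ballI L0)
      fix x y assume "x \<in> V" "y \<in> V"
      then show "dist (u x $ l) (u y $ l) \<le> L * dist x y"
        using lipschitz_onD[OF L, of x y] dist_vec_nth_le[of "u x" l "u y"] by linarith
    qed
    have iQ: "integrable lebesgue (\<lambda>x. Q n l x * v l x)" for n l
      unfolding Q_def
      by (rule integrable_difference_quotient(1)[OF V _ K(1,2) xV cv v0])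
         (use d in \<open>auto simp: weak_derivative_def\<close>)
    have iT: "integrable lebesgue (\<lambda>x. T n x * \<phi> x)" for n
      unfolding T_def
      by (rule integrable_difference_quotient(1)[OF V lpu K(1,2) xV test_function_continuous[OF \<phi>] K(3)])
    have limQ: "(\<lambda>n. LINT x|lebesgue. Q n l x * v l x) \<longlonglongrightarrow> (LINT x|lebesgue. g x $ l * v l x)" for l
      unfolding Q_def
      by (rule difference_quotient_weak_convergence[OF V d Ll K(1,2) cv v0 _ hlim])
         (simp_all add: h0 less_imp_neq[symmetric])
    have "\<exists>B. \<forall>x\<in>K. \<bar>v l x\<bar> \<le> B" for l
      using compact_imp_bounded[OF compact_continuous_image[OF continuous_on_subset[OF cv] K(1)]]
      by (auto simp: bounded_iff)
    then obtain B where B: "\<And>l x. x \<in> K \<Longrightarrow> \<bar>v l x\<bar> \<le> B l" by metis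
    have "\<exists>B. \<forall>x\<in>K. \<bar>\<phi> x\<bar> \<le> B"
      using compact_imp_bounded[OF compact_continuous_image[OF test_function_continuous[OF \<phi>] K(1)]]
      by (auto simp: bounded_iff)
    then obtain B\<phi> where B\<phi>: "\<And>x. x \<in> K \<Longrightarrow> \<bar>\<phi> x\<bar> \<le> B\<phi>" by blast
    have du: "norm (u (x + h n *\<^sub>R z) - u x) \<le> L * norm z * h n" if x: "x \<in> K" for x n
      using lipschitz_onD[OF L xV[OF x], of x n] x K(2) h0[of n] by (auto simp: dist_norm mult_ac)
    have Qb: "\<bar>Q n l x\<bar> \<le> L * norm z" if x: "x \<in> K" for x n l
    proof -
      have "\<bar>u (x + h n *\<^sub>R z) $ l - u x $ l\<bar> \<le> L * norm z * h n"
        using du[OF x, of n] component_le_norm_cart[of "u (x + h n *\<^sub>R z) - u x" l] by simp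
      then show ?thesis using h0[of n] by (simp add: Q_def abs_divide divide_le_eq)
    qed
    have Tb: "\<bar>T n x\<bar> \<le> Lp * (L * norm z)" if x: "x \<in> K" for x n
    proof -
      have "dist (p (u (x + h n *\<^sub>R z))) (p (u x)) \<le> Lp * dist (u (x + h n *\<^sub>R z)) (u x)"
        using lipschitz_onD[OF p] uW xV[OF x, of n] x K(2) by blast
      also have "\<dots> \<le> Lp * (L * norm z * h n)"
        using du[OF x, of n] L0 by (intro mult_left_mono) (auto simp: dist_norm)
      finally show ?thesis using h0[of n] by (simp add: T_def abs_divide divide_le_eq dist_real_def mult_ac)
    qed
    have R0: "(\<lambda>n. R n x) \<longlonglongrightarrow> 0" for x
    proof (cases "x \<in> K")
      case True
      have xV': "x \<in> V" using True K(2) by blast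
      have Req: "R n x = (p (u (x + h n *\<^sub>R z)) - p (u x) - p' (u x) (u (x + h n *\<^sub>R z) - u x)) / h n * \<phi> x" for n
      proof -
        have "(\<Sum>l\<in>UNIV. Q n l x * v l x) = p' (u x) (u (x + h n *\<^sub>R z) - u x) / h n * \<phi> x"
          unfolding p'_sum[OF xV', of "u (x + h n *\<^sub>R z) - u x"] sum_divide_distrib sum_distrib_right
          by (rule sum.cong) (simp_all add: Q_def v_def)
        then show ?thesis unfolding R_def T_def
          by (simp only: diff_divide_distrib[of "p (u (x + h n *\<^sub>R z)) - p (u x)"] left_diff_distrib)
      qed
      show ?thesis
      proof (rule tendstoI)
        fix e :: real assume e: "e > 0"
        define A where "A = L * norm z * \<bar>\<phi> x\<bar> + 1"
        have A: "A > 0" using L0 by (simp add: A_def add_nonneg_pos)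
        have "(p has_derivative p' (u x)) (at (u x))" using p' uW xV' by blast
        then obtain \<rho> where \<rho>: "\<rho> > 0" "\<And>y. norm (y - u x) < \<rho> \<Longrightarrow>
            norm (p y - p (u x) - p' (u x) (y - u x)) \<le> e / A * norm (y - u x)"
          unfolding has_derivative_at_alt using divide_pos_pos[OF e A] by blast
        have "(\<lambda>n. L * norm z * h n) \<longlonglongrightarrow> L * norm z * 0" by (intro tendsto_intros hlim)
        then have "\<forall>\<^sub>F n in sequentially. L * norm z * h n < \<rho>" using \<rho>(1) by (intro order_tendstoD) auto
        then show "\<forall>\<^sub>F n in sequentially. dist (R n x) 0 < e"
        proof eventually_elim
          case (elim n)
          have "\<bar>p (u (x + h n *\<^sub>R z)) - p (u x) - p' (u x) (u (x + h n *\<^sub>R z) - u x)\<bar>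
              \<le> e / A * norm (u (x + h n *\<^sub>R z) - u x)"
            using \<rho>(2)[of "u (x + h n *\<^sub>R z)"] du[OF True, of n] elim by simp
          also have "\<dots> \<le> e / A * (L * norm z * h n)"
            using du[OF True, of n] e A by (intro mult_left_mono) auto
          finally have "\<bar>(p (u (x + h n *\<^sub>R z)) - p (u x) - p' (u x) (u (x + h n *\<^sub>R z) - u x)) / h n\<bar>
              \<le> e / A * (L * norm z)"
            using h0[of n] by (simp add: abs_divide divide_le_eq mult_ac)
          then have "\<bar>R n x\<bar> \<le> e / A * (L * norm z) * \<bar>\<phi> x\<bar>"
            unfolding Req abs_mult by (intro mult_right_mono) auto
          also have "\<dots> = e / A * (A - 1)" by (simp add: A_def)
          also have "\<dots> < e / A * A" using e A by (intro mult_strict_left_mono) auto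
          also have "\<dots> = e" using A by simp
          finally show ?case by simp
        qed
      qed
    next
      case False
      then show ?thesis using K(3)[OF False] by (simp add: R_def v_def)
    qed
    have limR: "(\<lambda>n. LINT x|lebesgue. R n x) \<longlonglongrightarrow> (LINT x|(lebesgue::'a measure). 0)"
    proof (rule integral_dominated_convergence[where
          w="\<lambda>x. (Lp * (L * norm z) * B\<phi> + (\<Sum>l\<in>UNIV. L * norm z * B l)) * indicat_real K x"])
      show "R n \<in> borel_measurable lebesgue" for n
        unfolding R_def[abs_def] using iT iQ
        by (intro borel_measurable_diff borel_measurable_sum borel_measurable_integrable) auto
      show "integrable lebesgue (\<lambda>x. (Lp * (L * norm z) * B\<phi> + (\<Sum>l\<in>UNIV. L * norm z * B l)) * indicat_real K x)"
        using lmeasurable_compact[OF K(1)] by (intro integrable_mult_right) (auto simp: fmeasurable_def)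
      show "AE x in lebesgue. (\<lambda>n. R n x) \<longlonglongrightarrow> 0" using R0 by simp
      have "norm (R n x) \<le> (Lp * (L * norm z) * B\<phi> + (\<Sum>l\<in>UNIV. L * norm z * B l)) * indicat_real K x" for n x
      proof (cases "x \<in> K")
        case True
        have "\<bar>R n x\<bar> \<le> \<bar>T n x * \<phi> x\<bar> + \<bar>\<Sum>l\<in>UNIV. Q n l x * v l x\<bar>" unfolding R_def by linarith
        also have "\<bar>T n x * \<phi> x\<bar> \<le> Lp * (L * norm z) * B\<phi>"
          unfolding abs_mult using Tb[OF True] B\<phi>[OF True] L0 by (intro mult_mono) auto
        also have "\<bar>\<Sum>l\<in>UNIV. Q n l x * v l x\<bar> \<le> (\<Sum>l\<in>UNIV. L * norm z * B l)"
        proof (rule sum_abs[THEN order_trans], rule sum_mono)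
          show "\<bar>Q n l x * v l x\<bar> \<le> L * norm z * B l" for l
            unfolding abs_mult using Qb[OF True] B[OF True] L0 by (intro mult_mono) auto
        qed
        finally show ?thesis using True by simp
      next
        case False
        then show ?thesis using K(3)[OF False] by (simp add: R_def v_def)
      qed
      then show "AE x in lebesgue. norm (R n x) \<le>
        (Lp * (L * norm z) * B\<phi> + (\<Sum>l\<in>UNIV. L * norm z * B l)) * indicat_real K x" for n by simp
    qed simp
    have split: "(LINT x|lebesgue. T n x * \<phi> x) = (\<Sum>l\<in>UNIV. (LINT x|lebesgue. Q n l x * v l x)) + (LINT x|lebesgue. R n x)" for n
    proof -
      have s: "integrable lebesgue (\<lambda>x. \<Sum>l\<in>UNIV. Q n l x * v l x)" using iQ by simp
      have "(LINT x|lebesgue. R n x) = (LINT x|lebesgue. T n x * \<phi> x) - (LINT x|lebesgue. (\<Sum>l\<in>UNIV. Q n l x * v l x))"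
        unfolding R_def by (rule Bochner_Integration.integral_diff[OF iT s])
      moreover have "(LINT x|lebesgue. (\<Sum>l\<in>UNIV. Q n l x * v l x)) = (\<Sum>l\<in>UNIV. (LINT x|lebesgue. Q n l x * v l x))"
        by (rule Bochner_Integration.integral_sum[OF iQ])
      ultimately show ?thesis by simp
    qed
    have lim1: "(\<lambda>n. LINT x|lebesgue. T n x * \<phi> x) \<longlonglongrightarrow> (\<Sum>l\<in>UNIV. (LINT x|lebesgue. g x $ l * v l x)) + (LINT x|(lebesgue::'a measure). 0)"
      unfolding split by (intro tendsto_add tendsto_sum limQ limR)
    have "((\<lambda>t. ((LINT x|lebesgue. p (u x) * \<phi> (x - (0 + t) *\<^sub>R z)) - (LINT x|lebesgue. p (u x) * \<phi> (x - 0 *\<^sub>R z))) / t)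
        \<longlongrightarrow> - (LINT x|lebesgue. p (u x) * frechet_derivative \<phi> (at x) z)) (at 0)"
      using derivative_integral_translated_test_function[OF V lpu \<phi>] unfolding DERIV_def .
    moreover have "filterlim h (at 0) sequentially"
      using hlim h0 by (auto simp: filterlim_at less_imp_neq[symmetric])
    ultimately have "(\<lambda>n. ((LINT x|lebesgue. p (u x) * \<phi> (x - (0 + h n) *\<^sub>R z)) - (LINT x|lebesgue. p (u x) * \<phi> (x - 0 *\<^sub>R z))) / h n)
        \<longlonglongrightarrow> - (LINT x|lebesgue. p (u x) * frechet_derivative \<phi> (at x) z)"
      by (rule filterlim_compose)
    moreover have "(LINT x|lebesgue. T n x * \<phi> x) =
        ((LINT x|lebesgue. p (u x) * \<phi> (x - (0 + h n) *\<^sub>R z)) - (LINT x|lebesgue. p (u x) * \<phi> (x - 0 *\<^sub>R z))) / h n" for n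
      unfolding T_def
      using integrable_difference_quotient(2)[OF V lpu K(1,2) xV test_function_continuous[OF \<phi>] K(3)] by simp
    ultimately have lim2: "(\<lambda>n. LINT x|lebesgue. T n x * \<phi> x) \<longlonglongrightarrow> - (LINT x|lebesgue. p (u x) * frechet_derivative \<phi> (at x) z)"
      by simp
    have "(\<Sum>l\<in>UNIV. (LINT x|lebesgue. g x $ l * v l x)) = (LINT x|lebesgue. (\<Sum>l\<in>UNIV. g x $ l * v l x))"
      by (rule Bochner_Integration.integral_sum[symmetric])
         (rule locally_integrable_mult_continuous[OF lg K(1,2) cv v0])
    also have "\<dots> = (LINT x|lebesgue. p' (u x) (g x) * \<phi> x)"
    proof (rule Bochner_Integration.integral_cong[OF refl])
      fix x
      show "(\<Sum>l\<in>UNIV. g x $ l * v l x) = p' (u x) (g x) * \<phi> x"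
      proof (cases "x \<in> V")
        case True
        show ?thesis unfolding p'_sum[OF True, of "g x"] v_def sum_distrib_right
          by (rule sum.cong) simp_all
      next
        case False
        then have "\<phi> x = 0" using K by blast
        then show ?thesis by (simp add: v_def)
      qed
    qed
    finally show "(LINT x|lebesgue. p (u x) * frechet_derivative \<phi> (at x) z) = - (LINT x|lebesgue. p' (u x) (g x) * \<phi> x)"
      using LIMSEQ_unique[OF lim1 lim2] by simp
  qed
qed

lemma weak_derivative_cong:
  assumes "weak_derivative V z f g" "\<And>x. x \<in> V \<Longrightarrow> g x = g' x"
  shows "weak_derivative V z f g'"
proof -
  have "locally_integrable V g'" unfolding locally_integrable_def
  proof (intro allI impI)
    fix K assume K: "compact K" "K \<subseteq> V"
    have "integrable (lebesgue_on K) g" using assms(1) K by (simp add: weak_derivative_def locally_integrable_def)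
    moreover have "integrable (lebesgue_on K) g = integrable (lebesgue_on K) g'"
      by (rule Bochner_Integration.integrable_cong[OF refl]) (use K(2) assms(2) in auto)
    ultimately show "integrable (lebesgue_on K) g'" by simp
  qed
  moreover have "(\<lambda>x. g x * \<phi> x) = (\<lambda>x. g' x * \<phi> x)" if \<phi>: "test_function V \<phi>" for \<phi>
  proof
    fix x show "g x * \<phi> x = g' x * \<phi> x"
      using test_function_support[OF \<phi>] assms(2)[of x] by (cases "x \<in> V") auto
  qed
  ultimately show ?thesis using assms(1) unfolding weak_derivative_def by simp
qed

lemma has_weak_gradient_chain:
  fixes u :: "real^'d \<Rightarrow> real^'k" and P :: "real^'k \<Rightarrow> real^'m"
  assumes V: "open V" and u: "has_weak_gradient V u G" and L: "L-lipschitz_on V u"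
    and P: "LP-lipschitz_on W P" and uW: "u ` V \<subseteq> W"
    and dP: "\<And>y. y \<in> W \<Longrightarrow> P differentiable (at y)"
    and cP: "\<And>w. continuous_on W (\<lambda>y. frechet_derivative P (at y) w)"
  shows "has_weak_gradient V (\<lambda>x. P (u x)) (\<lambda>x. jacobian P (at (u x)) ** G x)"
proof -
  have "weak_derivative V (axis j 1) (\<lambda>x. P (u x) $ i) (\<lambda>x. frechet_derivative P (at (u x)) (G x *v axis j 1) $ i)" for i j
  proof (rule weak_derivative_chain[OF V _ L _ uW])
    show "weak_derivative V (axis j 1) (\<lambda>x. u x $ l) (\<lambda>x. (G x *v axis j 1) $ l)" for l
      by (rule has_weak_gradient_direction[OF V u])
    show "LP-lipschitz_on W (\<lambda>y. P y $ i)"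
      unfolding lipschitz_on_def
    proof (intro conjI ballI lipschitz_on_nonneg[OF P])
      fix x y assume "x \<in> W" "y \<in> W"
      then show "dist (P x $ i) (P y $ i) \<le> LP * dist x y"
        using lipschitz_onD[OF P, of x y] dist_vec_nth_le[of "P x" i "P y"] by linarith
    qed
    show "((\<lambda>y. P y $ i) has_derivative (\<lambda>w. frechet_derivative P (at y) w $ i)) (at y)" if "y \<in> W" for y
      using bounded_linear.has_derivative[OF bounded_linear_vec_nth] dP[OF that] frechet_derivative_works by blast
    show "continuous_on W (\<lambda>y. frechet_derivative P (at y) w $ i)" for w
      by (intro continuous_on_component cP)
  qed
  moreover have "frechet_derivative P (at (u x)) (G x *v axis j 1) $ i = (jacobian P (at (u x)) ** G x) $ i $ j"
    if "x \<in> V" for x i j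
  proof -
    have "linear (frechet_derivative P (at (u x)))"
      using dP uW that linear_frechet_derivative by blast
    then have "frechet_derivative P (at (u x)) (G x *v axis j 1) = jacobian P (at (u x)) *v (G x *v axis j 1)"
      by (simp add: jacobian_def)
    also have "\<dots> = (jacobian P (at (u x)) ** G x) *v axis j 1" by (simp add: matrix_vector_mul_assoc)
    finally show ?thesis by (simp add: matrix_vector_mul_component inner_axis)
  qed
  ultimately have wd: "weak_derivative V (axis j 1) (\<lambda>x. P (u x) $ i) (\<lambda>x. (jacobian P (at (u x)) ** G x) $ i $ j)" for i j
    by (rule weak_derivative_cong)
  have lH: "locally_integrable V (\<lambda>x. jacobian P (at (u x)) ** G x)"
    by (intro locally_integrable_componentwise) (use wd in \<open>auto simp: weak_derivative_def\<close>)
  have lPu: "locally_integrable V (\<lambda>x. P (u x))"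
    by (intro locally_integrable_componentwise) (use wd in \<open>auto simp: weak_derivative_def\<close>)
  show ?thesis unfolding has_weak_gradient_iff[OF V] using wd lH lPu by blast
qed

section \<open>Sobolev functions and traces\<close>

lemma Lp_norm_1: "Lp_norm \<Omega> 1 u = (\<integral>\<^sup>+x. ennreal (norm (u x)) \<partial>lebesgue_on \<Omega>)"
  by (auto simp: Lp_norm_def Let_def less_top ennreal_enn2real)

text \<open>This reduces membership in \<open>W\<^sup>1\<^sup>,\<^sup>1\<close> to integrability.\<close>

lemma Lp_space_1_iff:
  fixes u :: "'a::euclidean_space \<Rightarrow> 'b::euclidean_space"
  shows "u \<in> Lp_space \<Omega> 1 \<longleftrightarrow> integrable (lebesgue_on \<Omega>) u"
  by (simp add: Lp_space_def Lp_norm_1 integrable_iff_bounded)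

lemma Lp_space_infinity_bounded:
  assumes "u \<in> Lp_space \<Omega> \<infinity>"
  shows "\<exists>C\<ge>0. AE x in lebesgue_on \<Omega>. norm (u x) \<le> C"
proof -
  define C where "C = enn2real (Lp_norm \<Omega> \<infinity> u)"
  have fin: "Lp_norm \<Omega> \<infinity> u < \<infinity>" using assms by (simp add: Lp_space_def)
  have "AE x in lebesgue_on \<Omega>. ennreal (norm (u x)) \<le> Lp_norm \<Omega> \<infinity> u"
    unfolding Lp_norm_def using esssup_AE[of "\<lambda>x. ennreal (norm (u x))" "lebesgue_on \<Omega>"] by simp
  moreover have eq: "Lp_norm \<Omega> \<infinity> u = ennreal C" using fin by (simp add: C_def)
  moreover have C0: "C \<ge> 0" by (simp add: C_def)
  ultimately have "AE x in lebesgue_on \<Omega>. norm (u x) \<le> C"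
    by (auto simp: eq ennreal_le_iff[OF C0])
  then show ?thesis using C0 by blast
qed

lemma Lp_norm_infinity_le:
  fixes u :: "'a::euclidean_space \<Rightarrow> 'b::euclidean_space"
  assumes "u \<in> borel_measurable (lebesgue_on \<Omega>)" "AE x in lebesgue_on \<Omega>. norm (u x) \<le> c"
  shows "Lp_norm \<Omega> \<infinity> u \<le> ennreal c"
proof -
  have "esssup (lebesgue_on \<Omega>) (\<lambda>x. ennreal (norm (u x))) \<le> ennreal c"
    using assms by (intro esssup_I) (auto intro: ennreal_leI elim: eventually_mono)
  then show ?thesis by (simp add: Lp_norm_def)
qed

lemma borel_measurable_lebesgue_on_cong_AE:
  fixes f g :: "'a::euclidean_space \<Rightarrow> 'b::euclidean_space"
  assumes V: "open V" and ae: "AE x in lebesgue_on V. f x = g x" and f: "f \<in> borel_measurable (lebesgue_on V)"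
  shows "g \<in> borel_measurable (lebesgue_on V)"
proof -
  have Vs: "V \<inter> space lebesgue \<in> sets lebesgue" using V by simp
  have "(\<lambda>x. indicator V x *\<^sub>R f x) \<in> borel_measurable lebesgue"
    using f borel_measurable_restrict_space_iff[OF Vs, of f] by simp
  moreover have "AE x in lebesgue. indicator V x *\<^sub>R f x = indicator V x *\<^sub>R g x"
    using ae unfolding AE_lebesgue_on_iff[OF V] by eventually_elim (auto simp: indicator_def)
  ultimately have "(\<lambda>x. indicator V x *\<^sub>R g x) \<in> borel_measurable lebesgue" by (rule borel_measurable_AE)
  then show ?thesis using borel_measurable_restrict_space_iff[OF Vs, of g] by simp
qed

lemma Lp_norm_1_cong_AE:
  "AE x in lebesgue_on \<Omega>. u x = v x \<Longrightarrow> Lp_norm \<Omega> 1 u = Lp_norm \<Omega> 1 v"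
  unfolding Lp_norm_1 by (rule nn_integral_cong_AE) (auto elim: eventually_mono)

lemma W1_norm_1_cong_AE:
  fixes u v :: "real^'d \<Rightarrow> real^'k"
  assumes "open \<Omega>" "AE x in lebesgue_on \<Omega>. u x = v x"
  shows "W1_norm \<Omega> 1 u = W1_norm \<Omega> 1 v"
  unfolding W1_norm_def Lp_norm_1_cong_AE[OF assms(2)] weak_gradient_cong_AE[OF assms] ..

lemma W1_norm_infinity_cong_AE:
  fixes u v :: "real^'d \<Rightarrow> real^'k"
  assumes \<Omega>: "open \<Omega>" and u: "u \<in> borel_measurable (lebesgue_on \<Omega>)" and ae: "AE x in lebesgue_on \<Omega>. u x = v x"
  shows "W1_norm \<Omega> \<infinity> u = W1_norm \<Omega> \<infinity> v"
proof -
  have v: "v \<in> borel_measurable (lebesgue_on \<Omega>)" by (rule borel_measurable_lebesgue_on_cong_AE[OF \<Omega> ae u])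
  have "esssup (lebesgue_on \<Omega>) (\<lambda>x. ennreal (norm (u x))) = esssup (lebesgue_on \<Omega>) (\<lambda>x. ennreal (norm (v x)))"
    by (rule esssup_AE_cong) (use u v ae in \<open>auto elim: eventually_mono\<close>)
  then show ?thesis unfolding W1_norm_def weak_gradient_cong_AE[OF assms(1,3)] by (simp add: Lp_norm_def)
qed

lemma W1_1_add:
  fixes u v :: "real^'d \<Rightarrow> real^'k"
  assumes "open \<Omega>" "u \<in> W1 \<Omega> 1" "v \<in> W1 \<Omega> 1"
  shows "(\<lambda>x. u x + v x) \<in> W1 \<Omega> 1"
proof -
  obtain G H where "integrable (lebesgue_on \<Omega>) G" "has_weak_gradient \<Omega> u G"
    "integrable (lebesgue_on \<Omega>) H" "has_weak_gradient \<Omega> v H"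
    using assms(2,3) by (auto simp: W1_def Lp_space_1_iff)
  then have "integrable (lebesgue_on \<Omega>) (\<lambda>x. G x + H x)"
      "has_weak_gradient \<Omega> (\<lambda>x. u x + v x) (\<lambda>x. G x + H x)"
    using has_weak_gradient_add[OF assms(1)] by auto
  moreover have "integrable (lebesgue_on \<Omega>) (\<lambda>x. u x + v x)"
    using assms(2,3) by (auto simp: W1_def Lp_space_1_iff)
  ultimately show ?thesis unfolding W1_def by (auto simp: Lp_space_1_iff)
qed

lemma has_weak_gradient_uminus:
  fixes u :: "real^'d \<Rightarrow> real^'k"
  assumes V: "open V" and "has_weak_gradient V u G"
  shows "has_weak_gradient V (\<lambda>x. - u x) (\<lambda>x. - G x)"
proof -
  have "weak_derivative V (axis j 1) (\<lambda>x. (-1) * u x $ i) (\<lambda>x. (-1) * G x $ i $ j)" for i j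
    using assms(2) unfolding has_weak_gradient_iff[OF V] by (intro weak_derivative_mult_const) blast
  with assms(2) show ?thesis unfolding has_weak_gradient_iff[OF V] by (simp add: locally_integrable_def)
qed

lemma has_weak_gradient_diff:
  fixes u :: "real^'d \<Rightarrow> real^'k"
  assumes V: "open V" and "has_weak_gradient V u G" "has_weak_gradient V v H"
  shows "has_weak_gradient V (\<lambda>x. u x - v x) (\<lambda>x. G x - H x)"
  using has_weak_gradient_add[OF V assms(2) has_weak_gradient_uminus[OF V assms(3)]] by simp

lemma W1_1_diff:
  fixes u v :: "real^'d \<Rightarrow> real^'k"
  assumes "open \<Omega>" "u \<in> W1 \<Omega> 1" "v \<in> W1 \<Omega> 1"
  shows "(\<lambda>x. u x - v x) \<in> W1 \<Omega> 1"
proof -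
  obtain G where "integrable (lebesgue_on \<Omega>) G" "has_weak_gradient \<Omega> v G"
    using assms(3) by (auto simp: W1_def Lp_space_1_iff)
  then have "integrable (lebesgue_on \<Omega>) (\<lambda>x. - G x)" "has_weak_gradient \<Omega> (\<lambda>x. - v x) (\<lambda>x. - G x)"
    using has_weak_gradient_uminus[OF assms(1)] by auto
  moreover have "integrable (lebesgue_on \<Omega>) (\<lambda>x. - v x)" using assms(3) by (simp add: W1_def Lp_space_1_iff)
  ultimately have "(\<lambda>x. - v x) \<in> W1 \<Omega> 1" by (auto simp: W1_def Lp_space_1_iff)
  from W1_1_add[OF assms(1,2) this] show ?thesis by simp
qed

lemma integrable_lebesgue_on_bounded:
  fixes f :: "'a::euclidean_space \<Rightarrow> 'b::euclidean_space"
  assumes \<Omega>: "open \<Omega>" "bounded \<Omega>" and f: "f \<in> borel_measurable (lebesgue_on \<Omega>)"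
    and B: "AE x in lebesgue_on \<Omega>. norm (f x) \<le> B"
  shows "integrable (lebesgue_on \<Omega>) f"
proof -
  have "\<Omega> \<in> lmeasurable" using \<Omega> lmeasurable_open by blast
  then interpret finite_measure "lebesgue_on \<Omega>" by (rule finite_measure_lebesgue_on)
  show ?thesis using integrable_const_bound[OF B f] .
qed

lemma integrable_imp_locally_integrable:
  fixes f :: "'a::euclidean_space \<Rightarrow> 'b::euclidean_space"
  assumes \<Omega>: "open \<Omega>" and f: "integrable (lebesgue_on \<Omega>) f"
  shows "locally_integrable \<Omega> f"
  unfolding locally_integrable_def
proof (intro allI impI)
  fix K assume K: "compact K" "K \<subseteq> \<Omega>"
  have Ks: "K \<in> sets lebesgue" using K(1) by (simp add: fmeasurableD lmeasurable_compact)
  have "integrable lebesgue (\<lambda>x. indicator \<Omega> x *\<^sub>R f x)"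
    using f integrable_restrict_space[of \<Omega> lebesgue f] \<Omega> by simp
  from integrable_mult_indicator[OF Ks this]
  have "integrable lebesgue (\<lambda>x. indicator K x *\<^sub>R (indicator \<Omega> x *\<^sub>R f x))" .
  moreover have "(\<lambda>x. indicat_real K x *\<^sub>R (indicat_real \<Omega> x *\<^sub>R f x)) = (\<lambda>x. indicat_real K x *\<^sub>R f x)"
    using K(2) by (auto simp: indicator_def fun_eq_iff)
  ultimately have "integrable lebesgue (\<lambda>x. indicat_real K x *\<^sub>R f x)" by (simp only:)
  then show "integrable (lebesgue_on K) f"
    using integrable_restrict_space[of K lebesgue f] Ks by simp
qed

lemma W1_1_bounded:
  fixes u :: "real^'d \<Rightarrow> real^'k"
  assumes \<Omega>: "open \<Omega>" "bounded \<Omega>" and u: "has_weak_gradient \<Omega> u G"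
    and "u \<in> borel_measurable (lebesgue_on \<Omega>)" "AE x in lebesgue_on \<Omega>. norm (u x) \<le> B"
    and "G \<in> borel_measurable (lebesgue_on \<Omega>)" "AE x in lebesgue_on \<Omega>. norm (G x) \<le> C"
  shows "u \<in> W1 \<Omega> 1"
  using integrable_lebesgue_on_bounded[OF \<Omega> assms(4,5)] integrable_lebesgue_on_bounded[OF \<Omega> assms(6,7)] u
  by (auto simp: W1_def Lp_space_1_iff)

text \<open>A compactly supported continuous perturbation can be added to the functions, continuous up to
  the boundary, that define the trace.\<close>

lemma has_trace_perturb:
  fixes u v :: "real^'d \<Rightarrow> real^'k"
  assumes \<Omega>: "open \<Omega>" and tr: "has_trace \<Omega> u g" and v: "v \<in> W1 \<Omega> 1"
    and w: "w \<in> W1 \<Omega> 1" "continuous_on UNIV w" "\<And>x. x \<notin> \<Omega> \<Longrightarrow> w x = 0"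
    and ae: "AE x in lebesgue_on \<Omega>. v x = u x + w x"
  shows "has_trace \<Omega> v g"
proof -
  obtain a where g: "g \<in> borel_measurable borel" and a: "\<And>i. a i \<in> W1 \<Omega> 1" "\<And>i. continuous_on (closure \<Omega>) (a i)"
    and lim1: "(\<lambda>i. W1_norm \<Omega> 1 (\<lambda>x. a i x - u x)) \<longlonglongrightarrow> 0"
    and lim2: "(\<lambda>i. \<integral>\<^sup>+x\<in>frontier \<Omega>. ennreal (norm (a i x - g x)) \<partial>surface_measure) \<longlonglongrightarrow> 0"
    using tr unfolding has_trace_def by blast
  have fr: "x \<notin> \<Omega>" if "x \<in> frontier \<Omega>" for x
    using that \<Omega> by (simp add: frontier_def interior_open)
  show ?thesis unfolding has_trace_def
  proof (intro conjI v g exI[of _ "\<lambda>i x. a i x + w x"] allI)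
    show "(\<lambda>x. a i x + w x) \<in> W1 \<Omega> 1" for i by (rule W1_1_add[OF \<Omega> a(1) w(1)])
    show "continuous_on (closure \<Omega>) (\<lambda>x. a i x + w x)" for i
      by (intro continuous_on_add a(2) continuous_on_subset[OF w(2)]) simp
    have "W1_norm \<Omega> 1 (\<lambda>x. a i x + w x - v x) = W1_norm \<Omega> 1 (\<lambda>x. a i x - u x)" for i
      by (rule W1_norm_1_cong_AE[OF \<Omega>]) (use ae in \<open>auto elim: eventually_mono\<close>)
    then show "(\<lambda>i. W1_norm \<Omega> 1 (\<lambda>x. a i x + w x - v x)) \<longlonglongrightarrow> 0" using lim1 by simp
    have "(\<integral>\<^sup>+x\<in>frontier \<Omega>. ennreal (norm (a i x + w x - g x)) \<partial>surface_measure) =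
        (\<integral>\<^sup>+x\<in>frontier \<Omega>. ennreal (norm (a i x - g x)) \<partial>surface_measure)" for i
      by (intro nn_integral_cong) (auto simp: indicator_def w(3) fr)
    then show "(\<lambda>i. \<integral>\<^sup>+x\<in>frontier \<Omega>. ennreal (norm (a i x + w x - g x)) \<partial>surface_measure) \<longlonglongrightarrow> 0"
      using lim2 by simp
  qed
qed

lemma admissible_perturb:
  fixes u v :: "real^'d \<Rightarrow> real^'k"
  assumes \<Omega>: "open \<Omega>" and u: "u \<in> admissible \<Omega> \<Gamma> M n\<^sub>0" and v: "v \<in> W1 \<Omega> 1"
    and w: "w \<in> W1 \<Omega> 1" "continuous_on UNIV w" "\<And>x. x \<notin> \<Omega> \<Longrightarrow> w x = 0"
    and ae: "AE x in lebesgue_on \<Omega>. v x = u x + w x" "AE x in lebesgue_on \<Omega>. v x \<in> M"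
  shows "v \<in> admissible \<Omega> \<Gamma> M n\<^sub>0"
  using u v ae(2) has_trace_perturb[OF \<Omega> _ v w ae(1)]
  unfolding admissible_def trace_eq_on_def W1_into_def by blast

text \<open>Perturbation by \<open>0\<close>. This allows \<open>n\<close> to be replaced by a representative that is
  Lipschitz near a given point and has all its values in \<open>M\<close>.\<close>

lemma admissible_cong_AE:
  fixes u v :: "real^'d \<Rightarrow> real^'k"
  assumes \<Omega>: "open \<Omega>" and u: "u \<in> admissible \<Omega> \<Gamma> M n\<^sub>0" and ae: "AE x in lebesgue_on \<Omega>. u x = v x"
  shows "v \<in> admissible \<Omega> \<Gamma> M n\<^sub>0"
proof (rule admissible_perturb[OF \<Omega> u])
  have um: "u \<in> borel_measurable (lebesgue_on \<Omega>)" "integrable (lebesgue_on \<Omega>) u"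
    using u by (auto simp: admissible_def W1_into_def W1_def Lp_space_1_iff)
  obtain G where G: "integrable (lebesgue_on \<Omega>) G" "has_weak_gradient \<Omega> u G"
    using u by (auto simp: admissible_def W1_into_def W1_def Lp_space_1_iff)
  have "integrable (lebesgue_on \<Omega>) v"
    by (rule integrable_cong_AE_imp[OF um(2) borel_measurable_lebesgue_on_cong_AE[OF \<Omega> ae um(1)]])
       (use ae in \<open>auto elim: eventually_mono\<close>)
  moreover have "has_weak_gradient \<Omega> v G"
    by (rule has_weak_gradient_cong_AE[OF \<Omega> ae _ G(2)]) simp
  ultimately show "v \<in> W1 \<Omega> 1" using G(1) by (auto simp: W1_def Lp_space_1_iff)
  have z: "has_weak_gradient \<Omega> (\<lambda>x. 0 :: real^'k) (\<lambda>x. 0)"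
    by (auto simp: has_weak_gradient_def locally_integrable_def)
  then show "(\<lambda>x. 0 :: real^'k) \<in> W1 \<Omega> 1"
    by (auto simp: W1_def Lp_space_1_iff intro!: bexI[of _ "\<lambda>x. 0"])
  show "AE x in lebesgue_on \<Omega>. v x = u x + 0" using ae by (auto elim: eventually_mono)
  have "AE x in lebesgue_on \<Omega>. u x \<in> M" using u by (simp add: admissible_def W1_into_def)
  then show "AE x in lebesgue_on \<Omega>. v x \<in> M" using ae by eventually_elim simp
qed auto

lemma borel_measurable_continuous_on_compose:
  fixes h :: "'b::euclidean_space \<Rightarrow> real"
  assumes f: "f \<in> borel_measurable N" and S: "closed S" "\<And>x. x \<in> space N \<Longrightarrow> f x \<in> S"
    and h: "continuous_on S h"
  shows "(\<lambda>x. h (f x)) \<in> borel_measurable N"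
proof -
  have "(\<lambda>y. indicator S y *\<^sub>R h y) \<in> borel_measurable borel"
    using borel_measurable_continuous_on_indicator[OF _ h] S(1) by simp
  from measurable_compose[OF f this] have "(\<lambda>x. indicator S (f x) *\<^sub>R h (f x)) \<in> borel_measurable N" .
  then show ?thesis by (rule measurable_cong[THEN iffD1, rotated]) (simp add: S(2))
qed

section \<open>Variations by projection\<close>

lemma continuous_on_matrix_matrix_mult [continuous_intros]:
  fixes A :: "'a::topological_space \<Rightarrow> real^'m^'k" and B :: "'a \<Rightarrow> real^'n^'m"
  assumes "continuous_on S A" "continuous_on S B"
  shows "continuous_on S (\<lambda>x. A x ** B x)"
  unfolding matrix_matrix_mult_def by (intro continuous_on_vec_lambda continuous_intros assms)

lemma continuous_on_matrix_vector_mult [continuous_intros]: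
  fixes A :: "'a::topological_space \<Rightarrow> real^'m^'k" and b :: "'a \<Rightarrow> real^'m"
  assumes "continuous_on S A" "continuous_on S b"
  shows "continuous_on S (\<lambda>x. A x *v b x)"
  unfolding matrix_vector_mult_def by (intro continuous_on_vec_lambda continuous_intros assms)

lemma matrix_mult_outer_product: "A ** outer_product \<zeta> v = outer_product (A *v \<zeta>) v"
  by (simp add: outer_product_def matrix_matrix_mult_def matrix_vector_mult_def vec_eq_iff
      sum_distrib_right mult.assoc)

lemma outer_product_scaleR: "outer_product \<zeta> (c *\<^sub>R v) = c *\<^sub>R outer_product \<zeta> v"
  by (simp add: outer_product_def vec_eq_iff)

lemma outer_product_zero [simp]: "outer_product \<zeta> 0 = 0"
  by (simp add: outer_product_def vec_eq_iff)

lemma test_function_lipschitz: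
  fixes \<psi> :: "real^'d \<Rightarrow> real"
  assumes \<psi>: "test_function V \<psi>"
  shows "\<exists>B. B-lipschitz_on S \<psi>"
proof -
  have "\<forall>j. \<exists>B\<ge>0. \<forall>x. \<bar>frechet_derivative \<psi> (at x) (axis j 1)\<bar> \<le> B"
    using test_function_bounded_derivative[OF \<psi>] by blast
  from choice[OF this] obtain B where B: "\<And>j. B j \<ge> 0" "\<And>j x. \<bar>frechet_derivative \<psi> (at x) (axis j 1)\<bar> \<le> B j"
    by blast
  have D: "\<bar>frechet_derivative \<psi> (at x) z\<bar> \<le> (\<Sum>j\<in>UNIV. B j) * norm z" for x z
  proof -
    have lin: "linear (frechet_derivative \<psi> (at x))"
      using has_derivative_linear[OF test_function_has_derivative[OF \<psi>]] .
    have "frechet_derivative \<psi> (at x) z = frechet_derivative \<psi> (at x) (\<Sum>j\<in>UNIV. z $ j *\<^sub>R axis j 1)"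
      using basis_expansion[of z] by (simp add: scalar_mult_eq_scaleR)
    also have "\<dots> = (\<Sum>j\<in>UNIV. z $ j * frechet_derivative \<psi> (at x) (axis j 1))"
      using lin by (simp add: linear_sum linear_scale)
    also have "\<bar>\<dots>\<bar> \<le> (\<Sum>j\<in>UNIV. \<bar>z $ j * frechet_derivative \<psi> (at x) (axis j 1)\<bar>)" by (rule sum_abs)
    also have "\<dots> \<le> (\<Sum>j\<in>UNIV. norm z * B j)"
      using B component_le_norm_cart[of z] unfolding abs_mult by (intro sum_mono mult_mono) auto
    finally show ?thesis by (simp add: sum_distrib_left mult.commute)
  qed
  have "(\<Sum>j\<in>UNIV. B j)-lipschitz_on S \<psi>"
    unfolding lipschitz_on_def
  proof (intro conjI ballI)
    show "(\<Sum>j\<in>UNIV. B j) \<ge> 0" using B(1) by (simp add: sum_nonneg)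
    fix x y
    have "\<bar>\<psi> (x - 1 *\<^sub>R (x - y)) - \<psi> x\<bar> \<le> (\<Sum>j\<in>UNIV. B j) * norm (x - y) * \<bar>1\<bar>"
      by (rule test_function_increment[OF \<psi> D])
    then show "dist (\<psi> x) (\<psi> y) \<le> (\<Sum>j\<in>UNIV. B j) * dist x y"
      by (simp add: dist_norm abs_minus_commute)
  qed
  then show ?thesis by blast
qed

lemma lipschitz_on_ball_of_continuous_derivative:
  fixes P :: "real^'k \<Rightarrow> real^'m"
  assumes d: "\<And>y. y \<in> cball y0 R \<Longrightarrow> P differentiable (at y)"
    and c: "\<And>w. continuous_on (cball y0 R) (\<lambda>y. frechet_derivative P (at y) w)"
  shows "\<exists>B. B-lipschitz_on (ball y0 R) P"
proof -
  have "\<forall>l. \<exists>B\<ge>0. \<forall>y\<in>cball y0 R. norm (frechet_derivative P (at y) (axis l 1)) \<le> B"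
  proof
    fix l
    have "bounded ((\<lambda>y. frechet_derivative P (at y) (axis l 1)) ` cball y0 R)"
      by (rule compact_imp_bounded[OF compact_continuous_image[OF c compact_cball]])
    then obtain B where "\<And>y. y \<in> cball y0 R \<Longrightarrow> norm (frechet_derivative P (at y) (axis l 1)) \<le> B"
      unfolding bounded_iff by blast
    then show "\<exists>B\<ge>0. \<forall>y\<in>cball y0 R. norm (frechet_derivative P (at y) (axis l 1)) \<le> B"
      by (intro exI[of _ "max B 0"]) force
  qed
  from choice[OF this] obtain B where B: "\<And>l. B l \<ge> 0"
    "\<And>l y. y \<in> cball y0 R \<Longrightarrow> norm (frechet_derivative P (at y) (axis l 1)) \<le> B l" by blast
  have on: "onorm (frechet_derivative P (at y)) \<le> (\<Sum>l\<in>UNIV. B l)" if y: "y \<in> cball y0 R" for y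
  proof (rule onorm_le)
    fix w
    have lin: "linear (frechet_derivative P (at y))" by (rule linear_frechet_derivative[OF d[OF y]])
    have "frechet_derivative P (at y) w = frechet_derivative P (at y) (\<Sum>l\<in>UNIV. w $ l *\<^sub>R axis l 1)"
      using basis_expansion[of w] by (simp add: scalar_mult_eq_scaleR)
    also have "\<dots> = (\<Sum>l\<in>UNIV. w $ l *\<^sub>R frechet_derivative P (at y) (axis l 1))"
      using lin by (simp add: linear_sum linear_scale)
    also have "norm \<dots> \<le> (\<Sum>l\<in>UNIV. norm (w $ l *\<^sub>R frechet_derivative P (at y) (axis l 1)))" by (rule norm_sum)
    also have "\<dots> \<le> (\<Sum>l\<in>UNIV. norm w * B l)"
      unfolding norm_scaleR using B y component_le_norm_cart[of w] by (intro sum_mono mult_mono) auto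
    finally show "norm (frechet_derivative P (at y) w) \<le> (\<Sum>l\<in>UNIV. B l) * norm w"
      by (simp add: sum_distrib_left mult.commute)
  qed
  have "(\<Sum>l\<in>UNIV. B l)-lipschitz_on (ball y0 R) P"
    unfolding lipschitz_on_def
  proof (intro conjI ballI)
    show "0 \<le> (\<Sum>l\<in>UNIV. B l)" by (intro sum_nonneg B(1))
    fix x y assume xy: "x \<in> ball y0 R" "y \<in> ball y0 R"
    have "norm (P x - P y) \<le> (\<Sum>l\<in>UNIV. B l) * norm (x - y)"
    proof (rule differentiable_bound[OF convex_ball _ _ xy])
      fix z assume z: "z \<in> ball y0 R"
      then have z': "z \<in> cball y0 R" by simp
      show "(P has_derivative frechet_derivative P (at z)) (at z within ball y0 R)"
        using d[OF z'] frechet_derivative_works has_derivative_at_withinI by blast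
      show "onorm (frechet_derivative P (at z)) \<le> (\<Sum>l\<in>UNIV. B l)" by (rule on[OF z'])
    qed
    then show "dist (P x) (P y) \<le> (\<Sum>l\<in>UNIV. B l) * dist x y" by (simp add: dist_norm)
  qed
  then show ?thesis by blast
qed

text \<open>The local situation in which competitors are constructed. The set \<open>V\<close> is a neighbourhood on which the
  map \<open>u\<close> is Lipschitz and takes values so close to \<open>y0\<close> that small perturbations stay in a ball
  on which the projection \<open>P\<close> is Lipschitz with continuous derivative.\<close>

locale projected_variation =
  fixes \<Omega> V :: "(real^'d) set" and M :: "(real^'k) set" and P :: "real^'k \<Rightarrow> real^'k"
    and y0 :: "real^'k" and \<rho> C L LP :: real
    and u :: "real^'d \<Rightarrow> real^'k" and G :: "real^'d \<Rightarrow> real^'d^'k"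
  assumes \<Omega>: "open \<Omega>" "bounded \<Omega>" and V: "open V" "V \<subseteq> \<Omega>" and M: "compact M"
    and u: "u \<in> borel_measurable (lebesgue_on \<Omega>)" "\<And>x. x \<in> \<Omega> \<Longrightarrow> u x \<in> M" "has_weak_gradient \<Omega> u G"
    and G: "G \<in> borel_measurable (lebesgue_on \<Omega>)" "\<And>x. x \<in> \<Omega> \<Longrightarrow> norm (G x) \<le> C"
    and L: "L-lipschitz_on V u"
    and \<rho>: "0 < \<rho>" "u ` V \<subseteq> ball y0 \<rho>"
    and P: "LP-lipschitz_on (ball y0 (3 * \<rho>)) P"
      "\<And>y. y \<in> ball y0 (3 * \<rho>) \<Longrightarrow> P differentiable (at y)"
      "\<And>w. continuous_on (ball y0 (3 * \<rho>)) (\<lambda>y. frechet_derivative P (at y) w)"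
      "\<And>y. y \<in> ball y0 (3 * \<rho>) \<Longrightarrow> P y \<in> M"
      "\<And>y. y \<in> M \<Longrightarrow> P y = y"
begin

definition J :: "real^'k \<Rightarrow> real^'k^'k" where
  "J y = jacobian P (at y)"

definition small_variation :: "(real^'d \<Rightarrow> real) \<Rightarrow> real^'k \<Rightarrow> bool" where
  "small_variation \<psi> \<zeta> \<longleftrightarrow> test_function V \<psi> \<and> (\<forall>x. norm (\<psi> x *\<^sub>R \<zeta>) \<le> \<rho>)"

definition competitor :: "(real^'d \<Rightarrow> real) \<Rightarrow> real^'k \<Rightarrow> real^'d \<Rightarrow> real^'k" where
  "competitor \<psi> \<zeta> x = (if x \<in> V then P (u x + \<psi> x *\<^sub>R \<zeta>) else u x)"

definition competitor_gradient :: "(real^'d \<Rightarrow> real) \<Rightarrow> real^'k \<Rightarrow> real^'d \<Rightarrow> real^'d^'k" where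
  "competitor_gradient \<psi> \<zeta> x =
     (if x \<in> V then J (u x + \<psi> x *\<^sub>R \<zeta>) ** (G x + outer_product \<zeta> (gradient_vec \<psi> x)) else G x)"

lemma continuous_on_J: "continuous_on (ball y0 (3 * \<rho>)) J"
  unfolding J_def jacobian_def matrix_def
  by (intro continuous_on_vec_lambda continuous_on_component P(3))

lemma variation_in_ball:
  assumes "x \<in> V" "norm w \<le> \<rho>"
  shows "u x + w \<in> cball y0 (2 * \<rho>)" "u x + w \<in> ball y0 (3 * \<rho>)"
proof -
  have "dist y0 (u x) < \<rho>" using \<rho>(2) assms(1) by auto
  then have "dist y0 (u x + w) < 2 * \<rho>"
    using dist_triangle[of y0 "u x + w" "u x"] assms(2) by (simp add: dist_norm)
  then show "u x + w \<in> cball y0 (2 * \<rho>)" "u x + w \<in> ball y0 (3 * \<rho>)" using \<rho>(1) by auto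
qed

lemma has_weak_gradient_projected:
  assumes s: "small_variation \<psi> \<zeta>"
  shows "has_weak_gradient V (\<lambda>x. P (u x + \<psi> x *\<^sub>R \<zeta>))
      (\<lambda>x. J (u x + \<psi> x *\<^sub>R \<zeta>) ** (G x + outer_product \<zeta> (gradient_vec \<psi> x)))"
proof -
  have \<psi>: "test_function V \<psi>" and b: "\<And>x. norm (\<psi> x *\<^sub>R \<zeta>) \<le> \<rho>" using s by (auto simp: small_variation_def)
  obtain B where B: "B-lipschitz_on V \<psi>" using test_function_lipschitz[OF \<psi>] by blast
  have lip: "(L + B * norm \<zeta>)-lipschitz_on V (\<lambda>x. u x + \<psi> x *\<^sub>R \<zeta>)"
    unfolding lipschitz_on_def
  proof (intro conjI ballI)
    show "0 \<le> L + B * norm \<zeta>" using lipschitz_on_nonneg[OF L] lipschitz_on_nonneg[OF B] by simp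
    fix x y assume xy: "x \<in> V" "y \<in> V"
    have "dist (u x + \<psi> x *\<^sub>R \<zeta>) (u y + \<psi> y *\<^sub>R \<zeta>) \<le> dist (u x) (u y) + dist (\<psi> x *\<^sub>R \<zeta>) (\<psi> y *\<^sub>R \<zeta>)"
      by (rule dist_triangle_add)
    also have "dist (\<psi> x *\<^sub>R \<zeta>) (\<psi> y *\<^sub>R \<zeta>) = dist (\<psi> x) (\<psi> y) * norm \<zeta>"
      by (simp add: dist_norm scaleR_left_diff_distrib[symmetric])
    also have "dist (u x) (u y) \<le> L * dist x y" by (rule lipschitz_onD[OF L xy])
    also have "dist (\<psi> x) (\<psi> y) * norm \<zeta> \<le> B * dist x y * norm \<zeta>"
      by (intro mult_right_mono lipschitz_onD[OF B xy]) simp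
    finally show "dist (u x + \<psi> x *\<^sub>R \<zeta>) (u y + \<psi> y *\<^sub>R \<zeta>) \<le> (L + B * norm \<zeta>) * dist x y"
      by (simp add: algebra_simps)
  qed
  have wg: "has_weak_gradient V (\<lambda>x. u x + \<psi> x *\<^sub>R \<zeta>) (\<lambda>x. G x + outer_product \<zeta> (gradient_vec \<psi> x))"
    by (rule has_weak_gradient_add[OF V(1) has_weak_gradient_mono[OF \<Omega>(1) V u(3)]
          has_weak_gradient_test_function[OF V(1) \<psi>]])
  show ?thesis unfolding J_def
    by (rule has_weak_gradient_chain[OF V(1) wg lip P(1) _ P(2,3)])
       (use variation_in_ball(2)[OF _ b] in auto)
qed

text \<open>The chain rule applied to \<open>P \<circ> u = u\<close>, the perturbation being zero.\<close>

lemma gradient_tangent: "AE x in lebesgue. x \<in> V \<longrightarrow> J (u x) ** G x = G x"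
proof -
  have t: "test_function V (\<lambda>x. 0)"
    unfolding test_function_def using Ck_on_const[OF open_UNIV] by (auto intro!: exI[of _ "{}"])
  have "small_variation (\<lambda>x. 0) 0" unfolding small_variation_def using t \<rho> by simp
  from has_weak_gradient_projected[OF this]
  have 1: "has_weak_gradient V (\<lambda>x. P (u x)) (\<lambda>x. J (u x) ** (G x + outer_product 0 (gradient_vec (\<lambda>x. 0) x)))"
    by simp
  have z: "outer_product 0 v = (0 :: real^'d^'k)" for v by (simp add: outer_product_def vec_eq_iff)
  have "has_weak_gradient V u (\<lambda>x. J (u x) ** G x)"
    by (rule has_weak_gradient_cong_AE[OF V(1) _ _ 1])
       (use V u(2) P(5) in \<open>auto simp: AE_lebesgue_on_iff[OF V(1)] z\<close>)
  from has_weak_gradient_unique[OF V(1) this has_weak_gradient_mono[OF \<Omega>(1) V u(3)]]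
  show ?thesis by (simp add: AE_lebesgue_on_iff[OF V(1)])
qed

lemma jacobian_mult_uniformly_continuous:
  "uniformly_continuous_on (cball y0 (2 * \<rho>) \<times> cball 0 R) (\<lambda>(y, A :: real^'d^'k). J y ** A)"
proof (rule compact_uniformly_continuous)
  have "cball y0 (2 * \<rho>) \<subseteq> ball y0 (3 * \<rho>)" using \<rho>(1) by auto
  then have "continuous_on (cball y0 (2 * \<rho>)) J" using continuous_on_J continuous_on_subset by blast
  then have "continuous_on (cball y0 (2 * \<rho>) \<times> cball (0 :: real^'d^'k) R) (\<lambda>p. J (fst p))"
    by (rule continuous_on_compose2) (auto intro: continuous_intros)
  then show "continuous_on (cball y0 (2 * \<rho>) \<times> cball 0 R) (\<lambda>(y, A :: real^'d^'k). J y ** A)"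
    unfolding case_prod_beta by (intro continuous_intros)
qed (intro compact_Times compact_cball)

lemma jacobian_mult_bounded:
  "\<exists>D. \<forall>y\<in>cball y0 (2 * \<rho>). \<forall>A\<in>cball 0 R. norm (J y ** (A :: real^'d^'k)) \<le> D"
proof -
  have "compact ((\<lambda>(y, A :: real^'d^'k). J y ** A) ` (cball y0 (2 * \<rho>) \<times> cball 0 R))"
    by (intro compact_continuous_image uniformly_continuous_imp_continuous
        jacobian_mult_uniformly_continuous compact_Times compact_cball)
  from compact_imp_bounded[OF this] show ?thesis by (fastforce simp: bounded_iff)
qed

lemma gradient_vec_bounded:
  assumes \<psi>: "test_function V \<psi>"
  shows "\<exists>R. \<forall>x. norm (outer_product \<zeta> (gradient_vec \<psi> x) :: real^'d^'k) \<le> R"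
proof -
  obtain K where K: "compact K" "K \<subseteq> V" "\<And>x v. x \<notin> K \<Longrightarrow> frechet_derivative \<psi> (at x) v = 0"
    using test_function_support[OF \<psi>] by blast
  have "continuous_on K (\<lambda>x. outer_product \<zeta> (gradient_vec \<psi> x))"
    by (intro continuous_intros continuous_on_gradient_vec[OF \<psi>])
  from compact_imp_bounded[OF compact_continuous_image[OF this K(1)]]
  obtain R where R: "\<And>x. x \<in> K \<Longrightarrow> norm (outer_product \<zeta> (gradient_vec \<psi> x)) \<le> R"
    by (auto simp: bounded_iff)
  have "norm (outer_product \<zeta> (gradient_vec \<psi> x)) \<le> max R 0" for x
  proof (cases "x \<in> K")
    case False
    then have "gradient_vec \<psi> x = 0" by (simp add: gradient_vec_def K(3) vec_eq_iff)
    then show ?thesis by simp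
  qed (use R in force)
  then show ?thesis by blast
qed

text \<open>One bound for all competitors whose perturbation has gradient at most \<open>R\<close>; in particular
  it is independent of cutoff and frequency.\<close>

lemma competitor_gradient_bounded:
  "\<exists>D. \<forall>\<psi> \<zeta>. small_variation \<psi> \<zeta> \<longrightarrow> (\<forall>x. norm (outer_product \<zeta> (gradient_vec \<psi> x)) \<le> R) \<longrightarrow>
     (\<forall>x\<in>\<Omega>. norm (competitor_gradient \<psi> \<zeta> x) \<le> D)"
proof -
  obtain D where D: "\<And>y A. y \<in> cball y0 (2 * \<rho>) \<Longrightarrow> A \<in> cball 0 (C + R) \<Longrightarrow> norm (J y ** (A :: real^'d^'k)) \<le> D"
    using jacobian_mult_bounded[of "C + R"] by blast
  have "norm (competitor_gradient \<psi> \<zeta> x) \<le> max C D"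
    if s: "small_variation \<psi> \<zeta>" and R: "\<forall>x. norm (outer_product \<zeta> (gradient_vec \<psi> x)) \<le> R" and x: "x \<in> \<Omega>" for \<psi> \<zeta> x
  proof (cases "x \<in> V")
    case True
    have "norm (J (u x + \<psi> x *\<^sub>R \<zeta>) ** (G x + outer_product \<zeta> (gradient_vec \<psi> x))) \<le> D"
    proof (rule D)
      show "u x + \<psi> x *\<^sub>R \<zeta> \<in> cball y0 (2 * \<rho>)"
        using variation_in_ball(1)[OF True] s by (simp add: small_variation_def)
      have "norm (G x + outer_product \<zeta> (gradient_vec \<psi> x)) \<le> norm (G x) + norm (outer_product \<zeta> (gradient_vec \<psi> x))"
        by (rule norm_triangle_ineq)
      also have "\<dots> \<le> C + R" using G(2)[OF x] R by (intro add_mono) auto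
      finally show "G x + outer_product \<zeta> (gradient_vec \<psi> x) \<in> cball 0 (C + R)" by simp
    qed
    then show ?thesis using True by (simp add: competitor_gradient_def)
  next
    case False
    then show ?thesis using G(2)[OF x] by (simp add: competitor_gradient_def)
  qed
  then show ?thesis by blast
qed

lemma competitor_minus_continuous:
  assumes s: "small_variation \<psi> \<zeta>"
  shows "continuous_on UNIV (\<lambda>x. if x \<in> V then P (u x + \<psi> x *\<^sub>R \<zeta>) - u x else 0)"
proof -
  have \<psi>: "test_function V \<psi>" and b: "\<And>x. norm (\<psi> x *\<^sub>R \<zeta>) \<le> \<rho>" using s by (auto simp: small_variation_def)
  obtain K where K: "compact K" "K \<subseteq> V" "\<And>x. x \<notin> K \<Longrightarrow> \<psi> x = 0"
    using test_function_support[OF \<psi>] by blast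
  have cu: "continuous_on V u" using lipschitz_on_continuous_on[OF L] .
  have "continuous_on V (\<lambda>x. P (u x + \<psi> x *\<^sub>R \<zeta>))"
    by (rule continuous_on_compose2[OF lipschitz_on_continuous_on[OF P(1)]])
       (use variation_in_ball(2)[OF _ b] in \<open>auto intro!: continuous_intros cu test_function_continuous[OF \<psi>]\<close>)
  then have 1: "continuous_on V (\<lambda>x. P (u x + \<psi> x *\<^sub>R \<zeta>) - u x)" by (intro continuous_intros cu)
  have "continuous_on (V \<union> - K) (\<lambda>x. if x \<in> V then P (u x + \<psi> x *\<^sub>R \<zeta>) - u x else 0)"
  proof (rule continuous_on_open_Un[OF V(1)])
    show "open (- K)" using K(1) by (simp add: compact_imp_closed open_Compl)
    show "continuous_on V (\<lambda>x. if x \<in> V then P (u x + \<psi> x *\<^sub>R \<zeta>) - u x else 0)"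
      by (rule continuous_on_eq[OF 1]) simp
    show "continuous_on (- K) (\<lambda>x. if x \<in> V then P (u x + \<psi> x *\<^sub>R \<zeta>) - u x else 0)"
      by (rule continuous_on_eq[OF continuous_on_const[of _ 0]]) (use K(3) u(2) P(5) V(2) in auto)
  qed
  moreover have "V \<union> - K = UNIV" using K(2) by blast
  ultimately show ?thesis by simp
qed

lemma competitor_measurable:
  assumes s: "small_variation \<psi> \<zeta>"
  shows "competitor \<psi> \<zeta> \<in> borel_measurable (lebesgue_on \<Omega>)"
    and "competitor_gradient \<psi> \<zeta> \<in> borel_measurable (lebesgue_on \<Omega>)"
proof -
  have \<psi>: "test_function V \<psi>" and b: "\<And>x. norm (\<psi> x *\<^sub>R \<zeta>) \<le> \<rho>" using s by (auto simp: small_variation_def)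
  have leb: "f \<in> borel_measurable (lebesgue_on \<Omega>)" if "f \<in> borel_measurable borel"
    for f :: "real^'d \<Rightarrow> 'z::euclidean_space"
    by (rule measurable_restrict_space1[OF measurable_completion]) (use that in simp)
  have "(\<lambda>x. u x + (if x \<in> V then P (u x + \<psi> x *\<^sub>R \<zeta>) - u x else 0)) \<in> borel_measurable (lebesgue_on \<Omega>)"
    by (intro borel_measurable_add u(1) leb borel_measurable_continuous_onI competitor_minus_continuous[OF s])
  moreover have "(\<lambda>x. u x + (if x \<in> V then P (u x + \<psi> x *\<^sub>R \<zeta>) - u x else 0)) = competitor \<psi> \<zeta>"
    by (auto simp: competitor_def fun_eq_iff)
  ultimately show "competitor \<psi> \<zeta> \<in> borel_measurable (lebesgue_on \<Omega>)" by simp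
  define A where "A x = (if x \<in> V then J (u x + \<psi> x *\<^sub>R \<zeta>) else mat 1)" for x
  have cu: "continuous_on V u" using lipschitz_on_continuous_on[OF L] .
  have "continuous_on V (\<lambda>x. J (u x + \<psi> x *\<^sub>R \<zeta>))"
    by (rule continuous_on_compose2[OF continuous_on_J])
       (use variation_in_ball(2)[OF _ b] in \<open>auto intro!: continuous_intros cu test_function_continuous[OF \<psi>]\<close>)
  then have "A \<in> borel_measurable borel"
    unfolding A_def[abs_def] using V(1)
    by (intro borel_measurable_continuous_on_if) (auto intro: continuous_on_const)
  then have Am: "A \<in> borel_measurable (lebesgue_on \<Omega>)" by (rule leb)
  have Bm: "(\<lambda>x. G x + outer_product \<zeta> (gradient_vec \<psi> x)) \<in> borel_measurable (lebesgue_on \<Omega>)"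
    by (intro borel_measurable_add G(1) leb borel_measurable_continuous_onI continuous_intros
        continuous_on_gradient_vec[OF \<psi>])
  have "(\<lambda>x. A x ** (G x + outer_product \<zeta> (gradient_vec \<psi> x))) \<in> borel_measurable (lebesgue_on \<Omega>)"
    by (rule borel_measurable_continuous_Pair[OF Am Bm]) (intro continuous_intros)
  moreover have "(\<lambda>x. A x ** (G x + outer_product \<zeta> (gradient_vec \<psi> x))) = competitor_gradient \<psi> \<zeta>"
  proof
    fix x
    have "gradient_vec \<psi> x = 0" if "x \<notin> V"
      using test_function_support[OF \<psi>] that by (auto simp: gradient_vec_def vec_eq_iff)
    then show "A x ** (G x + outer_product \<zeta> (gradient_vec \<psi> x)) = competitor_gradient \<psi> \<zeta> x"
      by (simp add: A_def competitor_gradient_def)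
  qed
  ultimately show "competitor_gradient \<psi> \<zeta> \<in> borel_measurable (lebesgue_on \<Omega>)" by simp
qed

lemma competitor_in_M: "small_variation \<psi> \<zeta> \<Longrightarrow> x \<in> \<Omega> \<Longrightarrow> competitor \<psi> \<zeta> x \<in> M"
  using u(2) P(4) variation_in_ball(2) by (simp add: competitor_def small_variation_def)

lemma competitor_gradient_off_support:
  assumes "test_function V \<psi>"
    and K: "compact K" "K \<subseteq> V" "\<And>x. x \<notin> K \<Longrightarrow> \<psi> x = 0 \<and> (\<forall>v. frechet_derivative \<psi> (at x) v = 0)"
  shows "AE x in lebesgue. x \<in> \<Omega> - K \<longrightarrow> competitor_gradient \<psi> \<zeta> x = G x"
  using gradient_tangent
proof eventually_elim
  case (elim x)
  show ?case
  proof
    assume x: "x \<in> \<Omega> - K"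
    then have "gradient_vec \<psi> x = 0" using K(3) by (auto simp: gradient_vec_def vec_eq_iff)
    then show "competitor_gradient \<psi> \<zeta> x = G x"
      using elim x K(3) by (auto simp: competitor_gradient_def)
  qed
qed

text \<open>The gradient is given by the chain rule on \<open>V\<close>, and by \<open>G\<close> away from the support of \<open>\<psi>\<close>. On the overlap the two
  agree because \<open>\<nabla>P\<close> acts as the identity on \<open>G\<close>, and weak gradients can be glued.\<close>

lemma has_weak_gradient_competitor:
  assumes s: "small_variation \<psi> \<zeta>"
  shows "has_weak_gradient \<Omega> (competitor \<psi> \<zeta>) (competitor_gradient \<psi> \<zeta>)"
proof -
  have \<psi>: "test_function V \<psi>" using s by (auto simp: small_variation_def)
  obtain K where K: "compact K" "K \<subseteq> V" "\<And>x. x \<notin> K \<Longrightarrow> \<psi> x = 0 \<and> (\<forall>v. frechet_derivative \<psi> (at x) v = 0)"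
    using test_function_support[OF \<psi>] by blast
  have V2: "open (\<Omega> - K)" using \<Omega>(1) K(1) by (simp add: compact_imp_closed open_Diff)
  have 1: "has_weak_gradient V (competitor \<psi> \<zeta>) (competitor_gradient \<psi> \<zeta>)"
    by (rule has_weak_gradient_cong_AE[OF V(1) _ _ has_weak_gradient_projected[OF s]])
       (auto simp: AE_lebesgue_on_iff[OF V(1)] competitor_def competitor_gradient_def)
  have 2: "has_weak_gradient (\<Omega> - K) (competitor \<psi> \<zeta>) (competitor_gradient \<psi> \<zeta>)"
  proof (rule has_weak_gradient_cong_AE[OF V2 _ _ has_weak_gradient_mono[OF \<Omega>(1) V2 _ u(3)]])
    show "AE x in lebesgue_on (\<Omega> - K). u x = competitor \<psi> \<zeta> x"
      using K(3) u(2) P(5) by (auto simp: AE_lebesgue_on_iff[OF V2] competitor_def)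
    show "AE x in lebesgue_on (\<Omega> - K). G x = competitor_gradient \<psi> \<zeta> x"
    proof -
      have "AE x in lebesgue. x \<in> \<Omega> - K \<longrightarrow> competitor_gradient \<psi> \<zeta> x = G x"
        by (rule competitor_gradient_off_support[OF \<psi> K(1,2)]) (use K(3) in blast)
      then show ?thesis unfolding AE_lebesgue_on_iff[OF V2] by eventually_elim auto
    qed
  qed blast
  have Un: "V \<union> (\<Omega> - K) = \<Omega>" using K(2) V(2) by blast
  obtain R where R: "\<forall>x. norm (outer_product \<zeta> (gradient_vec \<psi> x)) \<le> R" using gradient_vec_bounded[OF \<psi>] by blast
  obtain D where D: "\<forall>x\<in>\<Omega>. norm (competitor_gradient \<psi> \<zeta> x) \<le> D"
    using competitor_gradient_bounded[of R] s R by blast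
  obtain B where B: "\<And>y. y \<in> M \<Longrightarrow> norm y \<le> B" using compact_imp_bounded[OF M] by (auto simp: bounded_iff)
  have l: "locally_integrable (V \<union> (\<Omega> - K)) (competitor \<psi> \<zeta>)"
      "locally_integrable (V \<union> (\<Omega> - K)) (competitor_gradient \<psi> \<zeta>)"
  proof -
    show "locally_integrable (V \<union> (\<Omega> - K)) (competitor \<psi> \<zeta>)" unfolding Un
      by (rule integrable_imp_locally_integrable[OF \<Omega>(1)
            integrable_lebesgue_on_bounded[OF \<Omega> competitor_measurable(1)[OF s], of B]])
         (use B competitor_in_M[OF s] in \<open>auto simp: AE_lebesgue_on_iff[OF \<Omega>(1)]\<close>)
    show "locally_integrable (V \<union> (\<Omega> - K)) (competitor_gradient \<psi> \<zeta>)" unfolding Un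
      by (rule integrable_imp_locally_integrable[OF \<Omega>(1)
            integrable_lebesgue_on_bounded[OF \<Omega> competitor_measurable(2)[OF s], of D]])
         (use D in \<open>auto simp: AE_lebesgue_on_iff[OF \<Omega>(1)]\<close>)
  qed
  from has_weak_gradient_Un[OF V(1) V2 1 2 l] show ?thesis unfolding Un .
qed

lemma competitor_W1:
  assumes s: "small_variation \<psi> \<zeta>"
  shows "competitor \<psi> \<zeta> \<in> W1 \<Omega> 1"
proof -
  have \<psi>: "test_function V \<psi>" using s by (auto simp: small_variation_def)
  obtain R where R: "\<forall>x. norm (outer_product \<zeta> (gradient_vec \<psi> x)) \<le> R" using gradient_vec_bounded[OF \<psi>] by blast
  obtain D where D: "\<forall>x\<in>\<Omega>. norm (competitor_gradient \<psi> \<zeta> x) \<le> D"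
    using competitor_gradient_bounded[of R] s R by blast
  obtain B where B: "\<And>y. y \<in> M \<Longrightarrow> norm y \<le> B" using compact_imp_bounded[OF M] by (auto simp: bounded_iff)
  show ?thesis
    by (rule W1_1_bounded[OF \<Omega> has_weak_gradient_competitor[OF s] competitor_measurable(1)[OF s] _ competitor_measurable(2)[OF s],
          of B D])
       (use B D competitor_in_M[OF s] in \<open>auto simp: AE_lebesgue_on_iff[OF \<Omega>(1)]\<close>)
qed

lemma has_weak_gradient_competitor_minus:
  assumes s: "small_variation \<psi> \<zeta>"
  shows "has_weak_gradient \<Omega> (\<lambda>x. u x - competitor \<psi> \<zeta> x) (\<lambda>x. G x - competitor_gradient \<psi> \<zeta> x)"
  by (rule has_weak_gradient_diff[OF \<Omega>(1) u(3) has_weak_gradient_competitor[OF s]])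

lemma competitor_admissible:
  assumes s: "small_variation \<psi> \<zeta>" and a: "u \<in> admissible \<Omega> \<Gamma> M n\<^sub>0"
  shows "competitor \<psi> \<zeta> \<in> admissible \<Omega> \<Gamma> M n\<^sub>0"
proof -
  define w where "w x = (if x \<in> V then P (u x + \<psi> x *\<^sub>R \<zeta>) - u x else 0)" for x
  have uW: "u \<in> W1 \<Omega> 1" using a by (auto simp: admissible_def W1_into_def)
  have wW: "w \<in> W1 \<Omega> 1"
  proof -
    have "(\<lambda>x. competitor \<psi> \<zeta> x - u x) \<in> W1 \<Omega> 1" by (rule W1_1_diff[OF \<Omega>(1) competitor_W1[OF s] uW])
    moreover have "(\<lambda>x. competitor \<psi> \<zeta> x - u x) = w" by (auto simp: w_def competitor_def)
    ultimately show ?thesis by simp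
  qed
  show ?thesis
  proof (rule admissible_perturb[OF \<Omega>(1) a competitor_W1[OF s] wW])
    show "continuous_on UNIV w" unfolding w_def[abs_def] by (rule competitor_minus_continuous[OF s])
    show "w x = 0" if "x \<notin> \<Omega>" for x using that V(2) by (auto simp: w_def)
    show "AE x in lebesgue_on \<Omega>. competitor \<psi> \<zeta> x = u x + w x" by (simp add: w_def competitor_def)
    show "AE x in lebesgue_on \<Omega>. competitor \<psi> \<zeta> x \<in> M"
      using competitor_in_M[OF s] by (simp add: AE_lebesgue_on_iff[OF \<Omega>(1)])
  qed
qed

end

section \<open>Second derivatives along rank-one lines\<close>

lemma has_real_derivative_along_line:
  fixes f :: "'a::real_normed_vector \<times> 'b::real_normed_vector \<Rightarrow> real"
  assumes "(f has_derivative f') (at (y, A + s *\<^sub>R Z))"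
  shows "((\<lambda>t. f (y, A + t *\<^sub>R Z)) has_real_derivative f' (0, Z)) (at s)"
proof -
  have "((\<lambda>t. (y, A + t *\<^sub>R Z)) has_derivative (\<lambda>t. (0, t *\<^sub>R Z))) (at s)"
    by (auto intro!: derivative_eq_intros)
  from has_derivative_compose[OF this assms]
  have "((\<lambda>t. f (y, A + t *\<^sub>R Z)) has_derivative (\<lambda>t. f' (0, t *\<^sub>R Z))) (at s)" .
  moreover have "f' (0, t *\<^sub>R Z) = f' (0, Z) * t" for t
    using linear_scale[OF has_derivative_linear[OF assms], of t "(0, Z)"] by simp
  ultimately show ?thesis by (simp add: has_field_derivative_def)
qed

lemma outer_product_expansion:
  "outer_product w \<eta> = (\<Sum>i\<in>UNIV. \<Sum>j\<in>UNIV. (w $ i * \<eta> $ j) *\<^sub>R axis i (axis j (1::real)))"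
  (is "_ = ?S")
proof -
  have "?S $ a $ b = outer_product w \<eta> $ a $ b" for a b
  proof -
    have "?S $ a $ b = (\<Sum>i\<in>UNIV. \<Sum>j\<in>UNIV. (w $ i * \<eta> $ j) * (if i = a \<and> j = b then 1 else 0))"
      unfolding sum_component vector_scaleR_component by (intro sum.cong refl) (auto simp: axis_def)
    also have "\<dots> = (\<Sum>i\<in>UNIV. if i = a then w $ i * \<eta> $ b else 0)"
    proof (rule sum.cong[OF refl])
      fix i
      have "(\<Sum>j\<in>UNIV. (w $ i * \<eta> $ j) * (if i = a \<and> j = b then 1 else 0)) =
          (\<Sum>j\<in>UNIV. if j = b then (if i = a then w $ i * \<eta> $ j else 0) else 0)"
        by (rule sum.cong) auto
      then show "(\<Sum>j\<in>UNIV. (w $ i * \<eta> $ j) * (if i = a \<and> j = b then 1 else 0)) = (if i = a then w $ i * \<eta> $ b else 0)"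
        by simp
    qed
    finally show ?thesis by (simp add: outer_product_def)
  qed
  then show ?thesis by (simp add: vec_eq_iff)
qed

text \<open>Expansion in the matrix units, in which the partial derivatives of the integrand are taken.\<close>

lemma linear_outer_product:
  fixes f :: "'a::real_vector \<times> (real^'d^'k) \<Rightarrow> real"
  assumes "linear f"
  shows "f (0, outer_product w \<eta>) = (\<Sum>i\<in>UNIV. \<Sum>j\<in>UNIV. w $ i * \<eta> $ j * f (0, axis i (axis j 1)))"
proof -
  have l: "linear (\<lambda>Z. f (0, Z))"
  proof (rule linearI)
    show "f (0, a + b) = f (0, a) + f (0, b)" for a b using linear_add[OF assms, of "(0, a)" "(0, b)"] by simp
    show "f (0, c *\<^sub>R b) = c *\<^sub>R f (0, b)" for c b using linear_scale[OF assms, of c "(0, b)"] by simp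
  qed
  show ?thesis unfolding outer_product_expansion linear_sum[OF l] linear_scale[OF l] by simp
qed

text \<open>Along the line in direction \<open>w \<otimes> \<eta>\<close> the Legendre form is the ordinary second derivative. The existence of
  \<open>q1\<close> says this in the form in which second differences are compared with it.\<close>

lemma second_derivative_rank_one:
  fixes Fx :: "(real^'k) \<times> (real^'d^'k) \<Rightarrow> real"
  assumes O: "open O'" "y \<in> O'" and C2: "Ck_on 2 Fx (O' \<times> UNIV)"
  shows "\<exists>q1. (\<forall>s. ((\<lambda>t. Fx (y, A + t *\<^sub>R outer_product w \<eta>)) has_real_derivative q1 s) (at s)) \<and>
     (q1 has_real_derivative (\<Sum>i\<in>UNIV. \<Sum>r\<in>UNIV. \<Sum>j\<in>UNIV. \<Sum>l\<in>UNIV.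
       entry_deriv i j (entry_deriv r l (\<lambda>A. Fx (y, A))) A * \<eta> $ j * \<eta> $ l * w $ i * w $ r)) (at 0)"
proof -
  let ?E = "\<lambda>i j. axis i (axis j (1::real)) :: real^'d^'k"
  define Z where "Z = outer_product w \<eta>"
  have S: "open (O' \<times> (UNIV :: (real^'d^'k) set))" using O(1) by (simp add: open_Times)
  have C2': "Ck_on (Suc (Suc 0)) Fx (O' \<times> UNIV)" using C2 by (simp add: numeral_2_eq_2)
  define D1 where "D1 p v = frechet_derivative Fx (at p) v" for p v
  define D2 where "D2 v p w = frechet_derivative (\<lambda>p. D1 p v) (at p) w" for v p w
  have mem: "(y, B) \<in> O' \<times> UNIV" for B :: "real^'d^'k" using O(2) by simp
  have d1: "(Fx has_derivative D1 (y, B)) (at (y, B))" for B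
    unfolding D1_def using Ck_on_SucD[OF C2' mem] .
  have "Ck_on (Suc 0) (\<lambda>p. D1 p v) (O' \<times> UNIV)" for v
    using C2' unfolding D1_def Ck_on.simps(2)[of "Suc 0"] by blast
  then have d2: "((\<lambda>p. D1 p v) has_derivative D2 v (y, B)) (at (y, B))" for B v
    unfolding D2_def using Ck_on_SucD mem by blast
  have e1: "entry_deriv r l (\<lambda>A. Fx (y, A)) B = D1 (y, B) (0, ?E r l)" for r l B
    unfolding entry_deriv_def
    by (rule DERIV_imp_deriv) (rule has_real_derivative_along_line, use d1[of B] in simp)
  have e2: "entry_deriv i j (entry_deriv r l (\<lambda>A. Fx (y, A))) A = D2 (0, ?E r l) (y, A) (0, ?E i j)" for i j r l
    unfolding e1[abs_def] unfolding entry_deriv_def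
    by (rule DERIV_imp_deriv) (rule has_real_derivative_along_line, use d2[of _ A] in simp)
  define q1 where "q1 s = D1 (y, A + s *\<^sub>R Z) (0, Z)" for s
  have q1: "((\<lambda>t. Fx (y, A + t *\<^sub>R Z)) has_real_derivative q1 s) (at s)" for s
    unfolding q1_def by (rule has_real_derivative_along_line[OF d1])
  have q1_sum: "q1 s = (\<Sum>r\<in>UNIV. \<Sum>l\<in>UNIV. w $ r * \<eta> $ l * D1 (y, A + s *\<^sub>R Z) (0, ?E r l))" for s
    unfolding q1_def Z_def by (rule linear_outer_product[OF has_derivative_linear[OF d1]])
  have dq: "((\<lambda>s. D1 (y, A + s *\<^sub>R Z) (0, ?E r l)) has_real_derivative D2 (0, ?E r l) (y, A) (0, Z)) (at 0)" for r l
    by (rule has_real_derivative_along_line) (use d2[of _ A] in simp)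
  have "(q1 has_real_derivative (\<Sum>r\<in>UNIV. \<Sum>l\<in>UNIV. w $ r * \<eta> $ l * D2 (0, ?E r l) (y, A) (0, Z))) (at 0)"
    unfolding q1_sum[abs_def] by (intro DERIV_sum DERIV_cmult dq)
  moreover have "(\<Sum>r\<in>UNIV. \<Sum>l\<in>UNIV. w $ r * \<eta> $ l * D2 (0, ?E r l) (y, A) (0, Z)) =
     (\<Sum>i\<in>UNIV. \<Sum>r\<in>UNIV. \<Sum>j\<in>UNIV. \<Sum>l\<in>UNIV.
       entry_deriv i j (entry_deriv r l (\<lambda>A. Fx (y, A))) A * \<eta> $ j * \<eta> $ l * w $ i * w $ r)"
  proof -
    define T where "T i r j l = D2 (0, ?E r l) (y, A) (0, ?E i j) * \<eta> $ j * \<eta> $ l * w $ i * w $ r" for i r j l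
    have "(\<Sum>r\<in>UNIV. \<Sum>l\<in>UNIV. w $ r * \<eta> $ l * D2 (0, ?E r l) (y, A) (0, Z)) =
        (\<Sum>r\<in>UNIV. \<Sum>l\<in>UNIV. \<Sum>i\<in>UNIV. \<Sum>j\<in>UNIV. T i r j l)"
      unfolding Z_def linear_outer_product[OF has_derivative_linear[OF d2]] sum_distrib_left T_def
      by (intro sum.cong refl) (simp add: mult_ac)
    also have "\<dots> = (\<Sum>r\<in>UNIV. \<Sum>i\<in>UNIV. \<Sum>l\<in>UNIV. \<Sum>j\<in>UNIV. T i r j l)"
      by (intro sum.cong refl sum.swap)
    also have "\<dots> = (\<Sum>i\<in>UNIV. \<Sum>r\<in>UNIV. \<Sum>l\<in>UNIV. \<Sum>j\<in>UNIV. T i r j l)" by (rule sum.swap)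
    also have "\<dots> = (\<Sum>i\<in>UNIV. \<Sum>r\<in>UNIV. \<Sum>j\<in>UNIV. \<Sum>l\<in>UNIV. T i r j l)"
      by (intro sum.cong refl sum.swap)
    finally show ?thesis unfolding e2 T_def .
  qed
  ultimately show ?thesis using q1 unfolding Z_def by (intro exI[of _ q1]) simp
qed

text \<open>Near \<open>0\<close> the derivative \<open>q1 s - q1 (- s)\<close> of \<open>q s + q (- s)\<close> is negative for small positive \<open>s\<close>,
  because \<open>q1\<close> is decreasing through \<open>0\<close>.\<close>

lemma second_difference_negative:
  fixes q q1 :: "real \<Rightarrow> real"
  assumes q: "\<And>s. (q has_real_derivative q1 s) (at s)" and q1: "(q1 has_real_derivative Q) (at 0)" and Q: "Q < 0"
  shows "\<exists>s0>0. \<forall>s. s \<noteq> 0 \<longrightarrow> \<bar>s\<bar> < s0 \<longrightarrow> q s + q (- s) < 2 * q 0"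
proof -
  obtain d1 where d1: "d1 > 0" "\<forall>h>0. h < d1 \<longrightarrow> q1 (0 + h) < q1 0"
    using DERIV_neg_dec_right[OF q1 Q] by auto
  obtain d2 where d2: "d2 > 0" "\<forall>h>0. h < d2 \<longrightarrow> q1 0 < q1 (0 - h)"
    using DERIV_neg_dec_left[OF q1 Q] by auto
  define s0 where "s0 = min d1 d2"
  have D: "((\<lambda>s. q s + q (- s)) has_real_derivative q1 s - q1 (- s)) (at s)" for s
  proof -
    have "((\<lambda>s. q (- s)) has_real_derivative q1 (- s) * -1) (at s)"
      by (rule DERIV_chain2[OF q]) (auto intro!: derivative_eq_intros)
    from DERIV_add[OF q this] show ?thesis by simp
  qed
  have pos: "q s + q (- s) < 2 * q 0" if s: "0 < s" "s < s0" for s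
  proof -
    have "q s + q (- s) < q 0 + q (- 0)"
    proof (rule DERIV_neg_imp_decreasing_open[OF s(1)])
      fix t assume t: "0 < t" "t < s"
      have "q1 t - q1 (- t) < 0" 
      proof -
        have "q1 (0 + t) < q1 0" using d1(2) t s by (simp add: s0_def)
        moreover have "q1 0 < q1 (0 - t)" using d2(2) t s by (simp add: s0_def)
        ultimately show ?thesis by simp
      qed
      then show "\<exists>y. ((\<lambda>s. q s + q (- s)) has_real_derivative y) (at t) \<and> y < 0"
        by (intro exI[of _ "q1 t - q1 (- t)"] conjI D)
    next
      show "continuous_on {0..s} (\<lambda>s. q s + q (- s))"
        by (rule continuous_at_imp_continuous_on) (simp add: DERIV_isCont[OF D])
    qed
    then show ?thesis by simp
  qed
  have "q s + q (- s) < 2 * q 0" if s: "s \<noteq> 0" "\<bar>s\<bar> < s0" for s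
    using pos[of s] pos[of "- s"] s by (cases "s > 0") (auto simp: add.commute)
  moreover have "s0 > 0" using d1(1) d2(1) by (simp add: s0_def)
  ultimately show ?thesis by blast
qed

section \<open>Oscillating variations\<close>

lemma norm_outer_product: "norm (outer_product \<zeta> v) = norm \<zeta> * norm v"
proof -
  have "outer_product \<zeta> v $ i = \<zeta> $ i *\<^sub>R v" for i by (simp add: outer_product_def vec_eq_iff)
  then have "norm (outer_product \<zeta> v) = L2_set (\<lambda>i. norm (\<zeta> $ i) * norm v) UNIV"
    by (simp add: norm_vec_def[of "outer_product \<zeta> v"])
  also have "\<dots> = norm \<zeta> * norm v" by (simp add: L2_set_left_distrib norm_vec_def[of \<zeta>])
  finally show ?thesis .
qed

text \<open>Dividing by \<open>N\<close> makes the perturbation uniformly small while its gradient keeps the amplitude \<open>\<delta>\<close>.\<close>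

definition oscillation :: "(real^'d \<Rightarrow> real) \<Rightarrow> real^'d \<Rightarrow> real \<Rightarrow> real \<Rightarrow> real \<Rightarrow> real^'d \<Rightarrow> real" where
  "oscillation \<kappa> \<eta> \<delta> N \<theta> x = \<kappa> x * ((\<delta> / N) * cos (N * (x \<bullet> \<eta>) + \<theta>))"

lemma test_function_oscillation:
  assumes "test_function V \<kappa>" shows "test_function V (oscillation \<kappa> \<eta> \<delta> N \<theta>)"
proof -
  have "Ck_on r (\<lambda>x. N * (x \<bullet> \<eta>) + \<theta>) UNIV" for r
    by (rule Ck_on_add[OF open_UNIV Ck_on_bounded_linear[OF open_UNIV
          bounded_linear_compose[OF bounded_linear_mult_right bounded_linear_inner_left]] Ck_on_const[OF open_UNIV]])
  then have "Ck_on r (\<lambda>x. (\<delta> / N) * cos (N * (x \<bullet> \<eta>) + \<theta>)) UNIV" for r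
    by (intro Ck_on_mult[OF open_UNIV Ck_on_const[OF open_UNIV]] Ck_on_compose_real[OF open_UNIV open_UNIV subset_UNIV Ck_on_cos])
  from test_function_mult_smooth[OF assms this] show ?thesis unfolding oscillation_def[abs_def] .
qed

lemma gradient_vec_oscillation:
  assumes \<kappa>: "test_function V \<kappa>" and N: "N \<noteq> 0"
  shows "gradient_vec (oscillation \<kappa> \<eta> \<delta> N \<theta>) x =
     (- \<delta> * \<kappa> x * sin (N * (x \<bullet> \<eta>) + \<theta>)) *\<^sub>R \<eta> + (\<delta> / N * cos (N * (x \<bullet> \<eta>) + \<theta>)) *\<^sub>R gradient_vec \<kappa> x"
proof -
  have "((\<lambda>x. (\<delta> / N) * cos (N * (x \<bullet> \<eta>) + \<theta>)) has_derivative
      (\<lambda>v. - \<delta> * sin (N * (x \<bullet> \<eta>) + \<theta>) * (v \<bullet> \<eta>))) (at x)"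
    using N by (auto intro!: derivative_eq_intros simp: fun_eq_iff)
  from has_derivative_mult[OF test_function_has_derivative[OF \<kappa>] this]
  have "(oscillation \<kappa> \<eta> \<delta> N \<theta> has_derivative (\<lambda>v. \<kappa> x * (- \<delta> * sin (N * (x \<bullet> \<eta>) + \<theta>) * (v \<bullet> \<eta>)) +
      frechet_derivative \<kappa> (at x) v * ((\<delta> / N) * cos (N * (x \<bullet> \<eta>) + \<theta>)))) (at x)"
    unfolding oscillation_def[abs_def] .
  from frechet_derivative_at[OF this, symmetric]
  have "frechet_derivative (oscillation \<kappa> \<eta> \<delta> N \<theta>) (at x) v = \<kappa> x * (- \<delta> * sin (N * (x \<bullet> \<eta>) + \<theta>) * (v \<bullet> \<eta>)) +
      frechet_derivative \<kappa> (at x) v * ((\<delta> / N) * cos (N * (x \<bullet> \<eta>) + \<theta>))" for v by metis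
  then show ?thesis by (simp add: gradient_vec_def vec_eq_iff inner_axis' mult_ac)
qed

lemma oscillation_le:
  assumes "0 \<le> \<kappa> x" "\<kappa> x \<le> 1" "\<delta> \<ge> 0" "N > 0"
  shows "\<bar>oscillation \<kappa> \<eta> \<delta> N \<theta> x\<bar> \<le> \<delta> / N"
proof -
  have "\<bar>oscillation \<kappa> \<eta> \<delta> N \<theta> x\<bar> = \<kappa> x * (\<delta> / N * \<bar>cos (N * (x \<bullet> \<eta>) + \<theta>)\<bar>)"
    using assms by (simp add: oscillation_def abs_mult)
  also have "\<dots> \<le> 1 * (\<delta> / N * 1)" using assms by (intro mult_mono) auto
  finally show ?thesis by simp
qed

text \<open>Up to terms of order \<open>1 / N\<close> the perturbation vanishes and its gradient is the rank-one
  oscillation in which the cutoff is not differentiated.\<close>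

lemma oscillation_estimates:
  fixes \<kappa> :: "real^'d \<Rightarrow> real" and \<zeta> :: "real^'k"
  assumes \<kappa>: "test_function V \<kappa>" "0 \<le> \<kappa> x" "\<kappa> x \<le> 1" and \<delta>: "\<delta> \<ge> 0" and N: "N > 0"
    and R: "norm (outer_product \<zeta> (gradient_vec \<kappa> x)) \<le> R"
  shows "norm (oscillation \<kappa> \<eta> \<delta> N \<theta> x *\<^sub>R \<zeta>) \<le> \<delta> * norm \<zeta> / N"
    and "norm (outer_product \<zeta> (gradient_vec (oscillation \<kappa> \<eta> \<delta> N \<theta>) x)
           - (- \<delta> * \<kappa> x * sin (N * (x \<bullet> \<eta>) + \<theta>)) *\<^sub>R outer_product \<zeta> \<eta>) \<le> \<delta> * R / N"
    and "norm ((- \<delta> * \<kappa> x * sin (N * (x \<bullet> \<eta>) + \<theta>)) *\<^sub>R outer_product \<zeta> \<eta>) \<le> \<delta> * (norm \<zeta> * norm \<eta>)"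
    and "norm (outer_product \<zeta> (gradient_vec (oscillation \<kappa> \<eta> \<delta> N \<theta>) x)) \<le> \<delta> * (norm \<zeta> * norm \<eta>) + \<delta> * R / N"
proof -
  have "norm (oscillation \<kappa> \<eta> \<delta> N \<theta> x *\<^sub>R \<zeta>) \<le> \<delta> / N * norm \<zeta>"
    using mult_right_mono[OF oscillation_le[of \<kappa> x \<delta> N \<eta> \<theta>, OF \<kappa>(2,3) \<delta> N], of "norm \<zeta>"] by simp
  then show "norm (oscillation \<kappa> \<eta> \<delta> N \<theta> x *\<^sub>R \<zeta>) \<le> \<delta> * norm \<zeta> / N" by simp
  have e: "outer_product \<zeta> (gradient_vec (oscillation \<kappa> \<eta> \<delta> N \<theta>) x) =
      (- \<delta> * \<kappa> x * sin (N * (x \<bullet> \<eta>) + \<theta>)) *\<^sub>R outer_product \<zeta> \<eta> +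
      (\<delta> / N * cos (N * (x \<bullet> \<eta>) + \<theta>)) *\<^sub>R outer_product \<zeta> (gradient_vec \<kappa> x)"
    using N unfolding gradient_vec_oscillation[OF \<kappa>(1) less_imp_neq[OF N, symmetric]]
    by (simp add: outer_product_def vec_eq_iff algebra_simps)
  have "norm ((\<delta> / N * cos (N * (x \<bullet> \<eta>) + \<theta>)) *\<^sub>R outer_product \<zeta> (gradient_vec \<kappa> x)) =
      \<delta> / N * (\<bar>cos (N * (x \<bullet> \<eta>) + \<theta>)\<bar> * norm (outer_product \<zeta> (gradient_vec \<kappa> x)))"
    using \<delta> N by (simp add: abs_mult)
  also have "\<dots> \<le> \<delta> / N * (1 * R)" using \<delta> N R by (intro mult_left_mono mult_mono) auto
  finally have n2: "norm ((\<delta> / N * cos (N * (x \<bullet> \<eta>) + \<theta>)) *\<^sub>R outer_product \<zeta> (gradient_vec \<kappa> x)) \<le> \<delta> * R / N"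
    by simp
  then show "norm (outer_product \<zeta> (gradient_vec (oscillation \<kappa> \<eta> \<delta> N \<theta>) x)
           - (- \<delta> * \<kappa> x * sin (N * (x \<bullet> \<eta>) + \<theta>)) *\<^sub>R outer_product \<zeta> \<eta>) \<le> \<delta> * R / N"
    unfolding e by simp
  have "\<bar>- \<delta> * \<kappa> x * sin (N * (x \<bullet> \<eta>) + \<theta>)\<bar> = \<delta> * (\<kappa> x * \<bar>sin (N * (x \<bullet> \<eta>) + \<theta>)\<bar>)"
    using \<delta> \<kappa>(2) by (simp add: abs_mult)
  also have "\<dots> \<le> \<delta> * (1 * 1)" using \<delta> \<kappa> by (intro mult_left_mono mult_mono) auto
  finally have "\<bar>- \<delta> * \<kappa> x * sin (N * (x \<bullet> \<eta>) + \<theta>)\<bar> \<le> \<delta>" by simp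
  from mult_right_mono[OF this, of "norm \<zeta> * norm \<eta>"]
  show n1: "norm ((- \<delta> * \<kappa> x * sin (N * (x \<bullet> \<eta>) + \<theta>)) *\<^sub>R outer_product \<zeta> \<eta>) \<le> \<delta> * (norm \<zeta> * norm \<eta>)"
    unfolding norm_scaleR norm_outer_product by simp
  show "norm (outer_product \<zeta> (gradient_vec (oscillation \<kappa> \<eta> \<delta> N \<theta>) x)) \<le> \<delta> * (norm \<zeta> * norm \<eta>) + \<delta> * R / N"
    unfolding e by (rule order_trans[OF norm_triangle_ineq add_mono[OF n1 n2]])
qed

lemma eventually_divide_le_at_top:
  fixes c b :: real assumes "b > 0" shows "\<forall>\<^sub>F N in at_top. c / N \<le> b"
  using eventually_ge_at_top[of "max 1 (c / b)"]
proof eventually_elim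
  case (elim N)
  then have "N > 0" "c / b \<le> N" by auto
  then show ?case using assms by (simp add: field_simps)
qed

locale projected_variation_energy = projected_variation \<Omega> V M P y0 \<rho> C L LP u G
  for \<Omega> V :: "(real^'d) set" and M :: "(real^'k) set" and P :: "real^'k \<Rightarrow> real^'k"
    and y0 :: "real^'k" and \<rho> C L LP :: real
    and u :: "real^'d \<Rightarrow> real^'k" and G :: "real^'d \<Rightarrow> real^'d^'k" +
  fixes F :: "real^'d \<Rightarrow> real^'k \<Rightarrow> real^'d^'k \<Rightarrow> real"
  assumes F: "continuous_on (closure \<Omega> \<times> M \<times> UNIV) (\<lambda>(x, v, A). F x v A)"
begin

lemma integrand_compact: "compact (closure \<Omega> \<times> M \<times> cball (0 :: real^'d^'k) D)"
  using \<Omega>(2) M by (intro compact_Times compact_cball) (simp_all add: compact_closure)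

lemma integrand_continuous: "continuous_on (closure \<Omega> \<times> M \<times> cball 0 D) (\<lambda>(x, v, A). F x v A)"
  by (rule continuous_on_subset[OF F]) auto

lemma integrand_bounded:
  "\<exists>B\<ge>0. \<forall>x\<in>\<Omega>. \<forall>v\<in>M. \<forall>A. norm A \<le> D \<longrightarrow> \<bar>F x v A\<bar> \<le> B"
proof -
  have "bounded ((\<lambda>(x, v, A). F x v A) ` (closure \<Omega> \<times> M \<times> cball 0 D))"
    by (rule compact_imp_bounded[OF compact_continuous_image[OF integrand_continuous integrand_compact]])
  then obtain B where B: "\<And>z. z \<in> (\<lambda>(x, v, A). F x v A) ` (closure \<Omega> \<times> M \<times> cball 0 D) \<Longrightarrow> norm z \<le> B"
    unfolding bounded_iff by blast
  have "\<bar>F x v A\<bar> \<le> max B 0" if "x \<in> \<Omega>" "v \<in> M" "norm A \<le> D" for x v A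
  proof -
    have "(x, v, A) \<in> closure \<Omega> \<times> M \<times> cball 0 D" using that closure_subset by auto
    then have "F x v A \<in> (\<lambda>(x, v, A). F x v A) ` (closure \<Omega> \<times> M \<times> cball 0 D)"
      by (rule rev_image_eqI) simp
    from B[OF this] show ?thesis by simp
  qed
  then show ?thesis by (intro exI[of _ "max B 0"]) auto
qed

text \<open>Joint continuity of \<open>F\<close> on the closed set \<open>closure \<Omega> \<times> M \<times> UNIV\<close> is what makes the integrand of a map with
  values in \<open>M\<close> measurable.\<close>

lemma integrand_measurable:
  assumes v: "v \<in> borel_measurable (lebesgue_on \<Omega>)" "\<And>x. x \<in> \<Omega> \<Longrightarrow> v x \<in> M"
    and H: "H \<in> borel_measurable (lebesgue_on \<Omega>)"
  shows "(\<lambda>x. F x (v x) (H x)) \<in> borel_measurable (lebesgue_on \<Omega>)"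
proof -
  have i: "(\<lambda>x. x) \<in> borel_measurable (lebesgue_on \<Omega>)"
    by (rule measurable_restrict_space1[OF measurable_completion]) simp
  have "(\<lambda>x. (\<lambda>(x, v, A). F x v A) (x, v x, H x)) \<in> borel_measurable (lebesgue_on \<Omega>)"
  proof (rule borel_measurable_continuous_on_compose[OF _ _ _ F])
    show "(\<lambda>x. (x, v x, H x)) \<in> borel_measurable (lebesgue_on \<Omega>)"
      by (intro borel_measurable_Pair i v(1) H)
    show "closed (closure \<Omega> \<times> M \<times> (UNIV :: (real^'d^'k) set))"
      using M by (intro closed_Times) (auto simp: compact_imp_closed)
    show "(x, v x, H x) \<in> closure \<Omega> \<times> M \<times> UNIV" if "x \<in> space (lebesgue_on \<Omega>)" for x
      using that v(2) closure_subset by auto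
  qed
  then show ?thesis by simp
qed

lemma integrand_integrable:
  assumes v: "v \<in> borel_measurable (lebesgue_on \<Omega>)" "\<And>x. x \<in> \<Omega> \<Longrightarrow> v x \<in> M"
    and H: "H \<in> borel_measurable (lebesgue_on \<Omega>)" "\<And>x. x \<in> \<Omega> \<Longrightarrow> norm (H x) \<le> D"
  shows "integrable (lebesgue_on \<Omega>) (\<lambda>x. F x (v x) (H x))"
proof -
  obtain B where B: "\<forall>x\<in>\<Omega>. \<forall>v\<in>M. \<forall>A. norm A \<le> D \<longrightarrow> \<bar>F x v A\<bar> \<le> B" using integrand_bounded by blast
  show ?thesis
    by (rule integrable_lebesgue_on_bounded[OF \<Omega> integrand_measurable[OF v H(1)], of B])
       (use B v(2) H(2) in \<open>auto simp: AE_lebesgue_on_iff[OF \<Omega>(1)]\<close>)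
qed

text \<open>The energy is defined through a chosen weak gradient; any other one gives the same value.\<close>

lemma energy_eq:
  assumes v: "v \<in> borel_measurable (lebesgue_on \<Omega>)" "\<And>x. x \<in> \<Omega> \<Longrightarrow> v x \<in> M"
    and H: "H \<in> borel_measurable (lebesgue_on \<Omega>)" and vH: "has_weak_gradient \<Omega> v H"
  shows "energy \<Omega> F v = (LINT x|lebesgue_on \<Omega>. F x (v x) (H x))"
proof -
  have ae: "AE x in lebesgue_on \<Omega>. weak_gradient \<Omega> v x = H x" by (rule weak_gradient_AE_eq[OF \<Omega>(1) vH])
  have "weak_gradient \<Omega> v \<in> borel_measurable (lebesgue_on \<Omega>)"
    by (rule borel_measurable_lebesgue_on_cong_AE[OF \<Omega>(1) _ H]) (use ae in \<open>auto elim: eventually_mono\<close>)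
  from integrand_measurable[OF v this] integrand_measurable[OF v H] ae show ?thesis
    unfolding energy_def by (intro integral_cong_AE) (auto elim: eventually_mono)
qed

lemma energy_cong_AE:
  assumes ae: "AE x in lebesgue_on \<Omega>. u x = v x"
  shows "energy \<Omega> F v = energy \<Omega> F u"
proof -
  have w: "weak_gradient \<Omega> v = weak_gradient \<Omega> u" using weak_gradient_cong_AE[OF \<Omega>(1) ae] by simp
  have "AE x in lebesgue_on \<Omega>. G x = weak_gradient \<Omega> u x"
    using weak_gradient_AE_eq[OF \<Omega>(1) u(3)] by eventually_elim simp
  note gm = borel_measurable_lebesgue_on_cong_AE[OF \<Omega>(1) this G(1)]
  have m: "(\<lambda>x. F x (u x) (weak_gradient \<Omega> u x)) \<in> borel_measurable (lebesgue_on \<Omega>)"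
    by (rule integrand_measurable[OF u(1,2) gm])
  have e: "AE x in lebesgue_on \<Omega>. F x (u x) (weak_gradient \<Omega> u x) = F x (v x) (weak_gradient \<Omega> u x)"
    using ae by eventually_elim simp
  show ?thesis unfolding energy_def w
    by (rule integral_cong_AE[OF borel_measurable_lebesgue_on_cong_AE[OF \<Omega>(1) e m] m])
       (use e in \<open>eventually_elim, simp\<close>)
qed

lemma jacobian_mult_modulus:
  assumes "e > 0"
  shows "\<exists>\<tau>>0. \<forall>y A y' A'. y \<in> cball y0 (2 * \<rho>) \<longrightarrow> norm A \<le> R \<longrightarrow>
      y' \<in> cball y0 (2 * \<rho>) \<longrightarrow> norm A' \<le> R \<longrightarrow> dist (y', A') (y, A) < \<tau> \<longrightarrow>
      dist (J y' ** (A' :: real^'d^'k)) (J y ** A) < e"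
proof -
  obtain \<tau> where \<tau>: "\<tau> > 0" "\<forall>p\<in>cball y0 (2 * \<rho>) \<times> cball 0 R. \<forall>p'\<in>cball y0 (2 * \<rho>) \<times> cball 0 R.
      dist p' p < \<tau> \<longrightarrow> dist (case p' of (y, A) \<Rightarrow> J y ** (A :: real^'d^'k)) (case p of (y, A) \<Rightarrow> J y ** A) < e"
    using jacobian_mult_uniformly_continuous[of R] assms unfolding uniformly_continuous_on_def by blast
  show ?thesis
  proof (intro exI[of _ \<tau>] conjI \<tau>(1) allI impI)
    fix y y' and A A' :: "real^'d^'k"
    assume a: "y \<in> cball y0 (2 * \<rho>)" "norm A \<le> R" "y' \<in> cball y0 (2 * \<rho>)" "norm A' \<le> R"
      "dist (y', A') (y, A) < \<tau>"
    have "(y, A) \<in> cball y0 (2 * \<rho>) \<times> cball 0 R" "(y', A') \<in> cball y0 (2 * \<rho>) \<times> cball 0 R"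
      using a by auto
    with \<tau>(2) a(5) have "dist (case (y', A') of (y, A) \<Rightarrow> J y ** (A :: real^'d^'k)) (case (y, A) of (y, A) \<Rightarrow> J y ** A) < e"
      by blast
    then show "dist (J y' ** A') (J y ** A) < e" by simp
  qed
qed

lemma integrand_modulus:
  assumes "\<mu> > 0"
  shows "\<exists>\<tau>>0. \<forall>x v A v' A'. x \<in> \<Omega> \<longrightarrow> v \<in> M \<longrightarrow> norm A \<le> D \<longrightarrow> v' \<in> M \<longrightarrow> norm A' \<le> D \<longrightarrow>
      dist (x, v', A') (x, v, A) < \<tau> \<longrightarrow> dist (F x v' A') (F x v A) < \<mu>"
proof -
  let ?f = "\<lambda>(x, v, A). F x v A"
  have "uniformly_continuous_on (closure \<Omega> \<times> M \<times> cball 0 D) ?f"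
    by (rule compact_uniformly_continuous[OF integrand_continuous integrand_compact])
  then obtain \<tau> where \<tau>: "\<tau> > 0" "\<forall>p\<in>closure \<Omega> \<times> M \<times> cball 0 D. \<forall>p'\<in>closure \<Omega> \<times> M \<times> cball 0 D.
      dist p' p < \<tau> \<longrightarrow> dist (?f p') (?f p) < \<mu>"
    using assms unfolding uniformly_continuous_on_def by blast
  show ?thesis
  proof (intro exI[of _ \<tau>] conjI \<tau>(1) allI impI)
    fix x v v' and A A' :: "real^'d^'k"
    assume a: "x \<in> \<Omega>" "v \<in> M" "norm A \<le> D" "v' \<in> M" "norm A' \<le> D" "dist (x, v', A') (x, v, A) < \<tau>"
    have "(x, v, A) \<in> closure \<Omega> \<times> M \<times> cball 0 D" "(x, v', A') \<in> closure \<Omega> \<times> M \<times> cball 0 D"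
      using a closure_subset by auto
    with \<tau>(2) a(6) have "dist (?f (x, v', A')) (?f (x, v, A)) < \<mu>" by blast
    then show "dist (F x v' A') (F x v A) < \<mu>" by simp
  qed
qed

text \<open>Weak minimality only allows small gradient perturbations. For amplitude below a threshold,
  all oscillations of high enough frequency are allowed, whatever the cutoff. The amplitude is not sent to
  \<open>0\<close> together with the wave length: the gain in energy has to be of a fixed size.\<close>

lemma small_oscillation:
  fixes \<zeta> :: "real^'k" and \<eta> :: "real^'d"
  assumes \<epsilon>: "\<epsilon> > 0"
  shows "\<exists>\<delta>0>0. \<delta>0 * (norm \<zeta> * norm \<eta>) \<le> 1 \<and> (\<forall>\<delta> \<kappa>. 0 < \<delta> \<longrightarrow> \<delta> \<le> \<delta>0 \<longrightarrow> test_function V \<kappa> \<longrightarrow>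
    (\<forall>x. 0 \<le> \<kappa> x \<and> \<kappa> x \<le> 1) \<longrightarrow> (\<forall>\<^sub>F N in at_top. \<forall>\<theta>. small_variation (oscillation \<kappa> \<eta> \<delta> N \<theta>) \<zeta> \<and>
      (\<forall>x. norm (outer_product \<zeta> (gradient_vec (oscillation \<kappa> \<eta> \<delta> N \<theta>) x)) \<le> 1) \<and>
      W1_norm \<Omega> \<infinity> (\<lambda>x. u x - competitor (oscillation \<kappa> \<eta> \<delta> N \<theta>) \<zeta> x) < ennreal \<epsilon>))"
proof -
  have LP0: "LP \<ge> 0" by (rule lipschitz_on_nonneg[OF P(1)])
  have \<epsilon>4: "\<epsilon> / 4 > 0" using \<epsilon> by simp
  obtain \<tau> where \<tau>: "\<tau> > 0" and uc: "\<And>y A y' A'. y \<in> cball y0 (2 * \<rho>) \<Longrightarrow> norm A \<le> C + 1 \<Longrightarrow>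
      y' \<in> cball y0 (2 * \<rho>) \<Longrightarrow> norm A' \<le> C + 1 \<Longrightarrow> dist (y', A') (y, A) < \<tau> \<Longrightarrow>
      dist (J y' ** (A' :: real^'d^'k)) (J y ** A) < \<epsilon> / 4"
    using jacobian_mult_modulus[OF \<epsilon>4] by blast
  define \<sigma> where "\<sigma> = min 1 (\<tau> / 2)"
  have \<sigma>: "\<sigma> > 0" "\<sigma> \<le> 1" "\<sigma> \<le> \<tau> / 2" using \<tau> by (auto simp: \<sigma>_def)
  define \<delta>0 where "\<delta>0 = \<sigma> / 2 / (norm \<zeta> * norm \<eta> + 1)"
  have nn: "norm \<zeta> * norm \<eta> + 1 > 0" by (simp add: add_nonneg_pos)
  have \<delta>0: "\<delta>0 > 0" using \<sigma> nn by (simp add: \<delta>0_def)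
  have \<delta>0n: "\<delta>0 * (norm \<zeta> * norm \<eta>) \<le> \<sigma> / 2"
  proof -
    have "\<delta>0 * (norm \<zeta> * norm \<eta>) \<le> \<delta>0 * (norm \<zeta> * norm \<eta> + 1)" using \<delta>0 by (intro mult_left_mono) auto
    also have "\<dots> = \<sigma> / 2"
    proof -
      have "a / b * b = a" if "b > 0" for a b :: real using that by simp
      then show ?thesis unfolding \<delta>0_def using nn by blast
    qed
    finally show ?thesis .
  qed
  define b where "b = min \<rho> (min (\<tau> / 4) (\<epsilon> / (4 * (LP + 1))))"
  have b: "b > 0" "b \<le> \<rho>" "b \<le> \<tau> / 4" "b \<le> \<epsilon> / (4 * (LP + 1))" 
  proof -
    have "\<epsilon> / (4 * (LP + 1)) > 0" using \<epsilon> LP0 by simp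
    then show "b > 0" "b \<le> \<rho>" "b \<le> \<tau> / 4" "b \<le> \<epsilon> / (4 * (LP + 1))"
      using \<rho>(1) \<tau> unfolding b_def by linarith+
  qed
  have LPb: "LP * b \<le> \<epsilon> / 4"
  proof -
    have "LP * b \<le> (LP + 1) * (\<epsilon> / (4 * (LP + 1)))" using LP0 b by (intro mult_mono) auto
    also have "\<dots> = \<epsilon> / 4"
    proof -
      have "b * (a / (4 * b)) = a / 4" if "b > 0" for a b :: real using that by simp
      moreover have "LP + 1 > 0" using LP0 by simp
      ultimately show ?thesis by blast
    qed
    finally show ?thesis .
  qed
  have "\<forall>\<^sub>F N in at_top. \<forall>\<theta>. small_variation (oscillation \<kappa> \<eta> \<delta> N \<theta>) \<zeta> \<and>
      (\<forall>x. norm (outer_product \<zeta> (gradient_vec (oscillation \<kappa> \<eta> \<delta> N \<theta>) x)) \<le> 1) \<and>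
      W1_norm \<Omega> \<infinity> (\<lambda>x. u x - competitor (oscillation \<kappa> \<eta> \<delta> N \<theta>) \<zeta> x) < ennreal \<epsilon>"
    if \<delta>: "0 < \<delta>" "\<delta> \<le> \<delta>0" and \<kappa>: "test_function V \<kappa>" "\<forall>x. 0 \<le> \<kappa> x \<and> \<kappa> x \<le> 1" for \<delta> \<kappa>
  proof -
    obtain R where R: "\<And>x. norm (outer_product \<zeta> (gradient_vec \<kappa> x)) \<le> R"
      using gradient_vec_bounded[OF \<kappa>(1)] by blast
    have \<sigma>2: "\<sigma> / 2 > 0" using \<sigma>(1) by simp
    show ?thesis
      using eventually_gt_at_top[of "0::real"] eventually_divide_le_at_top[OF b(1), of "\<delta> * norm \<zeta>"]
        eventually_divide_le_at_top[OF \<sigma>2, of "\<delta> * R"]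
    proof eventually_elim
      case (elim N)
      have N: "N > 0" "\<delta> * norm \<zeta> / N \<le> b" "\<delta> * R / N \<le> \<sigma> / 2" using elim \<sigma>(1) by auto
      show ?case
      proof (intro allI)
        fix \<theta>
        let ?\<psi> = "oscillation \<kappa> \<eta> \<delta> N \<theta>"
        note est = oscillation_estimates[OF \<kappa>(1) _ _ less_imp_le[OF \<delta>(1)] N(1) R]
        have w: "norm (?\<psi> x *\<^sub>R \<zeta>) \<le> b" for x 
          by (rule order_trans[OF est(1) N(2)]) (use \<kappa>(2) in auto)
        have \<delta>n: "\<delta> * (norm \<zeta> * norm \<eta>) \<le> \<sigma> / 2"
          using mult_right_mono[OF \<delta>(2), of "norm \<zeta> * norm \<eta>"] \<delta>0n by simp
        have o: "norm (outer_product \<zeta> (gradient_vec ?\<psi> x)) \<le> \<sigma>" for x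
        proof -
          have "norm (outer_product \<zeta> (gradient_vec ?\<psi> x)) \<le> \<delta> * (norm \<zeta> * norm \<eta>) + \<delta> * R / N"
            by (rule est(4)) (use \<kappa>(2) in auto)
          then show ?thesis using N(3) \<delta>n by linarith
        qed
        have s: "small_variation ?\<psi> \<zeta>"
          unfolding small_variation_def using test_function_oscillation[OF \<kappa>(1)] w b(2) order_trans by blast
        have o1: "\<forall>x. norm (outer_product \<zeta> (gradient_vec ?\<psi> x)) \<le> 1" using o \<sigma>(2) order_trans by blast
        have n1: "Lp_norm \<Omega> \<infinity> (\<lambda>x. u x - competitor ?\<psi> \<zeta> x) \<le> ennreal (\<epsilon> / 4)"
        proof (rule Lp_norm_infinity_le)
          show "(\<lambda>x. u x - competitor ?\<psi> \<zeta> x) \<in> borel_measurable (lebesgue_on \<Omega>)"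
            by (intro borel_measurable_diff u(1) competitor_measurable[OF s])
          have "norm (u x - competitor ?\<psi> \<zeta> x) \<le> \<epsilon> / 4" if x: "x \<in> \<Omega>" for x
          proof (cases "x \<in> V")
            case True
            have "dist (P (u x + 0)) (P (u x + ?\<psi> x *\<^sub>R \<zeta>)) \<le> LP * dist (u x + 0) (u x + ?\<psi> x *\<^sub>R \<zeta>)"
              using \<rho>(1) w[of x] b(2) by (intro lipschitz_onD[OF P(1)] variation_in_ball(2)[OF True]) auto
            also have "\<dots> \<le> LP * b" using w[of x] LP0 by (intro mult_left_mono) (auto simp: dist_norm)
            finally show ?thesis using LPb True P(5)[OF u(2)[OF x]] by (simp add: competitor_def dist_norm)
          qed (use \<epsilon> in \<open>simp add: competitor_def\<close>)
          then show "AE x in lebesgue_on \<Omega>. norm (u x - competitor ?\<psi> \<zeta> x) \<le> \<epsilon> / 4"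
            by (simp add: AE_lebesgue_on_iff[OF \<Omega>(1)])
        qed
        have n2: "Lp_norm \<Omega> \<infinity> (weak_gradient \<Omega> (\<lambda>x. u x - competitor ?\<psi> \<zeta> x)) \<le> ennreal (\<epsilon> / 4)"
        proof (rule Lp_norm_infinity_le)
          have ae: "AE x in lebesgue_on \<Omega>. weak_gradient \<Omega> (\<lambda>x. u x - competitor ?\<psi> \<zeta> x) x = G x - competitor_gradient ?\<psi> \<zeta> x"
            by (rule weak_gradient_AE_eq[OF \<Omega>(1) has_weak_gradient_competitor_minus[OF s]])
          show "weak_gradient \<Omega> (\<lambda>x. u x - competitor ?\<psi> \<zeta> x) \<in> borel_measurable (lebesgue_on \<Omega>)"
          proof (rule borel_measurable_lebesgue_on_cong_AE[OF \<Omega>(1)])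
            show "AE x in lebesgue_on \<Omega>. G x - competitor_gradient ?\<psi> \<zeta> x = weak_gradient \<Omega> (\<lambda>x. u x - competitor ?\<psi> \<zeta> x) x"
              using ae by eventually_elim simp
            show "(\<lambda>x. G x - competitor_gradient ?\<psi> \<zeta> x) \<in> borel_measurable (lebesgue_on \<Omega>)"
              by (intro borel_measurable_diff G(1) competitor_measurable[OF s])
          qed
          have "AE x in lebesgue_on \<Omega>. x \<in> \<Omega>" by (simp add: AE_lebesgue_on_iff[OF \<Omega>(1)])
          moreover have "AE x in lebesgue_on \<Omega>. x \<in> V \<longrightarrow> J (u x) ** G x = G x"
            using gradient_tangent unfolding AE_lebesgue_on_iff[OF \<Omega>(1)] by eventually_elim auto
          ultimately show "AE x in lebesgue_on \<Omega>. norm (weak_gradient \<Omega> (\<lambda>x. u x - competitor ?\<psi> \<zeta> x) x) \<le> \<epsilon> / 4"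
            using ae
          proof eventually_elim
            case (elim x)
            show ?case
            proof (cases "x \<in> V")
              case True
              have "dist (J (u x) ** G x) (J (u x + ?\<psi> x *\<^sub>R \<zeta>) ** (G x + outer_product \<zeta> (gradient_vec ?\<psi> x))) < \<epsilon> / 4"
              proof (rule uc)
                show "u x + ?\<psi> x *\<^sub>R \<zeta> \<in> cball y0 (2 * \<rho>)"
                  using variation_in_ball(1)[OF True order_trans[OF w b(2)]] .
                show "u x \<in> cball y0 (2 * \<rho>)" using variation_in_ball(1)[OF True, of 0] \<rho>(1) by simp
                show "norm (G x) \<le> C + 1" using G(2)[OF elim(1)] by simp
                show "norm (G x + outer_product \<zeta> (gradient_vec ?\<psi> x)) \<le> C + 1"
                  using G(2)[OF elim(1)] o1 by (intro order_trans[OF norm_triangle_ineq] add_mono) auto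
                have "dist (u x, G x) (u x + ?\<psi> x *\<^sub>R \<zeta>, G x + outer_product \<zeta> (gradient_vec ?\<psi> x)) \<le>
                    norm (?\<psi> x *\<^sub>R \<zeta>) + norm (outer_product \<zeta> (gradient_vec ?\<psi> x))"
                  unfolding dist_Pair_Pair by (rule order_trans[OF sqrt_sum_squares_le_sum]) (simp_all add: dist_norm)
                also have "\<dots> \<le> \<tau> / 4 + \<tau> / 2" using w[of x] b(3) o[of x] \<sigma>(3) by linarith
                also have "\<dots> < \<tau>" using \<tau> by simp
                finally show "dist (u x, G x) (u x + ?\<psi> x *\<^sub>R \<zeta>, G x + outer_product \<zeta> (gradient_vec ?\<psi> x)) < \<tau>" .
              qed
              then show ?thesis using elim True by (simp add: competitor_gradient_def dist_norm)
            next
              case False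
              then show ?thesis using elim \<epsilon> by (simp add: competitor_gradient_def)
            qed
          qed
        qed
        have "W1_norm \<Omega> \<infinity> (\<lambda>x. u x - competitor ?\<psi> \<zeta> x) \<le> ennreal (\<epsilon> / 4) + ennreal (\<epsilon> / 4)"
          unfolding W1_norm_def by (intro add_mono n1 n2)
        also have "\<dots> = ennreal (\<epsilon> / 2)" using \<epsilon> by (subst ennreal_plus[symmetric]) auto
        also have "\<dots> < ennreal \<epsilon>" using \<epsilon> by (simp add: ennreal_lessI)
        finally show "small_variation ?\<psi> \<zeta> \<and> (\<forall>x. norm (outer_product \<zeta> (gradient_vec ?\<psi> x)) \<le> 1) \<and>
            W1_norm \<Omega> \<infinity> (\<lambda>x. u x - competitor ?\<psi> \<zeta> x) < ennreal \<epsilon>"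
          using s o1 by blast
      qed
    qed
  qed
  moreover have "\<delta>0 * (norm \<zeta> * norm \<eta>) \<le> 1" using \<delta>0n \<sigma> by linarith
  ultimately show ?thesis using \<delta>0 by blast
qed

text \<open>The value outside \<open>V\<close>, where \<open>P\<close> need not be differentiable at \<open>u x\<close>, is chosen for measurability.\<close>

definition direction :: "real^'k \<Rightarrow> real^'d \<Rightarrow> real^'d \<Rightarrow> real^'d^'k" where
  "direction \<zeta> \<eta> x = (if x \<in> V then outer_product (J (u x) *v \<zeta>) \<eta> else 0)"

definition line_density :: "real^'k \<Rightarrow> real^'d \<Rightarrow> real^'d \<Rightarrow> real \<Rightarrow> real" where
  "line_density \<zeta> \<eta> x s = F x (u x) (G x + s *\<^sub>R direction \<zeta> \<eta> x)"

text \<open>Uniform continuity of \<open>F\<close> on compact sets gives convergence of the energy densities that is uniform in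
  \<open>x\<close>. Since the projection is tangential, \<open>J (u x) ** G x = G x\<close>, only the oscillating part of the gradient
  is changed by the derivative of \<open>P\<close>.\<close>

lemma oscillation_energy_density:
  fixes \<zeta> :: "real^'k" and \<eta> :: "real^'d"
  assumes \<delta>: "0 < \<delta>" "\<delta> * (norm \<zeta> * norm \<eta>) \<le> 1" and \<kappa>: "test_function V \<kappa>" "\<forall>x. 0 \<le> \<kappa> x \<and> \<kappa> x \<le> 1"
    and \<mu>: "\<mu> > 0"
  shows "\<forall>\<^sub>F N in at_top. \<forall>\<theta>. small_variation (oscillation \<kappa> \<eta> \<delta> N \<theta>) \<zeta> \<longrightarrow>
      (\<forall>x. norm (outer_product \<zeta> (gradient_vec (oscillation \<kappa> \<eta> \<delta> N \<theta>) x)) \<le> 1) \<longrightarrow>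
      (AE x in lebesgue. x \<in> V \<longrightarrow>
        \<bar>F x (competitor (oscillation \<kappa> \<eta> \<delta> N \<theta>) \<zeta> x) (competitor_gradient (oscillation \<kappa> \<eta> \<delta> N \<theta>) \<zeta> x) -
         line_density \<zeta> \<eta> x (- \<delta> * \<kappa> x * sin (N * (x \<bullet> \<eta>) + \<theta>))\<bar> < \<mu>)"
proof -
  have LP0: "LP \<ge> 0" by (rule lipschitz_on_nonneg[OF P(1)])
  obtain D where D: "\<And>y A. y \<in> cball y0 (2 * \<rho>) \<Longrightarrow> A \<in> cball 0 (C + 1) \<Longrightarrow> norm (J y ** (A :: real^'d^'k)) \<le> D"
    using jacobian_mult_bounded[of "C + 1"] by blast
  obtain \<tau>1 where \<tau>1: "\<tau>1 > 0" and ucF: "\<And>x v A v' A'. x \<in> \<Omega> \<Longrightarrow> v \<in> M \<Longrightarrow> norm A \<le> D \<Longrightarrow>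
      v' \<in> M \<Longrightarrow> norm A' \<le> D \<Longrightarrow> dist (x, v', A') (x, v, A) < \<tau>1 \<Longrightarrow> dist (F x v' A') (F x v A) < \<mu>"
    using integrand_modulus[OF \<mu>] by blast
  have \<tau>12: "\<tau>1 / 2 > 0" using \<tau>1 by simp
  obtain \<tau>2 where \<tau>2: "\<tau>2 > 0" and ucJ: "\<And>y A y' A'. y \<in> cball y0 (2 * \<rho>) \<Longrightarrow> norm A \<le> C + 1 \<Longrightarrow>
      y' \<in> cball y0 (2 * \<rho>) \<Longrightarrow> norm A' \<le> C + 1 \<Longrightarrow> dist (y', A') (y, A) < \<tau>2 \<Longrightarrow>
      dist (J y' ** (A' :: real^'d^'k)) (J y ** A) < \<tau>1 / 2"
    using jacobian_mult_modulus[OF \<tau>12] by blast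
  obtain R where R: "\<And>x. norm (outer_product \<zeta> (gradient_vec \<kappa> x)) \<le> R"
    using gradient_vec_bounded[OF \<kappa>(1)] by blast
  define b where "b = min \<rho> (min (\<tau>2 / 4) (\<tau>1 / (4 * (LP + 1))))"
  have b: "b > 0" "b \<le> \<rho>" "b \<le> \<tau>2 / 4" "b \<le> \<tau>1 / (4 * (LP + 1))" 
  proof -
    have "\<tau>1 / (4 * (LP + 1)) > 0" using \<tau>1 LP0 by simp
    then show "b > 0" "b \<le> \<rho>" "b \<le> \<tau>2 / 4" "b \<le> \<tau>1 / (4 * (LP + 1))"
      using \<rho>(1) \<tau>2 unfolding b_def by linarith+
  qed
  have LPb: "LP * b \<le> \<tau>1 / 4"
  proof -
    have "LP * b \<le> (LP + 1) * (\<tau>1 / (4 * (LP + 1)))" using LP0 b by (intro mult_mono) auto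
    also have "\<dots> = \<tau>1 / 4"
    proof -
      have "b * (a / (4 * b)) = a / 4" if "b > 0" for a b :: real using that by simp
      moreover have "LP + 1 > 0" using LP0 by simp
      ultimately show ?thesis by blast
    qed
    finally show ?thesis .
  qed
  have t4: "\<tau>2 / 4 > 0" using \<tau>2 by simp
  show ?thesis
    using eventually_gt_at_top[of "0::real"] eventually_divide_le_at_top[OF b(1), of "\<delta> * norm \<zeta>"]
      eventually_divide_le_at_top[OF t4, of "\<delta> * R"]
  proof eventually_elim
    case (elim N)
    show ?case
    proof (intro allI impI)
      fix \<theta>
      let ?\<psi> = "oscillation \<kappa> \<eta> \<delta> N \<theta>"
      assume s: "small_variation ?\<psi> \<zeta>" and o1: "\<forall>x. norm (outer_product \<zeta> (gradient_vec ?\<psi> x)) \<le> 1"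
      note est = oscillation_estimates[OF \<kappa>(1) _ _ less_imp_le[OF \<delta>(1)] elim(1) R]
      have w: "norm (?\<psi> x *\<^sub>R \<zeta>) \<le> b" for x 
        by (rule order_trans[OF est(1) elim(2)]) (use \<kappa>(2) in auto)
      show "AE x in lebesgue. x \<in> V \<longrightarrow> \<bar>F x (competitor ?\<psi> \<zeta> x) (competitor_gradient ?\<psi> \<zeta> x) -
         line_density \<zeta> \<eta> x (- \<delta> * \<kappa> x * sin (N * (x \<bullet> \<eta>) + \<theta>))\<bar> < \<mu>"
        using gradient_tangent
      proof eventually_elim
        case (elim x)
        show ?case
        proof
          assume x: "x \<in> V"
          then have x\<Omega>: "x \<in> \<Omega>" using V(2) by blast
          define a where "a = - \<delta> * \<kappa> x * sin (N * (x \<bullet> \<eta>) + \<theta>)"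
          define B where "B = G x + outer_product \<zeta> (gradient_vec ?\<psi> x)"
          define B' where "B' = G x + a *\<^sub>R outer_product \<zeta> \<eta>"
          have BB': "norm (B - B') \<le> \<tau>2 / 4"
          proof -
            have "B - B' = outer_product \<zeta> (gradient_vec ?\<psi> x) -
                (- \<delta> * \<kappa> x * sin (N * (x \<bullet> \<eta>) + \<theta>)) *\<^sub>R outer_product \<zeta> \<eta>"
              by (simp add: B_def B'_def a_def)
            also have "norm \<dots> \<le> \<delta> * R / N" by (rule est(2)) (use \<kappa>(2) in auto)
            also have "\<dots> \<le> \<tau>2 / 4" by fact
            finally show ?thesis .
          qed
          have nB: "norm B \<le> C + 1" unfolding B_def
            using G(2)[OF x\<Omega>] o1 by (intro order_trans[OF norm_triangle_ineq] add_mono) auto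
          have "norm (a *\<^sub>R outer_product \<zeta> \<eta>) \<le> 1"
          proof -
            have "norm (a *\<^sub>R outer_product \<zeta> \<eta>) \<le> \<delta> * (norm \<zeta> * norm \<eta>)"
              unfolding a_def by (rule est(3)) (use \<kappa>(2) in auto)
            then show ?thesis using \<delta>(2) by linarith
          qed
          then have nB': "norm B' \<le> C + 1" unfolding B'_def
            using G(2)[OF x\<Omega>] by (intro order_trans[OF norm_triangle_ineq] add_mono) auto
          have y: "u x + ?\<psi> x *\<^sub>R \<zeta> \<in> cball y0 (2 * \<rho>)" "u x \<in> cball y0 (2 * \<rho>)"
            using variation_in_ball(1)[OF x order_trans[OF w b(2)]] variation_in_ball(1)[OF x, of 0] \<rho>(1) by auto
          have T: "J (u x) ** B' = G x + a *\<^sub>R direction \<zeta> \<eta> x"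
            using elim x by (simp add: B'_def direction_def matrix_add_ldistrib
                outer_product_scaleR[symmetric] matrix_mult_outer_product)
          have "dist (u x + ?\<psi> x *\<^sub>R \<zeta>, B) (u x, B') \<le> norm (?\<psi> x *\<^sub>R \<zeta>) + norm (B - B')"
            unfolding dist_Pair_Pair by (rule order_trans[OF sqrt_sum_squares_le_sum]) (simp_all add: dist_norm)
          also have "\<dots> < \<tau>2" using w[of x] b(3) BB' \<tau>2 by linarith
          finally have dJ: "dist (J (u x + ?\<psi> x *\<^sub>R \<zeta>) ** B) (J (u x) ** B') < \<tau>1 / 2"
            by (intro ucJ y nB nB')
          have dP: "dist (P (u x + ?\<psi> x *\<^sub>R \<zeta>)) (u x) \<le> \<tau>1 / 4"
          proof -
            have "dist (P (u x + ?\<psi> x *\<^sub>R \<zeta>)) (P (u x + 0)) \<le> LP * dist (u x + ?\<psi> x *\<^sub>R \<zeta>) (u x + 0)"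
              using \<rho>(1) w[of x] b(2) by (intro lipschitz_onD[OF P(1)] variation_in_ball(2)[OF x]) auto
            also have "\<dots> \<le> LP * b" using w[of x] LP0 by (intro mult_left_mono) (auto simp: dist_norm)
            finally show ?thesis using LPb P(5)[OF u(2)[OF x\<Omega>]] by simp
          qed
          have "dist (x, P (u x + ?\<psi> x *\<^sub>R \<zeta>), J (u x + ?\<psi> x *\<^sub>R \<zeta>) ** B) (x, u x, J (u x) ** B') \<le>
              dist (P (u x + ?\<psi> x *\<^sub>R \<zeta>)) (u x) + dist (J (u x + ?\<psi> x *\<^sub>R \<zeta>) ** B) (J (u x) ** B')"
            unfolding dist_Pair_Pair by (simp add: sqrt_sum_squares_le_sum)
          also have "\<dots> < \<tau>1" using dP dJ \<tau>1 by linarith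
          finally have d: "dist (x, P (u x + ?\<psi> x *\<^sub>R \<zeta>), J (u x + ?\<psi> x *\<^sub>R \<zeta>) ** B) (x, u x, J (u x) ** B') < \<tau>1" .
          have "dist (F x (P (u x + ?\<psi> x *\<^sub>R \<zeta>)) (J (u x + ?\<psi> x *\<^sub>R \<zeta>) ** B)) (F x (u x) (J (u x) ** B')) < \<mu>"
          proof (rule ucF[OF x\<Omega> u(2)[OF x\<Omega>] _ _ _ d])
            show "norm (J (u x) ** B') \<le> D" using D[OF y(2)] nB' by simp
            show "norm (J (u x + ?\<psi> x *\<^sub>R \<zeta>) ** B) \<le> D" using D[OF y(1)] nB by simp
            show "P (u x + ?\<psi> x *\<^sub>R \<zeta>) \<in> M"
              using P(4) variation_in_ball(2)[OF x order_trans[OF w b(2)]] by blast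
          qed
          then show "\<bar>F x (competitor ?\<psi> \<zeta> x) (competitor_gradient ?\<psi> \<zeta> x) -
              line_density \<zeta> \<eta> x (- \<delta> * \<kappa> x * sin (N * (x \<bullet> \<eta>) + \<theta>))\<bar> < \<mu>"
            unfolding a_def[symmetric] line_density_def T[symmetric]
            using x by (simp add: competitor_def competitor_gradient_def B_def[symmetric] dist_real_def)
        qed
      qed
    qed
  qed
qed

section \<open>Legendre's condition\<close>

text \<open>The sum over the phases \<open>0\<close>, \<open>\<pi>/2\<close>, \<open>\<pi>\<close>, \<open>3\<pi>/2\<close> of the densities of the oscillating competitors, minus the
  unperturbed ones, at a point with \<open>y = N (x \<bullet> \<eta>)\<close>. Two opposite phases would not be enough, because the
  perturbation vanishes where \<open>sin y = 0\<close>; sine and cosine have no common zero.\<close>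

definition second_difference :: "real^'k \<Rightarrow> real^'d \<Rightarrow> real \<Rightarrow> real^'d \<Rightarrow> real \<Rightarrow> real" where
  "second_difference \<zeta> \<eta> \<delta> x y =
     line_density \<zeta> \<eta> x (\<delta> * sin y) + line_density \<zeta> \<eta> x (- \<delta> * sin y) +
     line_density \<zeta> \<eta> x (\<delta> * cos y) + line_density \<zeta> \<eta> x (- \<delta> * cos y) - 4 * line_density \<zeta> \<eta> x 0"

lemma sum_four_phases:
  "(\<Sum>j<4. line_density \<zeta> \<eta> x (- \<delta> * sin (y + real j * (pi / 2)))) - 4 * line_density \<zeta> \<eta> x 0 =
     second_difference \<zeta> \<eta> \<delta> x y"
proof -
  have s: "sin (y + pi / 2) = cos y" "sin (y + 2 * (pi / 2)) = - sin y" "sin (y + 3 * pi / 2) = - cos y"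
  proof -
    show 1: "sin (y + pi / 2) = cos y" by (simp add: sin_add)
    show "sin (y + 2 * (pi / 2)) = - sin y" by simp
    have "y + 3 * (pi / 2) = (y + pi / 2) + pi" by simp
    then show "sin (y + 3 * pi / 2) = - cos y" using 1 by (metis sin_periodic_pi times_divide_eq_right)
  qed
  have "(\<Sum>j<4. f j) = f 0 + f 1 + f 2 + f 3" for f :: "nat \<Rightarrow> real"
    by (simp add: eval_nat_numeral)
  then show ?thesis by (simp add: s second_difference_def del: mult_minus_left)
qed

lemma line_density_measurable:
  "(\<lambda>x. line_density \<zeta> \<eta> x s) \<in> borel_measurable (lebesgue_on \<Omega>)"
proof -
  have cu: "continuous_on V u" using lipschitz_on_continuous_on[OF L] .
  have "continuous_on V (\<lambda>x. J (u x))"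
    by (rule continuous_on_compose2[OF continuous_on_J cu]) (use \<rho> in force)
  then have "continuous_on V (\<lambda>x. outer_product (J (u x) *v \<zeta>) \<eta>)" by (intro continuous_intros)
  then have "direction \<zeta> \<eta> \<in> borel_measurable borel"
    unfolding direction_def[abs_def] using V(1)
    by (intro borel_measurable_continuous_on_if) (auto intro: continuous_on_const)
  then have "direction \<zeta> \<eta> \<in> borel_measurable (lebesgue_on \<Omega>)"
    by (intro measurable_restrict_space1 measurable_completion) simp
  then have "(\<lambda>x. G x + s *\<^sub>R direction \<zeta> \<eta> x) \<in> borel_measurable (lebesgue_on \<Omega>)"
    by (intro borel_measurable_add G(1) borel_measurable_scaleR borel_measurable_const)
  from integrand_measurable[OF u(1,2) this] show ?thesis unfolding line_density_def .
qed

lemma integral_lebesgue_on_indicator: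
  assumes "A \<in> lmeasurable" "A \<subseteq> \<Omega>"
  shows "integrable (lebesgue_on \<Omega>) (\<lambda>x. c * indicat_real A x)"
    and "(LINT x|lebesgue_on \<Omega>. c * indicat_real A x) = c * measure lebesgue A"
proof -
  have O: "\<Omega> \<inter> space lebesgue \<in> sets lebesgue" using \<Omega>(1) by simp
  have e: "(\<lambda>x. indicator \<Omega> x *\<^sub>R (c * indicat_real A x)) = (\<lambda>x. c * indicat_real A x)"
    using assms(2) by (auto simp: indicator_def fun_eq_iff)
  have i: "integrable lebesgue (\<lambda>x. c * indicat_real A x)"
    using assms(1) by (intro integrable_mult_right) (auto simp: fmeasurable_def)
  show "integrable (lebesgue_on \<Omega>) (\<lambda>x. c * indicat_real A x)"
    using i unfolding integrable_restrict_space[OF O] e .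
  show "(LINT x|lebesgue_on \<Omega>. c * indicat_real A x) = c * measure lebesgue A"
    unfolding integral_restrict_space[OF O] e by simp
qed

text \<open>On a compact set where the averaged second difference is uniformly negative, the four
  oscillating competitors together would have less than four times the energy of \<open>u\<close>. The cutoff is
  supported in a neighbourhood so tight that the loss there, only bounded by the supremum of \<open>F\<close>,
  is negligible.\<close>

lemma compact_negative_second_difference_null:
  assumes adm: "u \<in> admissible \<Omega> \<Gamma> M n\<^sub>0" and \<epsilon>: "\<epsilon> > 0"
    and min: "\<And>m. m \<in> admissible \<Omega> \<Gamma> M n\<^sub>0 \<Longrightarrow> W1_norm \<Omega> \<infinity> (\<lambda>x. u x - m x) < ennreal \<epsilon> \<Longrightarrow>
        energy \<Omega> F u \<le> energy \<Omega> F m"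
  shows "\<exists>\<delta>0>0. \<forall>\<delta> K c. 0 < \<delta> \<longrightarrow> \<delta> \<le> \<delta>0 \<longrightarrow> compact K \<longrightarrow> K \<subseteq> V \<longrightarrow> c > 0 \<longrightarrow>
     (\<forall>x\<in>K. \<forall>y. second_difference \<zeta> \<eta> \<delta> x y \<le> - c) \<longrightarrow> measure lebesgue K = 0"
proof -
  obtain \<delta>0 where \<delta>0: "\<delta>0 > 0" "\<delta>0 * (norm \<zeta> * norm \<eta>) \<le> 1" and
    small: "\<And>\<delta> \<kappa>. 0 < \<delta> \<Longrightarrow> \<delta> \<le> \<delta>0 \<Longrightarrow> test_function V \<kappa> \<Longrightarrow> \<forall>x. 0 \<le> \<kappa> x \<and> \<kappa> x \<le> 1 \<Longrightarrow>
      \<forall>\<^sub>F N in at_top. \<forall>\<theta>. small_variation (oscillation \<kappa> \<eta> \<delta> N \<theta>) \<zeta> \<and>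
      (\<forall>x. norm (outer_product \<zeta> (gradient_vec (oscillation \<kappa> \<eta> \<delta> N \<theta>) x)) \<le> 1) \<and>
      W1_norm \<Omega> \<infinity> (\<lambda>x. u x - competitor (oscillation \<kappa> \<eta> \<delta> N \<theta>) \<zeta> x) < ennreal \<epsilon>"
    using small_oscillation[OF \<epsilon>, of \<zeta> \<eta>] by blast
  obtain D0 where D0: "\<And>\<psi>. small_variation \<psi> \<zeta> \<Longrightarrow> \<forall>x. norm (outer_product \<zeta> (gradient_vec \<psi> x)) \<le> 1 \<Longrightarrow>
      \<forall>x\<in>\<Omega>. norm (competitor_gradient \<psi> \<zeta> x) \<le> D0"
    using competitor_gradient_bounded[of 1] by blast
  define D where "D = max C D0"
  obtain B where B: "B \<ge> 0" "\<And>x v A. x \<in> \<Omega> \<Longrightarrow> v \<in> M \<Longrightarrow> norm A \<le> D \<Longrightarrow> \<bar>F x v A\<bar> \<le> B"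
    using integrand_bounded[of D] by blast
  have "measure lebesgue K = 0" if \<delta>: "0 < \<delta>" "\<delta> \<le> \<delta>0" and K: "compact K" "K \<subseteq> V" and c: "c > 0"
      and neg: "\<forall>x\<in>K. \<forall>y. second_difference \<zeta> \<eta> \<delta> x y \<le> - c" for \<delta> K c
  proof (rule ccontr)
    assume "measure lebesgue K \<noteq> 0"
    then have mK: "measure lebesgue K > 0" using zero_less_measure_iff by blast
    have Kl: "K \<in> lmeasurable" using K(1) by (rule lmeasurable_compact)
    have K\<Omega>: "K \<subseteq> \<Omega>" using K(2) V(2) by blast
    \<comment> \<open>the loss near \<open>K\<close> is at most \<open>8 B \<tau> < c |K| / 4\<close>, against a gain of \<open>c |K| / 2\<close> on \<open>K\<close>\<close>
    define \<tau> where "\<tau> = c * measure lebesgue K / (4 * (8 * B + 1))"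
    have \<tau>: "\<tau> > 0" using c mK B(1) by (simp add: \<tau>_def)
    obtain T where T: "open T" "K \<subseteq> T" "T - K \<in> lmeasurable" "emeasure lebesgue (T - K) < ennreal \<tau>"
      using sets_lebesgue_outer_open[of K \<tau>] Kl \<tau> by (auto simp: fmeasurableD)
    define V' where "V' = T \<inter> V"
    have V': "open V'" "K \<subseteq> V'" "V' \<subseteq> V" using T V(1) K(2) by (auto simp: V'_def)
    have VK: "V' - K \<in> lmeasurable" "V' - K \<subseteq> \<Omega>" "measure lebesgue (V' - K) \<le> \<tau>"
    proof -
      have "V' \<in> lmeasurable" using V' V \<Omega>(2) by (meson bounded_subset lmeasurable_open)
      then show l: "V' - K \<in> lmeasurable" using Kl by (intro fmeasurable.Diff) (auto simp: fmeasurableD)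
      show "V' - K \<subseteq> \<Omega>" using V'(3) V(2) by blast
      have "measure lebesgue (V' - K) \<le> measure lebesgue (T - K)"
        using l T(3) by (intro measure_mono_fmeasurable) (auto simp: V'_def fmeasurableD)
      also have "\<dots> \<le> \<tau>" using T(3,4) \<tau> by (simp add: emeasure_eq_measure2 ennreal_less_iff)
      finally show "measure lebesgue (V' - K) \<le> \<tau>" .
    qed
    obtain \<kappa> W where \<kappa>': "test_function V' \<kappa>" and \<kappa>01: "\<forall>x. 0 \<le> \<kappa> x \<and> \<kappa> x \<le> 1" and W: "K \<subseteq> W" "\<forall>x\<in>W. \<kappa> x = 1"
      using smooth_urysohn[OF K(1) V'(1,2)] by blast
    have \<kappa>: "test_function V \<kappa>" by (rule test_function_mono[OF \<kappa>' V'(3)])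
    have \<delta>n: "\<delta> * (norm \<zeta> * norm \<eta>) \<le> 1"
      using mult_right_mono[OF \<delta>(2), of "norm \<zeta> * norm \<eta>"] \<delta>0(2) by simp
    \<comment> \<open>four errors \<open>\<mu>\<close> use up half of the gain \<open>c\<close>\<close>
    define \<mu> where "\<mu> = c / 8"
    have \<mu>: "\<mu> > 0" using c by (simp add: \<mu>_def)
    have "\<exists>N>0. (\<forall>\<theta>. small_variation (oscillation \<kappa> \<eta> \<delta> N \<theta>) \<zeta> \<and>
      (\<forall>x. norm (outer_product \<zeta> (gradient_vec (oscillation \<kappa> \<eta> \<delta> N \<theta>) x)) \<le> 1) \<and>
      W1_norm \<Omega> \<infinity> (\<lambda>x. u x - competitor (oscillation \<kappa> \<eta> \<delta> N \<theta>) \<zeta> x) < ennreal \<epsilon>) \<and>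
      (\<forall>\<theta>. small_variation (oscillation \<kappa> \<eta> \<delta> N \<theta>) \<zeta> \<longrightarrow>
      (\<forall>x. norm (outer_product \<zeta> (gradient_vec (oscillation \<kappa> \<eta> \<delta> N \<theta>) x)) \<le> 1) \<longrightarrow>
      (AE x in lebesgue. x \<in> V \<longrightarrow>
        \<bar>F x (competitor (oscillation \<kappa> \<eta> \<delta> N \<theta>) \<zeta> x) (competitor_gradient (oscillation \<kappa> \<eta> \<delta> N \<theta>) \<zeta> x) -
         line_density \<zeta> \<eta> x (- \<delta> * \<kappa> x * sin (N * (x \<bullet> \<eta>) + \<theta>))\<bar> < \<mu>))"
      using eventually_happens'[OF trivial_limit_at_top_linorder
          eventually_conj[OF eventually_gt_at_top[of "0::real"]
            eventually_conj[OF small[OF \<delta> \<kappa> \<kappa>01] oscillation_energy_density[OF \<delta>(1) \<delta>n \<kappa> \<kappa>01 \<mu>]]]] .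
    then obtain N :: real where N: "N > 0"
      and sv: "\<And>\<theta>. small_variation (oscillation \<kappa> \<eta> \<delta> N \<theta>) \<zeta>"
      and o1: "\<And>\<theta>. \<forall>x. norm (outer_product \<zeta> (gradient_vec (oscillation \<kappa> \<eta> \<delta> N \<theta>) x)) \<le> 1"
      and nrm: "\<And>\<theta>. W1_norm \<Omega> \<infinity> (\<lambda>x. u x - competitor (oscillation \<kappa> \<eta> \<delta> N \<theta>) \<zeta> x) < ennreal \<epsilon>"
      and dens: "\<And>\<theta>. AE x in lebesgue. x \<in> V \<longrightarrow>
        \<bar>F x (competitor (oscillation \<kappa> \<eta> \<delta> N \<theta>) \<zeta> x) (competitor_gradient (oscillation \<kappa> \<eta> \<delta> N \<theta>) \<zeta> x) -
         line_density \<zeta> \<eta> x (- \<delta> * \<kappa> x * sin (N * (x \<bullet> \<eta>) + \<theta>))\<bar> < \<mu>"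
      by blast
    define \<psi> where "\<psi> j = oscillation \<kappa> \<eta> \<delta> N (real j * (pi / 2))" for j :: nat
    define E where "E j x = F x (competitor (\<psi> j) \<zeta> x) (competitor_gradient (\<psi> j) \<zeta> x)" for j x
    define E0 where "E0 x = F x (u x) (G x)" for x
    have GD: "norm (G x) \<le> D" if "x \<in> \<Omega>" for x using G(2)[OF that] by (simp add: D_def)
    have HD: "norm (competitor_gradient (\<psi> j) \<zeta> x) \<le> D" if "x \<in> \<Omega>" for j x
      using D0[OF sv o1] that unfolding \<psi>_def D_def by (meson max.coboundedI2)
    have iE: "integrable (lebesgue_on \<Omega>) (E j)" for j
      unfolding E_def[abs_def]
      by (rule integrand_integrable[OF competitor_measurable(1) competitor_in_M competitor_measurable(2) HD])
         (simp_all add: \<psi>_def sv)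
    have iE0: "integrable (lebesgue_on \<Omega>) E0"
      unfolding E0_def[abs_def] by (rule integrand_integrable[OF u(1,2) G(1) GD])
    have le: "(LINT x|lebesgue_on \<Omega>. E0 x) \<le> (LINT x|lebesgue_on \<Omega>. E j x)" for j
    proof -
      have "energy \<Omega> F u \<le> energy \<Omega> F (competitor (\<psi> j) \<zeta>)"
        unfolding \<psi>_def by (rule min[OF competitor_admissible[OF sv adm] nrm])
      moreover have "energy \<Omega> F (competitor (\<psi> j) \<zeta>) = (LINT x|lebesgue_on \<Omega>. E j x)"
        unfolding E_def \<psi>_def
        by (rule energy_eq[OF competitor_measurable(1)[OF sv] competitor_in_M[OF sv] competitor_measurable(2)[OF sv]
              has_weak_gradient_competitor[OF sv]])
      moreover have "energy \<Omega> F u = (LINT x|lebesgue_on \<Omega>. E0 x)"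
        unfolding E0_def by (rule energy_eq[OF u(1,2) G(1) u(3)])
      ultimately show ?thesis by simp
    qed
    define e where "e x = (\<Sum>j<4. E j x) - 4 * E0 x" for x
    have ie: "integrable (lebesgue_on \<Omega>) e" unfolding e_def[abs_def] using iE iE0 by simp
    have "0 \<le> (\<Sum>j<4. (LINT x|lebesgue_on \<Omega>. E j x)) - 4 * (LINT x|lebesgue_on \<Omega>. E0 x)"
      using sum_mono[of "{..<4::nat}" "\<lambda>_. LINT x|lebesgue_on \<Omega>. E0 x" "\<lambda>j. LINT x|lebesgue_on \<Omega>. E j x"] le by simp
    also have "\<dots> = (LINT x|lebesgue_on \<Omega>. e x)" unfolding e_def using iE iE0 by simp
    also have "\<dots> \<le> (LINT x|lebesgue_on \<Omega>. (8 * B) * indicat_real (V' - K) x + (- c / 2) * indicat_real K x)"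
    proof (rule integral_mono_AE[OF ie])
      show "integrable (lebesgue_on \<Omega>) (\<lambda>x. (8 * B) * indicat_real (V' - K) x + (- c / 2) * indicat_real K x)"
        using integral_lebesgue_on_indicator(1)[OF VK(1,2), of "8 * B"]
          integral_lebesgue_on_indicator(1)[OF Kl, of "- c / 2"] K(2) V(2) by simp
      have dens4: "AE x in lebesgue. \<forall>j. x \<in> V \<longrightarrow>
          \<bar>E j x - line_density \<zeta> \<eta> x (- \<delta> * \<kappa> x * sin (N * (x \<bullet> \<eta>) + real j * (pi / 2)))\<bar> < \<mu>"
        unfolding AE_all_countable E_def \<psi>_def using dens by blast
      have off4: "AE x in lebesgue. \<forall>j. x \<in> \<Omega> - V' \<longrightarrow> competitor_gradient (\<psi> j) \<zeta> x = G x \<and> competitor (\<psi> j) \<zeta> x = u x"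
        unfolding AE_all_countable
      proof
        fix j
        have t: "test_function V' (\<psi> j)" unfolding \<psi>_def by (rule test_function_oscillation[OF \<kappa>'])
        obtain S where S: "compact S" "S \<subseteq> V'" "\<And>x. x \<notin> S \<Longrightarrow> \<psi> j x = 0 \<and> (\<forall>v. frechet_derivative (\<psi> j) (at x) v = 0)"
          using test_function_support[OF t] by blast
        have "AE x in lebesgue. x \<in> \<Omega> - S \<longrightarrow> competitor_gradient (\<psi> j) \<zeta> x = G x"
          by (rule competitor_gradient_off_support[OF test_function_mono[OF t V'(3)] S(1)])
             (use S V'(3) in blast)+
        then show "AE x in lebesgue. x \<in> \<Omega> - V' \<longrightarrow> competitor_gradient (\<psi> j) \<zeta> x = G x \<and> competitor (\<psi> j) \<zeta> x = u x"
        proof eventually_elim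
          case (elim x)
          show ?case
          proof
            assume x: "x \<in> \<Omega> - V'"
            then have "x \<notin> S" using S(2) by blast
            then show "competitor_gradient (\<psi> j) \<zeta> x = G x \<and> competitor (\<psi> j) \<zeta> x = u x"
              using elim x S(3)[of x] P(5)[OF u(2)[of x]] by (simp add: competitor_def)
          qed
        qed
      qed
      show "AE x in lebesgue_on \<Omega>. e x \<le> (8 * B) * indicat_real (V' - K) x + (- c / 2) * indicat_real K x"
        unfolding AE_lebesgue_on_iff[OF \<Omega>(1)] using dens4 off4
      proof eventually_elim
        case (elim x)
        show ?case
        proof
          assume x: "x \<in> \<Omega>"
          have E0B: "\<bar>E0 x\<bar> \<le> B" unfolding E0_def by (rule B(2)[OF x u(2)[OF x] GD[OF x]])
          have EB: "\<bar>E j x\<bar> \<le> B" for j unfolding E_def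
            by (rule B(2)[OF x competitor_in_M HD[OF x]]) (simp_all add: \<psi>_def sv x)
          consider "x \<in> K" | "x \<in> V' - K" | "x \<notin> V'" using V'(2) by blast
          then show "e x \<le> (8 * B) * indicat_real (V' - K) x + (- c / 2) * indicat_real K x"
          proof cases
            case 1
            have xV: "x \<in> V" using 1 K(2) by blast
            have k1: "\<kappa> x = 1" using 1 W by blast
            have "(\<Sum>j<4. E j x) \<le> (\<Sum>j<4. line_density \<zeta> \<eta> x (- \<delta> * sin (N * (x \<bullet> \<eta>) + real j * (pi / 2))) + \<mu>)"
            proof (rule sum_mono)
              fix j
              have "\<bar>E j x - line_density \<zeta> \<eta> x (- \<delta> * \<kappa> x * sin (N * (x \<bullet> \<eta>) + real j * (pi / 2)))\<bar> < \<mu>"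
                using elim(1) xV by blast
              then show "E j x \<le> line_density \<zeta> \<eta> x (- \<delta> * sin (N * (x \<bullet> \<eta>) + real j * (pi / 2))) + \<mu>"
                unfolding k1 by simp
            qed
            also have "\<dots> = second_difference \<zeta> \<eta> \<delta> x (N * (x \<bullet> \<eta>)) + 4 * E0 x + 4 * \<mu>"
              unfolding sum.distrib sum_four_phases[of \<zeta> \<eta> x \<delta> "N * (x \<bullet> \<eta>)", symmetric]
              by (simp add: E0_def line_density_def)
            also have "\<dots> \<le> - c + 4 * E0 x + 4 * \<mu>" using neg 1 by simp
            finally show ?thesis using 1 by (simp add: e_def \<mu>_def)
          next
            case 2
            have "(\<Sum>j<4. E j x) \<le> (\<Sum>j<(4::nat). B)" by (rule sum_mono) (use EB abs_le_D1 in blast)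
            then have "e x \<le> 8 * B" using E0B by (simp add: e_def)
            then show ?thesis using 2 by simp
          next
            case 3
            have "E j x = E0 x" for j using elim(2) x 3 by (simp add: E_def E0_def)
            then have "e x = 0" by (simp add: e_def)
            then show ?thesis using 3 V'(2) by (auto simp: indicator_def)
          qed
        qed
      qed
    qed
    also have "\<dots> = (8 * B) * measure lebesgue (V' - K) + (- c / 2) * measure lebesgue K"
      by (simp only: Bochner_Integration.integral_add[OF integral_lebesgue_on_indicator(1)[OF VK(1,2)]
            integral_lebesgue_on_indicator(1)[OF Kl K\<Omega>]]
          integral_lebesgue_on_indicator(2)[OF VK(1,2)] integral_lebesgue_on_indicator(2)[OF Kl K\<Omega>])
    also have "\<dots> \<le> (8 * B) * \<tau> + (- c / 2) * measure lebesgue K"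
      using VK(3) B(1) by (intro add_right_mono mult_left_mono) auto
    also have "(8 * B) * \<tau> \<le> (8 * B + 1) * \<tau>" using \<tau> by simp
    also have "(8 * B + 1) * \<tau> = c * measure lebesgue K / 4"
    proof -
      have "b * (a / (4 * b)) = a / 4" if "b > 0" for a b :: real using that by simp
      moreover have "8 * B + 1 > 0" using B(1) by simp
      ultimately show ?thesis unfolding \<tau>_def by blast
    qed
    finally have "c * measure lebesgue K \<le> 0" by simp
    then show False using c mK by (simp add: mult_le_0_iff)
  qed
  then show ?thesis using \<delta>0(1) by blast
qed

lemma line_density_continuous:
  assumes x: "x \<in> \<Omega>" shows "continuous_on S (line_density \<zeta> \<eta> x)"
proof -
  have "continuous_on UNIV (\<lambda>s. (\<lambda>(x, v, A). F x v A) (x, u x, G x + s *\<^sub>R direction \<zeta> \<eta> x))"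
    by (rule continuous_on_compose2[OF F])
       (use x u(2)[OF x] closure_subset in \<open>auto intro!: continuous_intros\<close>)
  then show ?thesis unfolding line_density_def[abs_def] by (auto intro: continuous_on_subset)
qed

lemma second_difference_continuous:
  assumes x: "x \<in> \<Omega>" shows "continuous_on S (second_difference \<zeta> \<eta> \<delta> x)"
  unfolding second_difference_def[abs_def]
  by (intro continuous_on_add continuous_on_diff continuous_on_const
      continuous_on_compose2[OF line_density_continuous[OF x, of UNIV]] continuous_intros) auto

text \<open>The exceptional set is measurable, since by continuity in \<open>y\<close> rational \<open>y\<close> suffice; if it were
  not null, it would contain a compact set of positive measure.\<close>

lemma second_difference_AE:
  assumes adm: "u \<in> admissible \<Omega> \<Gamma> M n\<^sub>0" and \<epsilon>: "\<epsilon> > 0"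
    and min: "\<And>m. m \<in> admissible \<Omega> \<Gamma> M n\<^sub>0 \<Longrightarrow> W1_norm \<Omega> \<infinity> (\<lambda>x. u x - m x) < ennreal \<epsilon> \<Longrightarrow>
        energy \<Omega> F u \<le> energy \<Omega> F m"
  shows "\<exists>\<delta>0>0. \<forall>\<delta> c. 0 < \<delta> \<longrightarrow> \<delta> \<le> \<delta>0 \<longrightarrow> c > 0 \<longrightarrow>
     (AE x in lebesgue. x \<in> V \<longrightarrow> (\<exists>y. second_difference \<zeta> \<eta> \<delta> x y > - c))"
proof -
  obtain \<delta>0 where \<delta>0: "\<delta>0 > 0" "\<And>\<delta> K c. 0 < \<delta> \<Longrightarrow> \<delta> \<le> \<delta>0 \<Longrightarrow> compact K \<Longrightarrow> K \<subseteq> V \<Longrightarrow> c > 0 \<Longrightarrow>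
     \<forall>x\<in>K. \<forall>y. second_difference \<zeta> \<eta> \<delta> x y \<le> - c \<Longrightarrow> measure lebesgue K = 0"
    using compact_negative_second_difference_null[OF adm \<epsilon> min, of \<zeta> \<eta>] by blast
  have "AE x in lebesgue. x \<in> V \<longrightarrow> (\<exists>y. second_difference \<zeta> \<eta> \<delta> x y > - c)"
    if \<delta>: "0 < \<delta>" "\<delta> \<le> \<delta>0" and c: "c > 0" for \<delta> c
  proof -
    define N where "N = {x\<in>V. \<forall>y. second_difference \<zeta> \<eta> \<delta> x y \<le> - c}"
    have closed: "second_difference \<zeta> \<eta> \<delta> x y \<le> - c"
      if x: "x \<in> \<Omega>" and q: "\<forall>q::rat. second_difference \<zeta> \<eta> \<delta> x (of_rat q) \<le> - c" for x y
    proof -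
      have "closed {y. second_difference \<zeta> \<eta> \<delta> x y \<le> - c}"
        by (intro closed_Collect_le second_difference_continuous[OF x] continuous_on_const)
      moreover have "\<rat> \<subseteq> {y. second_difference \<zeta> \<eta> \<delta> x y \<le> - c}" using q by (auto simp: Rats_def)
      ultimately have "closure \<rat> \<subseteq> {y. second_difference \<zeta> \<eta> \<delta> x y \<le> - c}" by (rule closure_minimal[rotated])
      then show ?thesis by (auto simp: Rats_closure_real)
    qed
    have Neq: "N = (\<Inter>q::rat. {x \<in> space (lebesgue_on \<Omega>). second_difference \<zeta> \<eta> \<delta> x (of_rat q) \<le> - c}) \<inter> V"
      using V(2) closed by (auto simp: N_def)
    have sm: "(\<lambda>x. second_difference \<zeta> \<eta> \<delta> x y) \<in> borel_measurable (lebesgue_on \<Omega>)" for y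
      unfolding second_difference_def
      by (intro borel_measurable_add borel_measurable_diff borel_measurable_times borel_measurable_const line_density_measurable)
    have "{x \<in> space (lebesgue_on \<Omega>). second_difference \<zeta> \<eta> \<delta> x y \<le> - c} \<in> sets (lebesgue_on \<Omega>)" for y
      by (rule borel_measurable_le[OF sm borel_measurable_const])
    then have "(\<Inter>q::rat. {x \<in> space (lebesgue_on \<Omega>). second_difference \<zeta> \<eta> \<delta> x (of_rat q) \<le> - c}) \<in> sets (lebesgue_on \<Omega>)"
      by (intro sets.countable_INT) auto
    then have "(\<Inter>q::rat. {x \<in> space (lebesgue_on \<Omega>). second_difference \<zeta> \<eta> \<delta> x (of_rat q) \<le> - c}) \<in> sets lebesgue"
      using \<Omega>(1) by (simp add: sets_restrict_space_iff)
    then have Ns: "N \<in> sets lebesgue" unfolding Neq using V(1) by (intro sets.Int) auto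
    have "negligible N"
    proof (rule ccontr)
      assume n: "\<not> negligible N"
      have "bounded N" using V(2) \<Omega>(2) by (rule_tac bounded_subset[of \<Omega>]) (auto simp: N_def)
      from not_null_imp_compact_subset[OF Ns this n] obtain K where
        K: "compact K" "K \<subseteq> N" "0 < measure lebesgue K" by blast
      have "measure lebesgue K = 0"
        by (rule \<delta>0(2)[OF \<delta> K(1) _ c]) (use K(2) in \<open>auto simp: N_def\<close>)
      with K(3) show False by simp
    qed
    then have "N \<in> null_sets lebesgue" by (simp add: negligible_iff_null_sets)
    then show ?thesis by (rule AE_I') (auto simp: N_def not_less)
  qed
  with \<delta>0(1) show ?thesis by blast
qed

text \<open>By periodicity and compactness, negativity for all \<open>y\<close> is uniform.\<close>

lemma second_difference_negative_uniform:
  assumes x: "x \<in> \<Omega>" and s0: "\<And>s. s \<noteq> 0 \<Longrightarrow> \<bar>s\<bar> < s0 \<Longrightarrow> line_density \<zeta> \<eta> x s + line_density \<zeta> \<eta> x (- s) < 2 * line_density \<zeta> \<eta> x 0"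
    and \<delta>: "0 < \<delta>" "\<delta> < s0"
  shows "\<exists>c>0. \<forall>y. second_difference \<zeta> \<eta> \<delta> x y \<le> - c"
proof -
  let ?l = "line_density \<zeta> \<eta> x"
  have le: "?l (\<delta> * a) + ?l (- \<delta> * a) \<le> 2 * ?l 0" "a \<noteq> 0 \<Longrightarrow> ?l (\<delta> * a) + ?l (- \<delta> * a) < 2 * ?l 0"
    if "\<bar>a\<bar> \<le> 1" for a
  proof -
    have "\<bar>\<delta> * a\<bar> \<le> \<delta>" using that \<delta> by (simp add: abs_mult mult_left_le)
    then have "\<bar>\<delta> * a\<bar> < s0" using \<delta> by simp
    then show lt: "?l (\<delta> * a) + ?l (- \<delta> * a) < 2 * ?l 0" if "a \<noteq> 0" using s0[of "\<delta> * a"] that \<delta> by simp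
    show "?l (\<delta> * a) + ?l (- \<delta> * a) \<le> 2 * ?l 0" using lt by (cases "a = 0") auto
  qed
  have neg: "second_difference \<zeta> \<eta> \<delta> x y < 0" for y
  proof (cases "sin y = 0")
    case True
    then have "cos y \<noteq> 0" using sin_zero_abs_cos_one by force
    then show ?thesis using le(2)[of "cos y"] le(1)[of "sin y"] unfolding second_difference_def by simp
  next
    case False
    then show ?thesis using le(2)[of "sin y"] le(1)[of "cos y"] unfolding second_difference_def by simp
  qed
  have "\<exists>y0\<in>{0..2 * pi}. \<forall>y\<in>{0..2 * pi}. second_difference \<zeta> \<eta> \<delta> x y \<le> second_difference \<zeta> \<eta> \<delta> x y0"
    by (rule continuous_attains_sup[OF compact_Icc _ second_difference_continuous[OF x]]) simp
  then obtain y0 where y0: "\<And>y. y \<in> {0..2 * pi} \<Longrightarrow> second_difference \<zeta> \<eta> \<delta> x y \<le> second_difference \<zeta> \<eta> \<delta> x y0" by blast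
  have "second_difference \<zeta> \<eta> \<delta> x y \<le> second_difference \<zeta> \<eta> \<delta> x y0" for y
  proof -
    obtain t where t: "0 \<le> t" "t \<le> 2 * pi" "cos y = cos t" "sin y = sin t"
      using sincos_total_2pi_le[of "cos y" "sin y"] by auto
    then have "second_difference \<zeta> \<eta> \<delta> x y = second_difference \<zeta> \<eta> \<delta> x t" by (simp add: second_difference_def)
    then show ?thesis using y0[of t] t by simp
  qed
  then show ?thesis using neg[of y0] by (intro exI[of _ "- second_difference \<zeta> \<eta> \<delta> x y0"]) auto
qed

text \<open>If the form is negative at \<open>x\<close>, then so are the second differences with all small amplitudes, uniformly in \<open>y\<close>.
  It is enough to exclude this for countably many amplitudes and bounds.\<close>

lemma legendre_fixed_direction:
  assumes adm: "u \<in> admissible \<Omega> \<Gamma> M n\<^sub>0" and \<epsilon>: "\<epsilon> > 0"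
    and min: "\<And>m. m \<in> admissible \<Omega> \<Gamma> M n\<^sub>0 \<Longrightarrow> W1_norm \<Omega> \<infinity> (\<lambda>x. u x - m x) < ennreal \<epsilon> \<Longrightarrow>
        energy \<Omega> F u \<le> energy \<Omega> F m"
    and O: "open O'" "M \<subseteq> O'" and C2: "\<And>x. x \<in> \<Omega> \<Longrightarrow> Ck_on 2 (\<lambda>(v, A). F x v A) (O' \<times> UNIV)"
  shows "AE x in lebesgue. x \<in> V \<longrightarrow> 0 \<le>
    (\<Sum>i\<in>UNIV. \<Sum>r\<in>UNIV. \<Sum>j\<in>UNIV. \<Sum>l\<in>UNIV.
       entry_deriv i j (entry_deriv r l (F x (u x))) (G x) * \<eta> $ j * \<eta> $ l *
       (jacobian P (at (u x)) *v \<zeta>) $ i * (jacobian P (at (u x)) *v \<zeta>) $ r)"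
proof -
  obtain \<delta>0 where \<delta>0: "\<delta>0 > 0" "\<And>\<delta> c. 0 < \<delta> \<Longrightarrow> \<delta> \<le> \<delta>0 \<Longrightarrow> c > 0 \<Longrightarrow>
     AE x in lebesgue. x \<in> V \<longrightarrow> (\<exists>y. second_difference \<zeta> \<eta> \<delta> x y > - c)"
    using second_difference_AE[OF adm \<epsilon> min, of \<zeta> \<eta>] by blast
  have "AE x in lebesgue. \<forall>j q. x \<in> V \<longrightarrow> (\<exists>y. second_difference \<zeta> \<eta> (\<delta>0 / real (Suc j)) x y > - (1 / real (Suc q)))"
    unfolding AE_all_countable
    by (intro allI \<delta>0(2)) (use \<delta>0(1) in \<open>auto simp: divide_le_eq\<close>)
  then show ?thesis
  proof eventually_elim
    case (elim x)
    show ?case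
    proof (intro impI, rule ccontr)
      assume xV: "x \<in> V"
      then have x: "x \<in> \<Omega>" using V(2) by blast
      let ?Q = "\<Sum>i\<in>UNIV. \<Sum>r\<in>UNIV. \<Sum>j\<in>UNIV. \<Sum>l\<in>UNIV.
         entry_deriv i j (entry_deriv r l (F x (u x))) (G x) * \<eta> $ j * \<eta> $ l *
         (jacobian P (at (u x)) *v \<zeta>) $ i * (jacobian P (at (u x)) *v \<zeta>) $ r"
      assume "\<not> 0 \<le> ?Q"
      then have Q: "?Q < 0" by simp
      have uO: "u x \<in> O'" using u(2)[OF x] O(2) by blast
      from second_derivative_rank_one[OF O(1) uO C2[OF x], of "G x" "jacobian P (at (u x)) *v \<zeta>" \<eta>]
      obtain q1 where q1: "\<And>s. ((\<lambda>t. F x (u x) (G x + t *\<^sub>R outer_product (jacobian P (at (u x)) *v \<zeta>) \<eta>)) has_real_derivative q1 s) (at s)"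
        "(q1 has_real_derivative ?Q) (at 0)" by auto
      have "(\<lambda>t. F x (u x) (G x + t *\<^sub>R outer_product (jacobian P (at (u x)) *v \<zeta>) \<eta>)) = line_density \<zeta> \<eta> x"
        using xV by (simp add: line_density_def direction_def J_def fun_eq_iff)
      from second_difference_negative[OF q1(1)[unfolded this] q1(2) Q] obtain s0 where
        s0: "s0 > 0" "\<And>s. s \<noteq> 0 \<Longrightarrow> \<bar>s\<bar> < s0 \<Longrightarrow> line_density \<zeta> \<eta> x s + line_density \<zeta> \<eta> x (- s) < 2 * line_density \<zeta> \<eta> x 0"
        by blast
      obtain j where "1 / real (Suc j) < s0 / \<delta>0"
        using nat_approx_posE[of "s0 / \<delta>0"] s0(1) \<delta>0(1) by auto
      then have j: "\<delta>0 / real (Suc j) < s0" using \<delta>0(1) by (simp add: field_simps)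
      have j0: "0 < \<delta>0 / real (Suc j)" using \<delta>0(1) by simp
      obtain c where c: "c > 0" "\<And>y. second_difference \<zeta> \<eta> (\<delta>0 / real (Suc j)) x y \<le> - c"
        using second_difference_negative_uniform[OF x s0(2) j0 j] by blast
      obtain q where q: "1 / real (Suc q) < c" using nat_approx_posE[OF c(1)] by blast
      obtain y where "second_difference \<zeta> \<eta> (\<delta>0 / real (Suc j)) x y > - (1 / real (Suc q))"
        using elim xV by blast
      with c(2)[of y] q show False by linarith
    qed
  qed
qed

end

text \<open>After changing \<open>n\<close> on a null set it is Lipschitz and \<open>M\<close>-valued near \<open>x0\<close>. The exceptional sets for
  countably many directions combine to one, by continuity of the form in the directions.\<close>

lemma legendre_locally:
  fixes \<Omega> :: "(real^'d) set" and M U O' :: "(real^'k) set"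
    and P :: "real^'k \<Rightarrow> real^'k" and F :: "real^'d \<Rightarrow> real^'k \<Rightarrow> real^'d^'k \<Rightarrow> real" and n :: "real^'d \<Rightarrow> real^'k"
  assumes \<Omega>: "open \<Omega>" "bounded \<Omega>" and M: "compact M"
    and U: "open U" "M \<subseteq> U" and npp: "nearest_point_projection M U P" and P: "Ck_on 1 P U"
    and F: "continuous_on (closure \<Omega> \<times> M \<times> UNIV) (\<lambda>(x, u, A). F x u A)"
    and O: "open O'" "M \<subseteq> O'" and C2: "\<forall>x\<in>\<Omega>. Ck_on 2 (\<lambda>(u, A). F x u A) (O' \<times> UNIV)"
    and n: "n \<in> W1_into \<Omega> \<infinity> M" and min: "weak_local_minimizer \<Omega> \<Gamma> M n\<^sub>0 F n"
    and x0: "x0 \<in> \<Omega>"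
  shows "\<exists>r>0. AE x in lebesgue. x \<in> ball x0 r \<longrightarrow> (\<forall>(\<eta> :: real^'d) (\<zeta> :: real^'k). 0 \<le>
    (\<Sum>i\<in>UNIV. \<Sum>r\<in>UNIV. \<Sum>j\<in>UNIV. \<Sum>l\<in>UNIV.
       entry_deriv i j (entry_deriv r l (F x (n x))) (weak_gradient \<Omega> n x) * \<eta> $ j * \<eta> $ l *
       (jacobian P (at (n x)) *v \<zeta>) $ i * (jacobian P (at (n x)) *v \<zeta>) $ r))"
proof -
  have nM: "AE x in lebesgue_on \<Omega>. n x \<in> M" and nL: "n \<in> Lp_space \<Omega> \<infinity>"
    using n by (auto simp: W1_into_def W1_def)
  have nm: "n \<in> borel_measurable (lebesgue_on \<Omega>)" using nL by (simp add: Lp_space_def)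
  obtain G' where G'L: "G' \<in> Lp_space \<Omega> \<infinity>" and nG': "has_weak_gradient \<Omega> n G'"
    using n by (auto simp: W1_into_def W1_def)
  obtain C where C0: "C \<ge> 0" and C: "AE x in lebesgue_on \<Omega>. norm (G' x) \<le> C"
    using Lp_space_infinity_bounded[OF G'L] by blast
  \<comment> \<open>a representative of the gradient that is bounded everywhere\<close>
  define G where "G x = (if norm (G' x) \<le> C then G' x else 0)" for x
  have GG': "AE x in lebesgue_on \<Omega>. G' x = G x" using C by eventually_elim (simp add: G_def)
  have Gm: "G \<in> borel_measurable (lebesgue_on \<Omega>)"
    by (rule borel_measurable_lebesgue_on_cong_AE[OF \<Omega>(1) GG']) (use G'L in \<open>simp add: Lp_space_def\<close>)
  have Gb: "norm (G x) \<le> C" for x using C0 by (simp add: G_def)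
  have nG: "has_weak_gradient \<Omega> n G" by (rule has_weak_gradient_cong_AE[OF \<Omega>(1) _ GG' nG']) simp
  obtain R where R: "R > 0" "ball x0 R \<subseteq> \<Omega>" using openE[OF \<Omega>(1) x0] by blast
  define r0 where "r0 = R / 4"
  have r0: "r0 > 0" "ball x0 (4 * r0) \<subseteq> \<Omega>" using R by (auto simp: r0_def)
  have r0\<Omega>: "ball x0 r0 \<subseteq> \<Omega>" using r0 subset_ball[of r0 "4 * r0" x0] by auto
  obtain h L where L: "L-lipschitz_on (ball x0 r0) h" and nh: "AE x in lebesgue. x \<in> ball x0 r0 \<longrightarrow> n x = h x"
    using has_weak_gradient_lipschitz_representative[OF r0(1)
        has_weak_gradient_mono[OF \<Omega>(1) open_ball r0(2) nG], of C] Gb by auto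
  have ch: "continuous_on (ball x0 r0) h" by (rule lipschitz_on_continuous_on[OF L])
  have hM: "h x \<in> M" if x: "x \<in> ball x0 r0" for x
  proof (rule ccontr)
    assume hx: "h x \<notin> M"
    have "open (ball x0 r0 \<inter> h -` (- M))"
      using M by (intro continuous_open_preimage ch open_ball open_Compl compact_imp_closed)
    moreover have "ball x0 r0 \<inter> h -` (- M) \<noteq> {}" using x hx by blast
    moreover have "AE x in lebesgue. (x \<in> ball x0 r0 \<longrightarrow> n x = h x) \<and> (x \<in> \<Omega> \<longrightarrow> n x \<in> M)"
      using nh nM unfolding AE_lebesgue_on_iff[OF \<Omega>(1)] by eventually_elim blast
    ultimately obtain y where "y \<in> ball x0 r0 \<inter> h -` (- M)" "y \<in> ball x0 r0 \<longrightarrow> n y = h y" "y \<in> \<Omega> \<longrightarrow> n y \<in> M"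
      using AE_lebesgue_open_ex[of _ "ball x0 r0 \<inter> h -` (- M)"] by blast
    then show False using r0\<Omega> by auto
  qed
  define y0 where "y0 = h x0"
  have y0: "y0 \<in> M" "y0 \<in> U" using hM[of x0] r0(1) U(2) by (auto simp: y0_def)
  obtain S where S: "S > 0" "cball y0 S \<subseteq> U" using open_contains_cball_eq[OF U(1)] y0(2) by blast
  define \<rho> where "\<rho> = S / 3"
  have \<rho>: "\<rho> > 0" "cball y0 (3 * \<rho>) \<subseteq> U" "ball y0 (3 * \<rho>) \<subseteq> U" using S by (auto simp: \<rho>_def)
  have L0: "L \<ge> 0" by (rule lipschitz_on_nonneg[OF L])
  \<comment> \<open>on a ball of this radius the \<open>L\<close>-Lipschitz map \<open>h\<close> stays within \<open>\<rho>\<close> of its central value\<close>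
  define r where "r = min r0 (\<rho> / (L + 1))"
  have r: "r > 0" "r \<le> r0" "r \<le> \<rho> / (L + 1)" using r0(1) \<rho>(1) L0 by (auto simp: r_def)
  define V where "V = ball x0 r"
  have V: "open V" "V \<subseteq> ball x0 r0" using r(2) by (auto simp: V_def)
  have hV: "h ` V \<subseteq> ball y0 \<rho>"
  proof
    fix y assume "y \<in> h ` V"
    then obtain x where x: "x \<in> V" "y = h x" by blast
    have "dist (h x0) (h x) \<le> L * dist x0 x"
      using V(2) x(1) r0(1) by (intro lipschitz_onD[OF L]) auto
    also have "\<dots> \<le> L * (\<rho> / (L + 1))" using x(1) r(3) L0 by (intro mult_left_mono) (auto simp: V_def)
    also have "\<dots> < \<rho>" using \<rho>(1) L0 by (simp add: field_simps)
    finally show "y \<in> ball y0 \<rho>" using x(2) by (simp add: y0_def)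
  qed
  have P': "Ck_on (Suc 0) P U" using P by simp
  have Pd: "P differentiable (at y)" if "y \<in> U" for y using P' that by simp
  have Pc: "continuous_on U (\<lambda>y. frechet_derivative P (at y) w)" for w using P' by simp
  obtain LP where LP: "LP-lipschitz_on (ball y0 (3 * \<rho>)) P"
    using lipschitz_on_ball_of_continuous_derivative[of y0 "3 * \<rho>" P] \<rho>(2) Pd continuous_on_subset[OF Pc] by blast
  have PM: "P y \<in> M" if "y \<in> U" for y using npp that by (simp add: nearest_point_projection_def)
  have Pid: "P y = y" if y: "y \<in> M" for y
  proof (rule ccontr)
    assume "P y \<noteq> y"
    then have "dist y (P y) < dist y y" using npp y U(2) unfolding nearest_point_projection_def by (metis subsetD)
    then show False by simp
  qed
  \<comment> \<open>equal to \<open>n\<close> almost everywhere in \<open>\<Omega>\<close>, and with values in \<open>M\<close> everywhere\<close>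
  define u where "u x = (if x \<in> V then h x else if x \<in> \<Omega> \<and> n x \<in> M then n x else y0)" for x
  have nu: "AE x in lebesgue_on \<Omega>. n x = u x"
    using nh nM unfolding AE_lebesgue_on_iff[OF \<Omega>(1)]
    by eventually_elim (use V(2) in \<open>auto simp: u_def\<close>)
  have un: "AE x in lebesgue_on \<Omega>. u x = n x" using nu by eventually_elim simp
  interpret projected_variation_energy \<Omega> V M P y0 \<rho> C L LP u G F
  proof
    show "open \<Omega>" "bounded \<Omega>" "compact M" "open V" by (fact \<Omega> M V)+
    show "V \<subseteq> \<Omega>" using V(2) r0\<Omega> by blast
    show "u \<in> borel_measurable (lebesgue_on \<Omega>)" by (rule borel_measurable_lebesgue_on_cong_AE[OF \<Omega>(1) nu nm])
    show "u x \<in> M" if "x \<in> \<Omega>" for x using hM V(2) y0(1) by (auto simp: u_def)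
    show "has_weak_gradient \<Omega> u G" by (rule has_weak_gradient_cong_AE[OF \<Omega>(1) nu _ nG]) simp
    show "G \<in> borel_measurable (lebesgue_on \<Omega>)" by (rule Gm)
    show "norm (G x) \<le> C" for x by (rule Gb)
    have "L-lipschitz_on V h" by (rule lipschitz_on_subset[OF L V(2)])
    then show "L-lipschitz_on V u" unfolding lipschitz_on_def by (simp add: u_def)
    show "0 < \<rho>" by (rule \<rho>(1))
    show "u ` V \<subseteq> ball y0 \<rho>" using hV by (auto simp: u_def)
    show "LP-lipschitz_on (ball y0 (3 * \<rho>)) P" by (rule LP)
    show "P differentiable (at y)" if "y \<in> ball y0 (3 * \<rho>)" for y using Pd that \<rho>(3) by blast
    show "continuous_on (ball y0 (3 * \<rho>)) (\<lambda>y. frechet_derivative P (at y) w)" for w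
      by (rule continuous_on_subset[OF Pc \<rho>(3)])
    show "P y \<in> M" if "y \<in> ball y0 (3 * \<rho>)" for y using PM that \<rho>(3) by blast
    show "P y = y" if "y \<in> M" for y using Pid that .
    show "continuous_on (closure \<Omega> \<times> M \<times> UNIV) (\<lambda>(x, v, A). F x v A)" by (rule F)
  qed
  obtain \<epsilon> where \<epsilon>: "\<epsilon> > 0" and minn: "\<And>m. m \<in> admissible \<Omega> \<Gamma> M n\<^sub>0 \<Longrightarrow>
      W1_norm \<Omega> \<infinity> (\<lambda>x. n x - m x) < ennreal \<epsilon> \<Longrightarrow> energy \<Omega> F n \<le> energy \<Omega> F m"
    and nadm: "n \<in> admissible \<Omega> \<Gamma> M n\<^sub>0"
    using min unfolding weak_local_minimizer_def by blast
  have uadm: "u \<in> admissible \<Omega> \<Gamma> M n\<^sub>0" by (rule admissible_cong_AE[OF \<Omega>(1) nadm nu])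
  have minu: "energy \<Omega> F u \<le> energy \<Omega> F m"
    if m: "m \<in> admissible \<Omega> \<Gamma> M n\<^sub>0" and w: "W1_norm \<Omega> \<infinity> (\<lambda>x. u x - m x) < ennreal \<epsilon>" for m
  proof -
    have mm: "m \<in> borel_measurable (lebesgue_on \<Omega>)"
      using m by (auto simp: admissible_def W1_into_def W1_def Lp_space_def)
    have "W1_norm \<Omega> \<infinity> (\<lambda>x. n x - m x) = W1_norm \<Omega> \<infinity> (\<lambda>x. u x - m x)"
      by (rule W1_norm_infinity_cong_AE[OF \<Omega>(1) borel_measurable_diff[OF nm mm]])
         (use nu in \<open>eventually_elim, simp\<close>)
    then show ?thesis using minn[OF m] w energy_cong_AE[OF un] by simp
  qed
  define Q where "Q x p = (\<Sum>i\<in>UNIV. \<Sum>r\<in>UNIV. \<Sum>j\<in>UNIV. \<Sum>l\<in>UNIV.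
       entry_deriv i j (entry_deriv r l (F x (u x))) (G x) * fst p $ j * fst p $ l *
       (jacobian P (at (u x)) *v snd p) $ i * (jacobian P (at (u x)) *v snd p) $ r)"
    for x and p :: "(real^'d) \<times> (real^'k)"
  obtain D :: "((real^'d) \<times> (real^'k)) set" where D: "countable D" "\<And>X. open X \<Longrightarrow> X \<noteq> {} \<Longrightarrow> \<exists>d\<in>D. d \<in> X"
    by (rule countable_dense_setE) blast
  have "AE x in lebesgue. \<forall>p\<in>D. x \<in> V \<longrightarrow> 0 \<le> Q x p"
    unfolding AE_ball_countable[OF D(1)] Q_def
    by (intro ballI legendre_fixed_direction[OF uadm \<epsilon> minu O]) (use C2 in auto)
  moreover have "AE x in lebesgue. x \<in> \<Omega> \<longrightarrow> n x = u x \<and> weak_gradient \<Omega> n x = G x"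
    using nu weak_gradient_AE_eq[OF \<Omega>(1) nG] unfolding AE_lebesgue_on_iff[OF \<Omega>(1)] by eventually_elim blast
  ultimately have "AE x in lebesgue. x \<in> ball x0 r \<longrightarrow> (\<forall>(\<eta> :: real^'d) (\<zeta> :: real^'k). 0 \<le>
    (\<Sum>i\<in>UNIV. \<Sum>r\<in>UNIV. \<Sum>j\<in>UNIV. \<Sum>l\<in>UNIV.
       entry_deriv i j (entry_deriv r l (F x (n x))) (weak_gradient \<Omega> n x) * \<eta> $ j * \<eta> $ l *
       (jacobian P (at (n x)) *v \<zeta>) $ i * (jacobian P (at (n x)) *v \<zeta>) $ r))"
  proof eventually_elim
    case (elim x)
    show ?case
    proof (intro impI allI)
      fix \<eta> :: "real^'d" and \<zeta> :: "real^'k"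
      assume "x \<in> ball x0 r"
      then have xV: "x \<in> V" and x\<Omega>: "x \<in> \<Omega>" using V(2) r0\<Omega> by (auto simp: V_def)
      have cQ: "continuous_on UNIV (Q x)"
        unfolding Q_def[abs_def] by (intro continuous_intros)
      have "0 \<le> Q x p" for p
      proof (rule ccontr)
        assume "\<not> 0 \<le> Q x p"
        then have "p \<in> {p. Q x p < 0}" by simp
        moreover have "open {p. Q x p < 0}" by (intro open_Collect_less cQ continuous_on_const)
        ultimately obtain d where "d \<in> D" "Q x d < 0" using D(2)[of "{p. Q x p < 0}"] by blast
        then show False using elim(1) xV by fastforce
      qed
      from this[of "(\<eta>, \<zeta>)"] show "0 \<le> (\<Sum>i\<in>UNIV. \<Sum>r\<in>UNIV. \<Sum>j\<in>UNIV. \<Sum>l\<in>UNIV.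
         entry_deriv i j (entry_deriv r l (F x (n x))) (weak_gradient \<Omega> n x) * \<eta> $ j * \<eta> $ l *
         (jacobian P (at (n x)) *v \<zeta>) $ i * (jacobian P (at (n x)) *v \<zeta>) $ r)"
        using elim(2) x\<Omega> by (simp add: Q_def)
    qed
  qed
  then show ?thesis using r(1) by blast
qed

text \<open>By the Lindeloef property, countably many of the balls suffice.\<close>

lemma AE_lebesgue_locally:
  fixes \<Omega> :: "'a::euclidean_space set"
  assumes l: "\<And>x0. x0 \<in> \<Omega> \<Longrightarrow> \<exists>r>0. AE x in lebesgue. x \<in> ball x0 r \<longrightarrow> Q x"
  shows "AE x in lebesgue. x \<in> \<Omega> \<longrightarrow> Q x"
proof -
  define S where "S = {x\<in>\<Omega>. \<not> Q x}"
  have "negligible S"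
  proof (subst locally_negligible_alt, intro ballI)
    fix x0 assume x0: "x0 \<in> S"
    then obtain r where r: "r > 0" "AE x in lebesgue. x \<in> ball x0 r \<longrightarrow> Q x" using l by (auto simp: S_def)
    obtain N where N: "N \<in> null_sets lebesgue" "{x \<in> space lebesgue. \<not> (x \<in> ball x0 r \<longrightarrow> Q x)} \<subseteq> N"
      using r(2) unfolding eventually_ae_filter by blast
    have "S \<inter> ball x0 r \<subseteq> N" using N(2) by (auto simp: S_def)
    then have "negligible (S \<inter> ball x0 r)" using N(1) negligible_iff_null_sets negligible_subset by blast
    then show "\<exists>U. openin (top_of_set S) U \<and> x0 \<in> U \<and> negligible U"
      using x0 r(1) by (intro exI[of _ "S \<inter> ball x0 r"]) (auto intro: openin_open_Int)
  qed
  then have "S \<in> null_sets lebesgue" by (simp add: negligible_iff_null_sets)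
  then show ?thesis by (rule AE_I') (auto simp: S_def)
qed

theorem theorem10:
  fixes \<Omega> \<Gamma>\<^sub>1 \<Gamma>\<^sub>2 :: "(real^'d) set"
    and M U O' :: "(real^'k) set"
    and m :: nat
    and P :: "real^'k \<Rightarrow> real^'k"
    and F :: "real^'d \<Rightarrow> real^'k \<Rightarrow> real^'d^'k \<Rightarrow> real"
    and n\<^sub>0 n :: "real^'d \<Rightarrow> real^'k"
  assumes "bounded \<Omega>" and "lipschitz_domain \<Omega>"
    and "openin (top_of_set (frontier \<Omega>)) \<Gamma>\<^sub>1" and "openin (top_of_set (frontier \<Omega>)) \<Gamma>\<^sub>2"
    and "\<Gamma>\<^sub>1 \<in> sets borel" and "\<Gamma>\<^sub>2 \<in> sets borel"
    and "\<Gamma>\<^sub>1 \<inter> \<Gamma>\<^sub>2 = {}" and "frontier \<Omega> = closure \<Gamma>\<^sub>1 \<union> closure \<Gamma>\<^sub>2"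
    and "closed M" and "bounded M" and "submanifold 4 m M"
    and "open U" and "M \<subseteq> U" and "nearest_point_projection M U P" and "Ck_on 3 P U"
    and "continuous_on (closure \<Omega> \<times> M \<times> UNIV) (\<lambda>(x, u, A). F x u A)"
    and "open O'" and "M \<subseteq> O'" and "O' \<subseteq> U"
    and "\<forall>x\<in>\<Omega>. Ck_on 2 (\<lambda>(u, A). F x u A) (O' \<times> UNIV)"
    and "n\<^sub>0 \<in> W1_into \<Omega> 1 M"
    and "n \<in> admissible \<Omega> \<Gamma>\<^sub>1 M n\<^sub>0 \<inter> W1_into \<Omega> \<infinity> M"
    and "weak_local_minimizer \<Omega> \<Gamma>\<^sub>1 M n\<^sub>0 F n"
  shows "AE x in lebesgue_on \<Omega>. \<forall>(\<eta> :: real^'d) (\<zeta> :: real^'k).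
    (\<Sum>i\<in>UNIV. \<Sum>r\<in>UNIV. \<Sum>j\<in>UNIV. \<Sum>l\<in>UNIV.
       entry_deriv i j (entry_deriv r l (F x (n x))) (weak_gradient \<Omega> n x) * \<eta> $ j * \<eta> $ l *
       (jacobian P (at (n x)) *v \<zeta>) $ i * (jacobian P (at (n x)) *v \<zeta>) $ r) \<ge> 0"
proof -
  have \<Omega>: "open \<Omega>" using \<open>lipschitz_domain \<Omega>\<close> by (simp add: lipschitz_domain_def)
  have M: "compact M" using \<open>closed M\<close> \<open>bounded M\<close> by (simp add: compact_eq_bounded_closed)
  have P: "Ck_on 1 P U"
    using Ck_on_pred[OF \<open>open U\<close>, of 2 P] Ck_on_pred[OF \<open>open U\<close>, of 1 P] \<open>Ck_on 3 P U\<close>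
    by (simp only: numeral_3_eq_3 numeral_2_eq_2 One_nat_def)
  have "AE x in lebesgue. x \<in> \<Omega> \<longrightarrow> (\<forall>(\<eta> :: real^'d) (\<zeta> :: real^'k). 0 \<le>
    (\<Sum>i\<in>UNIV. \<Sum>r\<in>UNIV. \<Sum>j\<in>UNIV. \<Sum>l\<in>UNIV.
       entry_deriv i j (entry_deriv r l (F x (n x))) (weak_gradient \<Omega> n x) * \<eta> $ j * \<eta> $ l *
       (jacobian P (at (n x)) *v \<zeta>) $ i * (jacobian P (at (n x)) *v \<zeta>) $ r))"
    using assms by (intro AE_lebesgue_locally legendre_locally[OF \<Omega> _ M _ _ _ P]) auto
  then show ?thesis unfolding AE_lebesgue_on_iff[OF \<Omega>] .
qed

end
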